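(* Fix an abelian group $A$. The duals of the natural chain maps $\nabla\colon C^{\mathrm{Tot}}_\bullet\to C^\Delta_\bullet$, $\Pi\colon C^\Delta_\bullet\to C^{\bowtie}_\bullet$ and $\Psi\colon C^{\bowtie}_\bullet\to C^{\mathrm{Tot}}_\bullet$ (i.e. precomposition with $\nabla,\Pi,\Psi$ on $\mathrm{Hom}(-,A)$) induce natural isomorphisms $$H_{\bowtie}^\bullet(\,\cdot\,;A)\cong H_{\Delta}^\bullet(\,\cdot\,;A)\cong H_{\mathrm{Tot}}^\bullet(\,\cdot\,;A)$$ of cohomology functors with coefficients in $A$ on the category of matched pairs.
   Context: Cohomology with coefficients in $A$ of a chain complex $(C_\bullet,d_\bullet)$ means the cohomology of the cochain complex $(\mathrm{Hom}(C_\bullet,A),d_\bullet^* )$; $H^\bullet_{\bowtie},H^\bullet_\Delta,H^\bullet_{\mathrm{Tot}}$ are the cohomologies of the three complexes defined below. Categories. A small category $\mathcal C$ is identified with its set of morphisms; $\mathcal C^0\subseteq\mathcal C$ is the set of identity morphisms (= objects); $r,s\colon\mathcal C\to\mathcal C^0$ are codomain and domain; $cc'$ is defined iff $s(c)=r(c')$. For $n\ge1$, $\mathcal C^n$ is the set of composable $n$-tuples ($s(c_i)=r(c_{i+1})$). If $\mathcal C^0=\mathcal D^0$, $\mathcal C*\mathcal D=\{(c,d): s(c)=r(d)\}$, and similarly $\mathcal C^p*\mathcal D^q$ (with $\mathcal C^0*\mathcal D^q=\mathcal D^q$, $\mathcal C^p*\mathcal D^0=\mathcal C^p$). Matched pairs.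 A matched pair consists of small categories $\mathcal C,\mathcal D$ with $\mathcal C^0=\mathcal D^0$ and maps $\triangleright\colon\mathcal C*\mathcal D\to\mathcal D$, $\triangleleft\colon\mathcal C*\mathcal D\to\mathcal C$ such that $\triangleright$ is a left action ($r(d)\triangleright d=d$, $r(c\triangleright d)=r(c)$, $(c_1c_2)\triangleright d=c_1\triangleright(c_2\triangleright d)$, $c\triangleright s(c)=r(c)$), $\triangleleft$ is a right action ($c\triangleleft s(c)=c$, $s(c\triangleleft d)=s(d)$, $c\triangleleft(d_1d_2)=(c\triangleleft d_1)\triangleleft d_2$, $r(d)\triangleleft d=s(d)$), and for all composable $(c_1,c_2,d_1,d_2)$: $s(c_2\triangleright d_1)=r(c_2\triangleleft d_1)$; $c_2\triangleright(d_1d_2)=(c_2\triangleright d_1)((c_2\triangleleft d_1)\triangleright d_2)$; $(c_1c_2)\triangleleft d_1=(c_1\triangleleft(c_2\triangleright d_1))(c_2\triangleleft d_1)$. A morphism $(\mathcal C,\mathcal D)\to(\mathcal C',\mathcal D')$ is a pair of functors $f^L\colon\mathcal C\to\mathcal C'$, $f^R\colon\mathcal D\to\mathcal D'$ such that for $(c,d)\in\mathcal C*\mathcal D$: $(f^L(c),f^R(d))\in\mathcal C'*\mathcal D'$, $f^L(c)\triangleright f^R(d)=f^R(c\triangleright d)$, $f^L(c)\triangleleft f^R(d)=f^L(c\triangleleft d)$. Zappa–Szép product. $\mathcal C\bowtie\mathcal D$ is the category with morphism set $\mathcal D*\mathcal C$ (write $dc$ for $(d,c)$), objects $\mathcal C^0$,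 $r(dc)=r(d)$, $s(dc)=s(c)$, composition $(d_1c_1)(d_2c_2)=\big(d_1(c_1\triangleright d_2)\big)\big((c_1\triangleleft d_2)c_2\big)$. For $\zeta=dc$ call $d$ its $\mathcal D$-part and $c$ its $\mathcal C$-part. Categorical complex. For a small category $\mathcal E$, $C_k(\mathcal E)=\mathbb Z\mathcal E^k$ with $d_k\colon C_{k+1}(\mathcal E)\to C_k(\mathcal E)$, $d_k=\sum_{i=0}^{k+1}(-1)^i\partial^i_k$, where $\partial^0_k[e_0,\dots,e_k]=[e_1,\dots,e_k]$, $\partial^i_k[e_0,\dots,e_k]=[e_0,\dots,e_{i-1}e_i,\dots,e_k]$ for $1\le i\le k$, $\partial^{k+1}_k[e_0,\dots,e_k]=[e_0,\dots,e_{k-1}]$, and $\partial_0^0[e]=[s(e)]$, $\partial^1_0[e]=[r(e)]$. Put $C^{\bowtie}_\bullet(\mathcal C,\mathcal D)=C_\bullet(\mathcal C\bowtie\mathcal D)$. Actions on tuples. $c\triangleright(d_1,\dots,d_q)=(c\triangleright d_1,(c\triangleleft d_1)\triangleright d_2,\dots,(c\triangleleft(d_1\cdots d_{q-1}))\triangleright d_q)$ and $(c_1,\dots,c_p)\triangleleft d=(c_1\triangleleft((c_2\cdots c_p)\triangleright d),\dots,c_{p-1}\triangleleft(c_p\triangleright d),c_p\triangleleft d)$. Bisimplicial structure. $C_{p,q}=\mathbb Z(\mathcal C^p*\mathcal D^q)$. Horizontal faces $\partial^{h,i}\colon C_{p+1,q}\to C_{p,q}$ ($0\le i\le p+1$):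 for $q\ge1$, $\partial^{h,0}[c_0,\dots,c_p;d]=[c_1,\dots,c_p;d]$, $\partial^{h,i}[c_0,\dots,c_p;d]=[c_0,\dots,c_{i-1}c_i,\dots,c_p;d]$ for $1\le i\le p$, $\partial^{h,p+1}[c_0,\dots,c_p;d]=[c_0,\dots,c_{p-1};c_p\triangleright d]$; for $q=0$ they are the faces $\partial^i_p$ of $C_\bullet(\mathcal C)$. Unsigned vertical faces $\partial^{v,j}\colon C_{p,q+1}\to C_{p,q}$ ($0\le j\le q+1$): for $p\ge1$, $\partial^{v,0}[c;d_0,\dots,d_q]=[c\triangleleft d_0;d_1,\dots,d_q]$, $\partial^{v,j}[c;d_0,\dots,d_q]=[c;d_0,\dots,d_{j-1}d_j,\dots,d_q]$ for $1\le j\le q$, $\partial^{v,q+1}[c;d_0,\dots,d_q]=[c;d_0,\dots,d_{q-1}]$; for $p=0$ they are the faces of $C_\bullet(\mathcal D)$. Unsigned degeneracies: $\sigma^{h,i}$ ($0\le i\le p$) on $C_{p,q}$ inserts an identity morphism into the $\mathcal C$-tuple $(c_0,\dots,c_{p-1})$ immediately before $c_i$ (at the end if $i=p$); $\sigma^{v,j}$ ($0\le j\le q$) does the same in the $\mathcal D$-tuple. Diagonal complex. $C^\Delta_k=C_{k,k}$, $d^\Delta_k=\sum_{i=0}^{k+1}(-1)^i\partial^{h,i}\partial^{v,i}\colon C^\Delta_{k+1}\to C^\Delta_k$. Total complex. $C^{\mathrm{Tot}}_k=\bigoplus_{p+q=k}C_{p,q}$; the differential is the sum of $d^h=\sum_i(-1)^i\partial^{h,i}\colon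 C_{p+1,q}\to C_{p,q}$ and $d^v=(-1)^p\sum_j(-1)^j\partial^{v,j}\colon C_{p,q+1}\to C_{p,q}$. Maps. $\nabla$ on $C_{p,q}$ is $\sum_\beta\mathrm{sgn}(\beta)\,\sigma^{h,\beta(p+q)-1}\cdots\sigma^{h,\beta(p+1)-1}\sigma^{v,\beta(p)-1}\cdots\sigma^{v,\beta(1)-1}$, summed over $(p,q)$-shuffles $\beta$, i.e. permutations of $\{1,\dots,p+q\}$ with $\beta(1)<\dots<\beta(p)$ and $\beta(p+1)<\dots<\beta(p+q)$. $\Pi_0=\mathrm{id}$, and recursively: if $\Pi_{k-1}(c_2,\dots,c_k,d_1,\dots,d_{k-1})=(e_1b_1,\dots,e_{k-1}b_{k-1})$ with $e_i\in\mathcal D$, $b_i\in\mathcal C$, and $b_0:=c_1$, $e_k:=d_k$, then $\Pi_k[c_1,\dots,c_k;d_1,\dots,d_k]$ is the generator of $C_k^{\bowtie}$ whose $i$-th entry is $(b_{i-1}\triangleright e_i)(b_{i-1}\triangleleft e_i)$, $1\le i\le k$. $\Psi_k=\sum_{p+q=k}\Psi_{p,q}$, where $\Psi_{p,q}[d_1c_1,\dots,d_kc_k]=[c_1\triangleleft v_2,\,\dots,\,c_{p-1}\triangleleft v_p,\,c_p;\ d_{p+1},\,u_{p+1}\triangleright d_{p+2},\,\dots,\,u_{k-1}\triangleright d_k]$, with $v_i$ the $\mathcal D$-part of $(d_ic_i)\cdots(d_pc_p)$ and $u_j$ the $\mathcal C$-part of $(d_{p+1}c_{p+1})\cdots(d_jc_j)$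 in $\mathcal C\bowtie\mathcal D$; $\Psi_0=\mathrm{id}$. *)

theory Defs
  imports "HOL-Algebra.Free_Abelian_Groups" "HOL-Combinatorics.Permutations"
begin

section \<open>Small categories and matched pairs\<close>

text \<open>
  A small category is identified with its set of morphisms; objects are the identity morphisms.
  \<open>tgt\<close> and \<open>src\<close> are the codomain and domain maps, usually written \<open>r\<close> and \<open>s\<close>, and
  \<open>cmp E c c'\<close> is meaningful iff \<open>src E c = tgt E c'\<close>.
\<close>

record 'm cat =
  Mor :: "'m set"
  tgt :: "'m \<Rightarrow> 'm"
  src :: "'m \<Rightarrow> 'm"
  cmp :: "'m \<Rightarrow> 'm \<Rightarrow> 'm"

definition Obj :: "'m cat \<Rightarrow> 'm set" where
  "Obj E = {x \<in> Mor E. tgt E x = x \<and> src E x = x}"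

locale small_category =
  fixes E :: "'m cat"
  assumes tgt_Obj: "c \<in> Mor E \<Longrightarrow> tgt E c \<in> Obj E"
    and src_Obj: "c \<in> Mor E \<Longrightarrow> src E c \<in> Obj E"
    and cmp_Mor: "\<lbrakk>c \<in> Mor E; c' \<in> Mor E; src E c = tgt E c'\<rbrakk> \<Longrightarrow> cmp E c c' \<in> Mor E"
    and tgt_cmp: "\<lbrakk>c \<in> Mor E; c' \<in> Mor E; src E c = tgt E c'\<rbrakk> \<Longrightarrow> tgt E (cmp E c c') = tgt E c"
    and src_cmp: "\<lbrakk>c \<in> Mor E; c' \<in> Mor E; src E c = tgt E c'\<rbrakk> \<Longrightarrow> src E (cmp E c c') = src E c'"
    and cmp_assoc: "\<lbrakk>c \<in> Mor E; c' \<in> Mor E; c'' \<in> Mor E; src E c = tgt E c'; src E c' = tgt E c''\<rbrakk>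
      \<Longrightarrow> cmp E (cmp E c c') c'' = cmp E c (cmp E c' c'')"
    and cmp_tgt: "c \<in> Mor E \<Longrightarrow> cmp E (tgt E c) c = c"
    and cmp_src: "c \<in> Mor E \<Longrightarrow> cmp E c (src E c) = c"

locale matched_pair = C: small_category C + D: small_category D
  for C D :: "'m cat" +
  fixes lact :: "'m \<Rightarrow> 'm \<Rightarrow> 'm" (infixr \<open>\<triangleright>\<close> 75)
    and ract :: "'m \<Rightarrow> 'm \<Rightarrow> 'm" (infixl \<open>\<triangleleft>\<close> 75)
  assumes Obj_eq: "Obj C = Obj D"
    and lact_Mor: "\<lbrakk>c \<in> Mor C; d \<in> Mor D; src C c = tgt D d\<rbrakk> \<Longrightarrow> c \<triangleright> d \<in> Mor D"
    and ract_Mor: "\<lbrakk>c \<in> Mor C; d \<in> Mor D; src C c = tgt D d\<rbrakk> \<Longrightarrow> c \<triangleleft> d \<in> Mor C"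
    and lact_unit: "d \<in> Mor D \<Longrightarrow> tgt D d \<triangleright> d = d"
    and tgt_lact: "\<lbrakk>c \<in> Mor C; d \<in> Mor D; src C c = tgt D d\<rbrakk> \<Longrightarrow> tgt D (c \<triangleright> d) = tgt C c"
    and lact_cmp_left: "\<lbrakk>c1 \<in> Mor C; c2 \<in> Mor C; d \<in> Mor D; src C c1 = tgt C c2; src C c2 = tgt D d\<rbrakk>
      \<Longrightarrow> cmp C c1 c2 \<triangleright> d = c1 \<triangleright> (c2 \<triangleright> d)"
    and lact_src: "c \<in> Mor C \<Longrightarrow> c \<triangleright> src C c = tgt C c"
    and ract_unit: "c \<in> Mor C \<Longrightarrow> c \<triangleleft> src C c = c"
    and src_ract: "\<lbrakk>c \<in> Mor C; d \<in> Mor D; src C c = tgt D d\<rbrakk> \<Longrightarrow> src C (c \<triangleleft> d) = src D d"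
    and ract_cmp_right: "\<lbrakk>c \<in> Mor C; d1 \<in> Mor D; d2 \<in> Mor D; src C c = tgt D d1; src D d1 = tgt D d2\<rbrakk>
      \<Longrightarrow> c \<triangleleft> cmp D d1 d2 = (c \<triangleleft> d1) \<triangleleft> d2"
    and ract_tgt: "d \<in> Mor D \<Longrightarrow> tgt D d \<triangleleft> d = src D d"
    and src_lact: "\<lbrakk>c1 \<in> Mor C; c2 \<in> Mor C; d1 \<in> Mor D; d2 \<in> Mor D;
        src C c1 = tgt C c2; src C c2 = tgt D d1; src D d1 = tgt D d2\<rbrakk>
      \<Longrightarrow> src D (c2 \<triangleright> d1) = tgt C (c2 \<triangleleft> d1)"
    and lact_cmp_right: "\<lbrakk>c1 \<in> Mor C; c2 \<in> Mor C; d1 \<in> Mor D; d2 \<in> Mor D;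
        src C c1 = tgt C c2; src C c2 = tgt D d1; src D d1 = tgt D d2\<rbrakk>
      \<Longrightarrow> c2 \<triangleright> cmp D d1 d2 = cmp D (c2 \<triangleright> d1) ((c2 \<triangleleft> d1) \<triangleright> d2)"
    and ract_cmp_left: "\<lbrakk>c1 \<in> Mor C; c2 \<in> Mor C; d1 \<in> Mor D; d2 \<in> Mor D;
        src C c1 = tgt C c2; src C c2 = tgt D d1; src D d1 = tgt D d2\<rbrakk>
      \<Longrightarrow> cmp C c1 c2 \<triangleleft> d1 = cmp C (c1 \<triangleleft> (c2 \<triangleright> d1)) (c2 \<triangleleft> d1)"

record 'm mpair =
  Lcat :: "'m cat"
  Rcat :: "'m cat"
  lact :: "'m \<Rightarrow> 'm \<Rightarrow> 'm"
  ract :: "'m \<Rightarrow> 'm \<Rightarrow> 'm"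

definition is_matched_pair :: "'m mpair \<Rightarrow> bool" where
  "is_matched_pair M \<longleftrightarrow> matched_pair (Lcat M) (Rcat M) (lact M) (ract M)"

definition is_functor :: "'a cat \<Rightarrow> 'b cat \<Rightarrow> ('a \<Rightarrow> 'b) \<Rightarrow> bool" where
  "is_functor E E' f \<longleftrightarrow>
     (\<forall>c\<in>Mor E. f c \<in> Mor E' \<and> f (tgt E c) = tgt E' (f c) \<and> f (src E c) = src E' (f c)) \<and>
     (\<forall>c\<in>Mor E. \<forall>c'\<in>Mor E. src E c = tgt E c' \<longrightarrow> f (cmp E c c') = cmp E' (f c) (f c'))"

text \<open>A morphism of matched pairs is a pair of functors \<open>(f\<^sup>L, f\<^sup>R)\<close>.\<close>

type_synonym ('a, 'b) mpair_map = "('a \<Rightarrow> 'b) \<times> ('a \<Rightarrow> 'b)"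

definition mpair_morphism :: "'a mpair \<Rightarrow> 'b mpair \<Rightarrow> ('a, 'b) mpair_map \<Rightarrow> bool" where
  "mpair_morphism M M' f \<longleftrightarrow>
     is_matched_pair M \<and> is_matched_pair M' \<and>
     is_functor (Lcat M) (Lcat M') (fst f) \<and> is_functor (Rcat M) (Rcat M') (snd f) \<and>
     (\<forall>c\<in>Mor (Lcat M). \<forall>d\<in>Mor (Rcat M). src (Lcat M) c = tgt (Rcat M) d \<longrightarrow>
        src (Lcat M') (fst f c) = tgt (Rcat M') (snd f d) \<and>
        lact M' (fst f c) (snd f d) = snd f (lact M c d) \<and>
        ract M' (fst f c) (snd f d) = fst f (ract M c d))"

definition mpair_id :: "('a, 'a) mpair_map" where
  "mpair_id = (id, id)"

definition mpair_comp :: "('b, 'c) mpair_map \<Rightarrow> ('a, 'b) mpair_map \<Rightarrow> ('a, 'c) mpair_map" where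
  "mpair_comp g f = (fst g \<circ> fst f, snd g \<circ> snd f)"

text \<open>
  The Zappa--Szep product.  A morphism \<open>dc\<close> is the pair \<open>(d, c)\<close>; an object \<open>x\<close> of the two
  factors appears as its identity morphism \<open>(x, x)\<close>.
\<close>

definition zappa_szep :: "'m mpair \<Rightarrow> ('m \<times> 'm) cat" where
  "zappa_szep M =
     \<lparr>Mor = {(d, c). d \<in> Mor (Rcat M) \<and> c \<in> Mor (Lcat M) \<and> src (Rcat M) d = tgt (Lcat M) c},
      tgt = (\<lambda>(d, c). (tgt (Rcat M) d, tgt (Rcat M) d)),
      src = (\<lambda>(d, c). (src (Lcat M) c, src (Lcat M) c)),
      cmp = (\<lambda>(d1, c1) (d2, c2).
               (cmp (Rcat M) d1 (lact M c1 d2), cmp (Lcat M) (ract M c1 d2) c2))\<rparr>"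


section \<open>Chain complexes and cohomology with coefficients\<close>

text \<open>\<open>bdry K k\<close> is the differential from degree \<open>k + 1\<close> to degree \<open>k\<close>.\<close>

record 'x complex =
  chains :: "nat \<Rightarrow> 'x monoid"
  bdry :: "nat \<Rightarrow> 'x \<Rightarrow> 'x"

definition chain_complex :: "'x complex \<Rightarrow> bool" where
  "chain_complex K \<longleftrightarrow>
     (\<forall>k. comm_group (chains K k)) \<and>
     (\<forall>k. bdry K k \<in> hom (chains K (Suc k)) (chains K k)) \<and>
     (\<forall>k. \<forall>x\<in>carrier (chains K (Suc (Suc k))). bdry K k (bdry K (Suc k) x) = \<one>\<^bsub>chains K k\<^esub>)"

definition chain_map :: "'x complex \<Rightarrow> 'y complex \<Rightarrow> (nat \<Rightarrow> 'x \<Rightarrow> 'y) \<Rightarrow> bool" where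
  "chain_map K L \<phi> \<longleftrightarrow>
     chain_complex K \<and> chain_complex L \<and>
     (\<forall>k. \<phi> k \<in> hom (chains K k) (chains L k)) \<and>
     (\<forall>k. \<forall>x\<in>carrier (chains K (Suc k)). \<phi> k (bdry K k x) = bdry L k (\<phi> (Suc k) x))"

text \<open>Homomorphisms are taken extensional, so that equality in \<open>Hom(G, A)\<close> is HOL equality.\<close>

definition Hom_group :: "('x, 'k) monoid_scheme \<Rightarrow> ('g, 'm) monoid_scheme \<Rightarrow> ('x \<Rightarrow> 'g) monoid" where
  "Hom_group G A =
     \<lparr>carrier = hom G A \<inter> extensional (carrier G),
      monoid.mult = (\<lambda>u v. \<lambda>x\<in>carrier G. u x \<otimes>\<^bsub>A\<^esub> v x),
      one = (\<lambda>x\<in>carrier G. \<one>\<^bsub>A\<^esub>)\<rparr>"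

definition dual :: "('x, 'k) monoid_scheme \<Rightarrow> ('x \<Rightarrow> 'y) \<Rightarrow> ('y \<Rightarrow> 'g) \<Rightarrow> 'x \<Rightarrow> 'g" where
  "dual G \<phi> u = compose (carrier G) u \<phi>"

definition cocycles :: "('g, 'm) monoid_scheme \<Rightarrow> 'x complex \<Rightarrow> nat \<Rightarrow> ('x \<Rightarrow> 'g) set" where
  "cocycles A K n =
     kernel (Hom_group (chains K n) A) (Hom_group (chains K (Suc n)) A)
       (dual (chains K (Suc n)) (bdry K n))"

definition coboundaries :: "('g, 'm) monoid_scheme \<Rightarrow> 'x complex \<Rightarrow> nat \<Rightarrow> ('x \<Rightarrow> 'g) set" where
  "coboundaries A K n =
     (case n of
        0 \<Rightarrow> {\<one>\<^bsub>Hom_group (chains K 0) A\<^esub>}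
      | Suc m \<Rightarrow> dual (chains K (Suc m)) (bdry K m) ` carrier (Hom_group (chains K m) A))"

definition cohomology :: "('g, 'm) monoid_scheme \<Rightarrow> 'x complex \<Rightarrow> nat \<Rightarrow> ('x \<Rightarrow> 'g) set monoid" where
  "cohomology A K n =
     (Hom_group (chains K n) A)\<lparr>carrier := cocycles A K n\<rparr> Mod coboundaries A K n"

text \<open>
  The map \<open>H\<^sup>n(L; A) \<rightarrow> H\<^sup>n(K; A)\<close> induced by \<open>\<phi> : K \<rightarrow> L\<close>.  A class \<open>X\<close> is sent to the union of the
  classes of all \<open>u \<circ> \<phi>\<close> with \<open>u \<in> X\<close>; this is a single class precisely when the class of
  \<open>u \<circ> \<phi>\<close> does not depend on \<open>u\<close>.
\<close>

definition cohomology_map ::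
  "('g, 'm) monoid_scheme \<Rightarrow> 'x complex \<Rightarrow> 'y complex \<Rightarrow> (nat \<Rightarrow> 'x \<Rightarrow> 'y) \<Rightarrow> nat \<Rightarrow>
     ('y \<Rightarrow> 'g) set \<Rightarrow> ('x \<Rightarrow> 'g) set" where
  "cohomology_map A K L \<phi> n X =
     coboundaries A K n <#>\<^bsub>Hom_group (chains K n) A\<^esub> (dual (chains K n) (\<phi> n) ` X)"


section \<open>The categorical complex\<close>

definition composable :: "'m cat \<Rightarrow> 'm list \<Rightarrow> bool" where
  "composable E es \<longleftrightarrow> set es \<subseteq> Mor E \<and> successively (\<lambda>e e'. src E e = tgt E e') es"

text \<open>
  \<open>\<E>\<^sup>n\<close> is encoded uniformly in \<open>n\<close>: a composable tuple \<open>es\<close> is stored together with its codomain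
  object \<open>x\<close>, which is redundant for \<open>n \<ge> 1\<close> and is the only datum for \<open>n = 0\<close>.
\<close>

definition nerve :: "'m cat \<Rightarrow> nat \<Rightarrow> ('m \<times> 'm list) set" where
  "nerve E n = {(x, es). x \<in> Obj E \<and> length es = n \<and> composable E es \<and>
                         (es \<noteq> [] \<longrightarrow> tgt E (hd es) = x)}"

text \<open>\<open>[e\<^sub>0, \<dots>, e\<^sub>k] \<mapsto> [e\<^sub>0, \<dots>, e\<^bsub>i-1\<^esub> e\<^sub>i, \<dots>, e\<^sub>k]\<close> for \<open>1 \<le> i \<le> k\<close>.\<close>

definition merge_at :: "'m cat \<Rightarrow> nat \<Rightarrow> 'm list \<Rightarrow> 'm list" where
  "merge_at E i es = take (i - 1) es @ [cmp E (es ! (i - 1)) (es ! i)] @ drop (Suc i) es"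

definition cat_face :: "'m cat \<Rightarrow> nat \<Rightarrow> 'm \<times> 'm list \<Rightarrow> 'm \<times> 'm list" where
  "cat_face E i = (\<lambda>(x, es).
     if i = 0 then (src E (hd es), tl es)
     else if i < length es then (x, merge_at E i es)
     else (x, butlast es))"

definition cat_complex :: "'m cat \<Rightarrow> (('m \<times> 'm list) \<Rightarrow>\<^sub>0 int) complex" where
  "cat_complex E =
     \<lparr>chains = (\<lambda>k. free_Abelian_group (nerve E k)),
      bdry = (\<lambda>k. frag_extend (\<lambda>s. \<Sum>i\<le>Suc k. frag_cmul ((-1) ^ i) (frag_of (cat_face E i s))))\<rparr>"

definition bowtie_complex :: "'m mpair \<Rightarrow> ((('m \<times> 'm) \<times> ('m \<times> 'm) list) \<Rightarrow>\<^sub>0 int) complex" where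
  "bowtie_complex M = cat_complex (zappa_szep M)"


section \<open>The bisimplicial structure\<close>

text \<open>Composite of a nonempty composable tuple.\<close>

fun composite :: "'m cat \<Rightarrow> 'm list \<Rightarrow> 'm" where
  "composite E [] = undefined"
| "composite E [e] = e"
| "composite E (e # e' # es) = cmp E e (composite E (e' # es))"

definition lact_tuple :: "'m mpair \<Rightarrow> 'm \<Rightarrow> 'm list \<Rightarrow> 'm list" where
  "lact_tuple M c ds =
     map (\<lambda>i. lact M (if i = 0 then c else ract M c (composite (Rcat M) (take i ds))) (ds ! i))
       [0..<length ds]"

definition ract_tuple :: "'m mpair \<Rightarrow> 'm list \<Rightarrow> 'm \<Rightarrow> 'm list" where
  "ract_tuple M cs d =
     map (\<lambda>i. ract M (cs ! i)
                (if Suc i = length cs then d else lact M (composite (Lcat M) (drop (Suc i) cs)) d))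
       [0..<length cs]"

text \<open>
  An element of \<open>\<C>\<^sup>p * \<D>\<^sup>q\<close> is stored as \<open>(cs, x, ds)\<close>, where \<open>x\<close> is the object in the middle: the
  domain of the last entry of \<open>cs\<close> and the codomain of the first entry of \<open>ds\<close>.  It is redundant
  unless \<open>p = q = 0\<close>, and it makes the conventions \<open>\<C>\<^sup>0 * \<D>\<^sup>q = \<D>\<^sup>q\<close>, \<open>\<C>\<^sup>p * \<D>\<^sup>0 = \<C>\<^sup>p\<close>, and the separate
  definitions of the faces for \<open>q = 0\<close> resp. \<open>p = 0\<close>, instances of the general formulas.
\<close>

type_synonym 'm bisimplex = "'m list \<times> 'm \<times> 'm list"

definition bisimplices :: "'m mpair \<Rightarrow> nat \<Rightarrow> nat \<Rightarrow> 'm bisimplex set" where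
  "bisimplices M p q = {(cs, x, ds).
     length cs = p \<and> length ds = q \<and> x \<in> Obj (Lcat M) \<and>
     composable (Lcat M) cs \<and> composable (Rcat M) ds \<and>
     (cs \<noteq> [] \<longrightarrow> src (Lcat M) (last cs) = x) \<and>
     (ds \<noteq> [] \<longrightarrow> tgt (Rcat M) (hd ds) = x)}"

definition hface :: "'m mpair \<Rightarrow> nat \<Rightarrow> 'm bisimplex \<Rightarrow> 'm bisimplex" where
  "hface M i = (\<lambda>(cs, x, ds).
     if i = 0 then (tl cs, x, ds)
     else if i < length cs then (merge_at (Lcat M) i cs, x, ds)
     else (butlast cs, tgt (Lcat M) (last cs), lact_tuple M (last cs) ds))"

definition vface :: "'m mpair \<Rightarrow> nat \<Rightarrow> 'm bisimplex \<Rightarrow> 'm bisimplex" where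
  "vface M j = (\<lambda>(cs, x, ds).
     if j = 0 then (ract_tuple M cs (hd ds), src (Rcat M) (hd ds), tl ds)
     else if j < length ds then (cs, x, merge_at (Rcat M) j ds)
     else (cs, x, butlast ds))"

definition hdegen :: "'m mpair \<Rightarrow> nat \<Rightarrow> 'm bisimplex \<Rightarrow> 'm bisimplex" where
  "hdegen M i = (\<lambda>(cs, x, ds).
     (take i cs @ [if i < length cs then tgt (Lcat M) (cs ! i) else x] @ drop i cs, x, ds))"

definition vdegen :: "'m mpair \<Rightarrow> nat \<Rightarrow> 'm bisimplex \<Rightarrow> 'm bisimplex" where
  "vdegen M j = (\<lambda>(cs, x, ds).
     (cs, x, take j ds @ [if j = 0 then x else src (Rcat M) (ds ! (j - 1))] @ drop j ds))"

definition diag_complex :: "'m mpair \<Rightarrow> ('m bisimplex \<Rightarrow>\<^sub>0 int) complex" where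
  "diag_complex M =
     \<lparr>chains = (\<lambda>k. free_Abelian_group (bisimplices M k k)),
      bdry = (\<lambda>k. frag_extend (\<lambda>s. \<Sum>i\<le>Suc k. frag_cmul ((-1) ^ i) (frag_of (hface M i (vface M i s)))))\<rparr>"

text \<open>
  The sets \<open>\<C>\<^sup>p * \<D>\<^sup>q\<close> with \<open>p + q = k\<close> are disjoint, since \<open>p\<close> and \<open>q\<close> are the lengths of the two tuples,
  so the direct sum of the groups they generate is the free abelian group on their union.
\<close>

definition tot_hdiff :: "'m mpair \<Rightarrow> 'm bisimplex \<Rightarrow> 'm bisimplex \<Rightarrow>\<^sub>0 int" where
  "tot_hdiff M = (\<lambda>(cs, x, ds).
     if cs = [] then 0
     else (\<Sum>i\<le>length cs. frag_cmul ((-1) ^ i) (frag_of (hface M i (cs, x, ds)))))"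

definition tot_vdiff :: "'m mpair \<Rightarrow> 'm bisimplex \<Rightarrow> 'm bisimplex \<Rightarrow>\<^sub>0 int" where
  "tot_vdiff M = (\<lambda>(cs, x, ds).
     if ds = [] then 0
     else frag_cmul ((-1) ^ length cs)
            (\<Sum>j\<le>length ds. frag_cmul ((-1) ^ j) (frag_of (vface M j (cs, x, ds)))))"

definition tot_complex :: "'m mpair \<Rightarrow> ('m bisimplex \<Rightarrow>\<^sub>0 int) complex" where
  "tot_complex M =
     \<lparr>chains = (\<lambda>k. free_Abelian_group (\<Union>p\<le>k. bisimplices M p (k - p))),
      bdry = (\<lambda>k. frag_extend (\<lambda>s. tot_hdiff M s + tot_vdiff M s))\<rparr>"


section \<open>The comparison maps\<close>

definition shuffle_perms :: "nat \<Rightarrow> nat \<Rightarrow> (nat \<Rightarrow> nat) set" where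
  "shuffle_perms p q = {\<beta>. \<beta> permutes {1..p + q} \<and>
     strict_mono_on {1..p} \<beta> \<and> strict_mono_on {p + 1..p + q} \<beta>}"

text \<open>\<open>fold\<close> applies the degeneracy of the leftmost list entry first.\<close>

definition nabla_term :: "'m mpair \<Rightarrow> nat \<Rightarrow> nat \<Rightarrow> (nat \<Rightarrow> nat) \<Rightarrow> 'm bisimplex \<Rightarrow> 'm bisimplex" where
  "nabla_term M p q \<beta> s =
     fold (\<lambda>i. hdegen M (\<beta> i - 1)) [p + 1..<p + q + 1]
       (fold (\<lambda>i. vdegen M (\<beta> i - 1)) [1..<p + 1] s)"

definition Nabla :: "'m mpair \<Rightarrow> nat \<Rightarrow> ('m bisimplex \<Rightarrow>\<^sub>0 int) \<Rightarrow> 'm bisimplex \<Rightarrow>\<^sub>0 int" where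
  "Nabla M k = frag_extend (\<lambda>(cs, x, ds).
     \<Sum>\<beta>\<in>shuffle_perms (length cs) (length ds).
       frag_cmul (sign \<beta>) (frag_of (nabla_term M (length cs) (length ds) \<beta> (cs, x, ds))))"

text \<open>
  The recursion for \<open>\<Pi>\<close>: \<open>ebs\<close> lists the entries \<open>e\<^sub>i b\<^sub>i\<close> obtained from
  \<open>(c\<^sub>2, \<dots>, c\<^sub>k, d\<^sub>1, \<dots>, d\<^bsub>k-1\<^esub>)\<close>; then \<open>b\<^sub>0 = c\<^sub>1\<close> is put in front of the \<open>b\<^sub>i\<close> and \<open>e\<^sub>k = d\<^sub>k\<close> after the \<open>e\<^sub>i\<close>.
\<close>

primrec Pi_tuple :: "'m mpair \<Rightarrow> 'm list \<Rightarrow> 'm list \<Rightarrow> ('m \<times> 'm) list" where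
  "Pi_tuple M [] ds = []"
| "Pi_tuple M (c # cs) ds =
     (let ebs = Pi_tuple M cs (butlast ds);
          bs = c # map snd ebs;
          es = map fst ebs @ [last ds]
      in map2 (\<lambda>b e. (lact M b e, ract M b e)) bs es)"

definition Pi_map :: "'m mpair \<Rightarrow> nat \<Rightarrow> ('m bisimplex \<Rightarrow>\<^sub>0 int) \<Rightarrow>
    (('m \<times> 'm) \<times> ('m \<times> 'm) list) \<Rightarrow>\<^sub>0 int" where
  "Pi_map M k = frag_extend (\<lambda>(cs, x, ds).
     let y = (if cs = [] then x else tgt (Lcat M) (hd cs))
     in frag_of ((y, y), Pi_tuple M cs ds))"

text \<open>
  \<open>\<Psi>\<^bsub>p,q\<^esub>\<close> on \<open>zs = [d\<^sub>1c\<^sub>1, \<dots>, d\<^sub>kc\<^sub>k]\<close>.  List positions start at \<open>0\<close>, so \<open>zs ! i = d\<^bsub>i+1\<^esub>c\<^bsub>i+1\<^esub>\<close>.  For \<open>i + 1 < p\<close>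
  the tuple \<open>drop (Suc i) (take p zs)\<close> is \<open>d\<^bsub>i+2\<^esub>c\<^bsub>i+2\<^esub>, \<dots>, d\<^sub>pc\<^sub>p\<close>, with composite having \<open>\<D>\<close>-part \<open>v\<^bsub>i+2\<^esub>\<close>;
  for \<open>j > p\<close> the tuple \<open>drop p (take j zs)\<close> is \<open>d\<^bsub>p+1\<^esub>c\<^bsub>p+1\<^esub>, \<dots>, d\<^sub>jc\<^sub>j\<close>, with composite having \<open>\<C>\<close>-part \<open>u\<^sub>j\<close>.
\<close>

definition Psi_C :: "'m mpair \<Rightarrow> nat \<Rightarrow> ('m \<times> 'm) list \<Rightarrow> 'm list" where
  "Psi_C M p zs =
     map (\<lambda>i. if Suc i = p then snd (zs ! i)
              else ract M (snd (zs ! i)) (fst (composite (zappa_szep M) (drop (Suc i) (take p zs)))))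
       [0..<p]"

definition Psi_D :: "'m mpair \<Rightarrow> nat \<Rightarrow> ('m \<times> 'm) list \<Rightarrow> 'm list" where
  "Psi_D M p zs =
     map (\<lambda>j. if j = p then fst (zs ! j)
              else lact M (snd (composite (zappa_szep M) (drop p (take j zs)))) (fst (zs ! j)))
       [p..<length zs]"

definition Psi_map :: "'m mpair \<Rightarrow> nat \<Rightarrow> ((('m \<times> 'm) \<times> ('m \<times> 'm) list) \<Rightarrow>\<^sub>0 int) \<Rightarrow>
    'm bisimplex \<Rightarrow>\<^sub>0 int" where
  "Psi_map M k = frag_extend (\<lambda>(y, zs).
     \<Sum>p\<le>k. frag_of (Psi_C M p zs,
                     if p = 0 then fst y else src (Lcat M) (snd (zs ! (p - 1))),
                     Psi_D M p zs))"


section \<open>The cohomology functors on matched pairs\<close>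

definition bowtie_push :: "('a, 'b) mpair_map \<Rightarrow> nat \<Rightarrow>
    ((('a \<times> 'a) \<times> ('a \<times> 'a) list) \<Rightarrow>\<^sub>0 int) \<Rightarrow> (('b \<times> 'b) \<times> ('b \<times> 'b) list) \<Rightarrow>\<^sub>0 int" where
  "bowtie_push f k = frag_extend (\<lambda>(y, zs).
     frag_of (map_prod (snd f) (fst f) y, map (map_prod (snd f) (fst f)) zs))"

definition bisimplex_push :: "('a, 'b) mpair_map \<Rightarrow> nat \<Rightarrow>
    ('a bisimplex \<Rightarrow>\<^sub>0 int) \<Rightarrow> 'b bisimplex \<Rightarrow>\<^sub>0 int" where
  "bisimplex_push f k = frag_extend (\<lambda>(cs, x, ds).
     frag_of (map (fst f) cs, fst f x, map (snd f) ds))"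

abbreviation "H_bowtie A M n \<equiv> cohomology A (bowtie_complex M) n"
abbreviation "H_diag A M n \<equiv> cohomology A (diag_complex M) n"
abbreviation "H_tot A M n \<equiv> cohomology A (tot_complex M) n"

abbreviation "H_bowtie_map A M M' f n \<equiv>
  cohomology_map A (bowtie_complex M) (bowtie_complex M') (bowtie_push f) n"
abbreviation "H_diag_map A M M' f n \<equiv>
  cohomology_map A (diag_complex M) (diag_complex M') (bisimplex_push f) n"
abbreviation "H_tot_map A M M' f n \<equiv>
  cohomology_map A (tot_complex M) (tot_complex M') (bisimplex_push f) n"

abbreviation "Pi_star A M n \<equiv> cohomology_map A (diag_complex M) (bowtie_complex M) (Pi_map M) n"
abbreviation "Nabla_star A M n \<equiv> cohomology_map A (tot_complex M) (diag_complex M) (Nabla M) n"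
abbreviation "Psi_star A M n \<equiv> cohomology_map A (bowtie_complex M) (tot_complex M) (Psi_map M) n"

end

theory Submission
  imports Defs
begin

text \<open>
  The proof is by acyclic models.  A bisimplex extends uniquely to a commuting grid of morphisms of
  the two factors, and a simplex of the nerve of the Zappa--Szep product extends uniquely to a
  staircase-shaped part of such a grid.  On points of the grid every operator becomes an operation on
  lists of indices: faces delete entries, degeneracies repeat entries, \<open>\<Pi>\<close> reads a bisimplex along its
  diagonal and so becomes the identity, \<open>\<Psi>\<close> becomes the Alexander--Whitney map and \<open>\<nabla>\<close> the shuffle
  map.  This gives naturality and the chain map property.  The index complexes of full grids and of
  staircases are contractible, by putting the smallest vertex in front, so the composites of the three
  maps once around the cycle \<open>Tot \<rightarrow> \<Delta> \<rightarrow> \<bowtie> \<rightarrow> Tot\<close>, starting at any of the three complexes, are naturally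
  homotopic to the identity.  Hence each of the three dual maps has a left and a right inverse in
  cohomology.
\<close>

text \<open>The complexes are not normalised, so neither order of composing the shuffle and
  Alexander--Whitney maps gives the identity on the nose; that is why every round trip needs a
  homotopy. Going around the whole cycle avoids an inverse of \<Pi>: a nerve simplex determines only
  the part of a grid on one side of the diagonal, a diagonal bisimplex needs the full square, so on
  indices \<Pi> is only an inclusion, of \<open>dgrid V l\<close> into \<open>ngrid V l\<close>.
  Alexander--Whitney followed by the shuffle map leads from the larger set back into the smaller
  one, because each Alexander--Whitney summand spans a full rectangle of available points. Hence two
  endomorphisms of index chains suffice: \<open>Fdiag\<close> for the diagonal and the bowtie
  complex, \<open>Ftot\<close> for the total one. Both are the identity in degree 0, which starts
  the construction of the homotopies. Each homotopy is built on the generic element of a model only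
  and then transported by reading indices in the grid of a simplex. The axioms of a matched pair are
  thereby confined to the construction of the grids.\<close>

abbreviation supp :: "('a \<Rightarrow>\<^sub>0 int) \<Rightarrow> 'a set" where
  "supp \<equiv> Poly_Mapping.keys"

abbreviation frag_map :: "('a \<Rightarrow> 'b) \<Rightarrow> ('a \<Rightarrow>\<^sub>0 int) \<Rightarrow> 'b \<Rightarrow>\<^sub>0 int" where
  "frag_map h \<equiv> frag_extend (\<lambda>x. frag_of (h x))"

section \<open>Cohomology of abstract complexes\<close>

lemma carrier_Hom_group: "carrier (Hom_group G A) = hom G A \<inter> extensional (carrier G)"
  by (simp add: Hom_group_def)

lemma mult_Hom_group: "u \<otimes>\<^bsub>Hom_group G A\<^esub> v = (\<lambda>x\<in>carrier G. u x \<otimes>\<^bsub>A\<^esub> v x)"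
  by (simp add: Hom_group_def)

lemma one_Hom_group: "\<one>\<^bsub>Hom_group G A\<^esub> = (\<lambda>x\<in>carrier G. \<one>\<^bsub>A\<^esub>)"
  by (simp add: Hom_group_def)

lemma Hom_group_eqI:
  assumes "u \<in> carrier (Hom_group G A)" "v \<in> carrier (Hom_group G A)"
    and "\<And>x. x \<in> carrier G \<Longrightarrow> u x = v x"
  shows "u = v"
  using assms by (auto simp: carrier_Hom_group intro: extensionalityI)

lemma comm_group_Hom_group:
  fixes A (structure)
  assumes "comm_group A" "group G"
  shows "comm_group (Hom_group G A)"
proof -
  interpret A: comm_group A by fact
  interpret G: group G by fact
  have mem: "u x \<in> carrier A" if "u \<in> hom G A" "x \<in> carrier G" for u x
    using that by (auto simp: hom_def)
  have app: "u (x \<otimes>\<^bsub>G\<^esub> y) = u x \<otimes> u y" if "u \<in> hom G A" "x \<in> carrier G" "y \<in> carrier G" for u x y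
    using that by (auto simp: hom_def)
  show ?thesis
  proof (rule comm_groupI)
    fix u v w
    assume u: "u \<in> carrier (Hom_group G A)" and v: "v \<in> carrier (Hom_group G A)"
    then have u': "u \<in> hom G A" and v': "v \<in> hom G A" by (auto simp: carrier_Hom_group)
    show "u \<otimes>\<^bsub>Hom_group G A\<^esub> v \<in> carrier (Hom_group G A)"
      unfolding carrier_Hom_group mult_Hom_group
      by (auto simp: mem[OF u'] mem[OF v'] app[OF u'] app[OF v'] A.m_ac intro!: homI)
    show "u \<otimes>\<^bsub>Hom_group G A\<^esub> v = v \<otimes>\<^bsub>Hom_group G A\<^esub> u"
      unfolding mult_Hom_group using u' v' by (auto simp: mem A.m_comm)
    assume "w \<in> carrier (Hom_group G A)"
    then have w': "w \<in> hom G A" by (auto simp: carrier_Hom_group)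
    show "u \<otimes>\<^bsub>Hom_group G A\<^esub> v \<otimes>\<^bsub>Hom_group G A\<^esub> w = u \<otimes>\<^bsub>Hom_group G A\<^esub> (v \<otimes>\<^bsub>Hom_group G A\<^esub> w)"
      unfolding mult_Hom_group using u' v' w' by (auto simp: mem A.m_assoc)
  next
    show "\<one>\<^bsub>Hom_group G A\<^esub> \<in> carrier (Hom_group G A)"
      unfolding carrier_Hom_group one_Hom_group by (auto intro!: homI)
  next
    fix u assume u: "u \<in> carrier (Hom_group G A)"
    then have u': "u \<in> hom G A" by (auto simp: carrier_Hom_group)
    show "\<one>\<^bsub>Hom_group G A\<^esub> \<otimes>\<^bsub>Hom_group G A\<^esub> u = u"
      using u u' unfolding mult_Hom_group one_Hom_group carrier_Hom_group
      by (auto simp: mem extensional_def)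
    let ?v = "\<lambda>x\<in>carrier G. inv (u x)"
    have "?v \<in> carrier (Hom_group G A)"
      unfolding carrier_Hom_group
      by (auto simp: mem[OF u'] app[OF u'] A.inv_mult intro!: homI)
    moreover have "?v \<otimes>\<^bsub>Hom_group G A\<^esub> u = \<one>\<^bsub>Hom_group G A\<^esub>"
      unfolding mult_Hom_group one_Hom_group using u' by (auto simp: mem)
    ultimately show "\<exists>v\<in>carrier (Hom_group G A). v \<otimes>\<^bsub>Hom_group G A\<^esub> u = \<one>\<^bsub>Hom_group G A\<^esub>"
      by blast
  qed
qed

lemma dual_apply: "x \<in> carrier G \<Longrightarrow> dual G \<phi> u x = u (\<phi> x)"
  by (simp add: dual_def compose_def)

lemma dual_closed:
  assumes "group G" "\<phi> \<in> hom G H" "u \<in> carrier (Hom_group H A)"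
  shows "dual G \<phi> u \<in> carrier (Hom_group G A)"
proof -
  interpret G: group G by fact
  show ?thesis
    using assms(2,3) unfolding carrier_Hom_group dual_def
    by (auto intro!: homI simp: compose_def hom_def Pi_iff)
qed

lemma dual_mult:
  assumes "group G" "\<phi> \<in> hom G H"
  shows "dual G \<phi> (u \<otimes>\<^bsub>Hom_group H A\<^esub> v) = dual G \<phi> u \<otimes>\<^bsub>Hom_group G A\<^esub> dual G \<phi> v"
  using assms by (auto simp: dual_def compose_def mult_Hom_group hom_def Pi_iff)

lemma dual_hom:
  assumes "group G" "\<phi> \<in> hom G H"
  shows "dual G \<phi> \<in> hom (Hom_group H A) (Hom_group G A)"
  using assms dual_closed dual_mult by (metis homI)

lemma dual_dual:
  assumes "\<phi> \<in> hom G H"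
  shows "dual G \<phi> (dual H \<psi> u) = dual G (\<psi> \<circ> \<phi>) u"
  using assms by (auto simp: dual_def compose_def hom_def Pi_iff)

lemma dual_cong: "(\<And>x. x \<in> carrier G \<Longrightarrow> \<phi> x = \<psi> x) \<Longrightarrow> dual G \<phi> u = dual G \<psi> u"
  by (auto simp: dual_def compose_def)

lemma dual_ident:
  assumes "u \<in> carrier (Hom_group G A)" "\<And>x. x \<in> carrier G \<Longrightarrow> \<phi> x = x"
  shows "dual G \<phi> u = u"
  using assms by (auto simp: dual_def compose_def carrier_Hom_group extensional_def)

section \<open>Cochains, cocycles and cohomology classes of one complex\<close>

abbreviation cochains :: "('g, 'm) monoid_scheme \<Rightarrow> 'x complex \<Rightarrow> nat \<Rightarrow> ('x \<Rightarrow> 'g) monoid" where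
  "cochains A K n \<equiv> Hom_group (chains K n) A"

abbreviation coclass ::
  "('g, 'm) monoid_scheme \<Rightarrow> 'x complex \<Rightarrow> nat \<Rightarrow> ('x \<Rightarrow> 'g) \<Rightarrow> ('x \<Rightarrow> 'g) set" where
  "coclass A K n u \<equiv> coboundaries A K n #>\<^bsub>cochains A K n\<^esub> u"

locale coefficient_complex =
  fixes A :: "('g, 'm) monoid_scheme" and K :: "'x complex"
  assumes comm_A: "comm_group A" and complex: "chain_complex K"
begin

lemma group_chains: "group (chains K n)"
  using complex comm_group.axioms(2) by (auto simp: chain_complex_def)

lemma bdry_hom: "bdry K n \<in> hom (chains K (Suc n)) (chains K n)"
  using complex by (auto simp: chain_complex_def)

lemma bdry_bdry: "x \<in> carrier (chains K (Suc (Suc n))) \<Longrightarrow> bdry K n (bdry K (Suc n) x) = \<one>\<^bsub>chains K n\<^esub>"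
  using complex by (auto simp: chain_complex_def)

sublocale cochains: comm_group "cochains A K n" for n
  by (rule comm_group_Hom_group[OF comm_A group_chains])

lemma cobdry_hom:
  "dual (chains K (Suc n)) (bdry K n) \<in> hom (cochains A K n) (cochains A K (Suc n))"
  by (rule dual_hom[OF group_chains bdry_hom])

sublocale cobdry: group_hom "cochains A K n" "cochains A K (Suc n)" "dual (chains K (Suc n)) (bdry K n)" for n
  using cobdry_hom by unfold_locales

lemma subgroup_cocycles: "subgroup (cocycles A K n) (cochains A K n)"
  unfolding cocycles_def by (rule cobdry.subgroup_kernel)

lemma subgroup_coboundaries: "subgroup (coboundaries A K n) (cochains A K n)"
  by (cases n) (auto simp: coboundaries_def cochains.triv_subgroup intro: cobdry.img_is_subgroup)

lemma cochain_one: "u \<in> carrier (cochains A K n) \<Longrightarrow> u \<one>\<^bsub>chains K n\<^esub> = \<one>\<^bsub>A\<^esub>"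
  by (metis Int_iff carrier_Hom_group comm_A comm_group_def group_chains hom_one)

lemma coboundaries_subset: "coboundaries A K n \<subseteq> cocycles A K n"
proof (cases n)
  case 0
  then show ?thesis
    using subgroup.one_closed[OF subgroup_cocycles[of 0]] by (simp add: coboundaries_def)
next
  case (Suc m)
  have "dual (chains K (Suc m)) (bdry K m) u \<in> cocycles A K (Suc m)"
    if u: "u \<in> carrier (cochains A K m)" for u
  proof -
    have "dual (chains K (Suc (Suc m))) (bdry K (Suc m)) (dual (chains K (Suc m)) (bdry K m) u) x =
      \<one>\<^bsub>cochains A K (Suc (Suc m))\<^esub> x" for x
      unfolding dual_dual[OF bdry_hom]
      by (auto simp: one_Hom_group dual_def compose_def bdry_bdry cochain_one[OF u])
    then show ?thesis
      using dual_closed[OF group_chains bdry_hom u] by (auto simp: cocycles_def kernel_def)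
  qed
  then show ?thesis using Suc by (auto simp: coboundaries_def)
qed

lemma normal_coboundaries:
  "coboundaries A K n \<lhd> (cochains A K n)\<lparr>carrier := cocycles A K n\<rparr>"
proof -
  interpret Z: group "(cochains A K n)\<lparr>carrier := cocycles A K n\<rparr>"
    by (rule cochains.subgroup_imp_group[OF subgroup_cocycles])
  interpret Z: comm_group "(cochains A K n)\<lparr>carrier := cocycles A K n\<rparr>"
    by (rule Z.group_comm_groupI) (auto intro: cochains.m_comm subgroup.mem_carrier[OF subgroup_cocycles])
  show ?thesis
    by (intro Z.subgroup_imp_normal cochains.subgroup_incl subgroup_coboundaries
        subgroup_cocycles coboundaries_subset)
qed

lemma carrier_cohomology: "carrier (cohomology A K n) = coclass A K n ` cocycles A K n"
  by (auto simp: cohomology_def FactGroup_def RCOSETS_def r_coset_def)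

lemma mult_coclass:
  assumes "u \<in> cocycles A K n" "v \<in> cocycles A K n"
  shows "coclass A K n u \<otimes>\<^bsub>cohomology A K n\<^esub> coclass A K n v
    = coclass A K n (u \<otimes>\<^bsub>cochains A K n\<^esub> v)"
  using normal.rcos_sum[OF normal_coboundaries, of u n v] assms
  by (simp add: cohomology_def FactGroup_def r_coset_def set_mult_def)

lemma coclass_eqI:
  assumes "u \<in> carrier (cochains A K n)" "b \<in> coboundaries A K n" "v = b \<otimes>\<^bsub>cochains A K n\<^esub> u"
  shows "coclass A K n v = coclass A K n u"
proof -
  have "v \<in> coclass A K n u" using assms by (auto simp: r_coset_def)
  then show ?thesis
    using cochains.repr_independence assms(1) subgroup_coboundaries by metis
qed

lemma cocycles_carrier: "u \<in> cocycles A K n \<Longrightarrow> u \<in> carrier (cochains A K n)"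
  by (simp add: cocycles_def kernel_def)

end

section \<open>The map in cohomology induced by a chain map\<close>

locale coefficient_map =
  fixes A :: "('g, 'm) monoid_scheme" and K :: "'x complex" and L :: "'y complex"
    and \<phi> :: "nat \<Rightarrow> 'x \<Rightarrow> 'y"
  assumes comm_A: "comm_group A" and chain_map: "chain_map K L \<phi>"
begin

sublocale K: coefficient_complex A K
  using comm_A chain_map by (auto simp: chain_map_def coefficient_complex_def)

sublocale L: coefficient_complex A L
  using comm_A chain_map by (auto simp: chain_map_def coefficient_complex_def)

lemma map_hom: "\<phi> n \<in> hom (chains K n) (chains L n)"
  using chain_map by (auto simp: chain_map_def)

lemma map_bdry: "x \<in> carrier (chains K (Suc n)) \<Longrightarrow> \<phi> n (bdry K n x) = bdry L n (\<phi> (Suc n) x)"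
  using chain_map by (auto simp: chain_map_def)

lemma dual_bdry:
  "dual (chains K (Suc n)) (bdry K n) (dual (chains K n) (\<phi> n) u) =
   dual (chains K (Suc n)) (\<phi> (Suc n)) (dual (chains L (Suc n)) (bdry L n) u)"
  unfolding dual_dual[OF K.bdry_hom] dual_dual[OF map_hom]
  by (rule dual_cong) (simp add: map_bdry)

sublocale pull: group_hom "cochains A L n" "cochains A K n" "dual (chains K n) (\<phi> n)" for n
  using dual_hom[OF K.group_chains map_hom] by unfold_locales

lemma dual_cocycle:
  assumes "u \<in> cocycles A L n" shows "dual (chains K n) (\<phi> n) u \<in> cocycles A K n"
proof -
  have "dual (chains L (Suc n)) (bdry L n) u = \<one>\<^bsub>cochains A L (Suc n)\<^esub>"
    using assms by (simp add: cocycles_def kernel_def)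
  then show ?thesis
    using assms unfolding cocycles_def kernel_def by (simp add: dual_bdry)
qed

lemma dual_coboundary:
  assumes "u \<in> coboundaries A L n" shows "dual (chains K n) (\<phi> n) u \<in> coboundaries A K n"
proof (cases n)
  case 0
  then show ?thesis using assms by (auto simp: coboundaries_def)
next
  case (Suc m)
  then show ?thesis using assms by (auto simp: coboundaries_def dual_bdry[symmetric])
qed

text \<open>The product with \<open>coboundaries A K n\<close> in \<open>cohomology_map\<close> does
  no harm: precomposition sends coboundaries of \<open>L\<close> to coboundaries of
  \<open>K\<close>, so the ambiguity of the representative is absorbed and a single coset is
  left.\<close>

lemma cohomology_map_coclass:
  assumes "u \<in> cocycles A L n"
  shows "cohomology_map A K L \<phi> n (coclass A L n u) = coclass A K n (dual (chains K n) (\<phi> n) u)"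
proof -
  let ?f = "dual (chains K n) (\<phi> n)" and ?B = "coboundaries A K n"
  interpret BK: subgroup ?B "cochains A K n" by (rule K.subgroup_coboundaries)
  interpret BL: subgroup "coboundaries A L n" "cochains A L n" by (rule L.subgroup_coboundaries)
  have u: "u \<in> carrier (cochains A L n)" by (rule L.cocycles_carrier[OF assms])
  have "?f ` coclass A L n u = (\<Union>b\<in>coboundaries A L n. {?f b \<otimes>\<^bsub>cochains A K n\<^esub> ?f u})"
    using u by (simp add: r_coset_def image_UN)
  then have "cohomology_map A K L \<phi> n (coclass A L n u) =
    (\<Union>b'\<in>?B. \<Union>b\<in>coboundaries A L n. {b' \<otimes>\<^bsub>cochains A K n\<^esub> (?f b \<otimes>\<^bsub>cochains A K n\<^esub> ?f u)})"
    by (auto simp: cohomology_map_def set_mult_def)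
  also have "\<dots> = (\<Union>b'\<in>?B. \<Union>b\<in>coboundaries A L n. {b' \<otimes>\<^bsub>cochains A K n\<^esub> ?f b \<otimes>\<^bsub>cochains A K n\<^esub> ?f u})"
    using u dual_coboundary by (simp add: K.cochains.m_assoc)
  also have "\<dots> = coclass A K n (?f u)"
  proof -
    \<comment> \<open>Take \<open>b'\<close> to be \<open>x\<close> and \<open>b\<close> the unit,
      whose pullback is the unit.\<close>
    have "\<exists>b'\<in>?B. \<exists>b\<in>coboundaries A L n. x = b' \<otimes>\<^bsub>cochains A K n\<^esub> ?f b" if "x \<in> ?B" for x
      using that BL.one_closed by (metis BK.mem_carrier K.cochains.r_one pull.hom_one)
    then show ?thesis
      by (force simp: r_coset_def dual_coboundary)
  qed
  finally show ?thesis .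
qed

lemma cohomology_map_hom: "cohomology_map A K L \<phi> n \<in> hom (cohomology A L n) (cohomology A K n)"
proof (rule homI)
  fix X assume "X \<in> carrier (cohomology A L n)"
  then obtain u where u: "u \<in> cocycles A L n" "X = coclass A L n u" by (auto simp: L.carrier_cohomology)
  show "cohomology_map A K L \<phi> n X \<in> carrier (cohomology A K n)"
    using u dual_cocycle by (auto simp: cohomology_map_coclass K.carrier_cohomology)
  fix Y assume "Y \<in> carrier (cohomology A L n)"
  then obtain v where v: "v \<in> cocycles A L n" "Y = coclass A L n v" by (auto simp: L.carrier_cohomology)
  have "u \<otimes>\<^bsub>cochains A L n\<^esub> v \<in> cocycles A L n"
    using u v subgroup.m_closed[OF L.subgroup_cocycles] by blast
  then show "cohomology_map A K L \<phi> n (X \<otimes>\<^bsub>cohomology A L n\<^esub> Y) =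
    cohomology_map A K L \<phi> n X \<otimes>\<^bsub>cohomology A K n\<^esub> cohomology_map A K L \<phi> n Y"
    using u v by (simp add: L.mult_coclass K.mult_coclass cohomology_map_coclass dual_cocycle
        L.cocycles_carrier)
qed

end

lemma cohomology_map_ident:
  assumes "comm_group A" "chain_map K K \<phi>" and id: "\<And>x. x \<in> carrier (chains K n) \<Longrightarrow> \<phi> n x = x"
    and "X \<in> carrier (cohomology A K n)"
  shows "cohomology_map A K K \<phi> n X = X"
proof -
  interpret coefficient_map A K K \<phi> by (rule coefficient_map.intro) fact+
  obtain u where u: "u \<in> cocycles A K n" "X = coclass A K n u"
    using assms by (auto simp: K.carrier_cohomology)
  then show ?thesis
    using id by (simp add: cohomology_map_coclass dual_ident[OF K.cocycles_carrier])
qed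

lemma chain_map_comp:
  assumes "chain_map K L \<phi>" "chain_map L N \<psi>"
  shows "chain_map K N (\<lambda>n. \<psi> n \<circ> \<phi> n)"
  using assms unfolding chain_map_def by (auto simp: hom_def Pi_iff)

text \<open>The composite enters as a separate \<open>\<chi>\<close> that agrees with it on chains
  of degree \<open>n\<close> only: maps with equal values on basis elements may differ as functions
  outside the chain groups, and both sides of a naturality square have to be compared with one and
  the same map.\<close>

lemma cohomology_map_comp:
  assumes "comm_group A" "chain_map K L \<phi>" "chain_map L N \<psi>" "chain_map K N \<chi>"
    and eq: "\<And>x. x \<in> carrier (chains K n) \<Longrightarrow> \<chi> n x = \<psi> n (\<phi> n x)"
    and "X \<in> carrier (cohomology A N n)"
  shows "cohomology_map A K N \<chi> n X = cohomology_map A K L \<phi> n (cohomology_map A L N \<psi> n X)"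
proof -
  interpret f: coefficient_map A K L \<phi> by (rule coefficient_map.intro) fact+
  interpret g: coefficient_map A L N \<psi> by (rule coefficient_map.intro) fact+
  interpret h: coefficient_map A K N \<chi> by (rule coefficient_map.intro) fact+
  obtain u where u: "u \<in> cocycles A N n" "X = coclass A N n u"
    using assms by (auto simp: g.L.carrier_cohomology)
  have "dual (chains K n) (\<chi> n) u = dual (chains K n) (\<phi> n) (dual (chains L n) (\<psi> n) u)"
    unfolding dual_dual[OF f.map_hom] by (rule dual_cong) (simp add: eq)
  then show ?thesis
    using u by (simp add: h.cohomology_map_coclass g.cohomology_map_coclass
        f.cohomology_map_coclass g.dual_cocycle)
qed

text \<open>For a cocycle \<open>u\<close> the term u d H vanishes and u H d is the coboundary of u
  H, so precomposing \<open>u\<close> with \<open>\<phi>\<close> changes it by a coboundary. In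
  degree 0 the homotopies constructed below vanish, whence the hypothesis
  \<open>zero\<close>.\<close>

lemma cohomology_map_homotopic_id:
  assumes A: "comm_group A" and \<phi>: "chain_map K K \<phi>"
    and H: "\<And>n. H n \<in> hom (chains K n) (chains K (Suc n))"
    and zero: "\<And>x. x \<in> carrier (chains K 0) \<Longrightarrow> \<phi> 0 x = x"
    and Suc: "\<And>n x. x \<in> carrier (chains K (Suc n)) \<Longrightarrow>
      \<phi> (Suc n) x = bdry K (Suc n) (H (Suc n) x) \<otimes>\<^bsub>chains K (Suc n)\<^esub> H n (bdry K n x) \<otimes>\<^bsub>chains K (Suc n)\<^esub> x"
    and X: "X \<in> carrier (cohomology A K n)"
  shows "cohomology_map A K K \<phi> n X = X"
proof (cases n)
  case 0
  then show ?thesis using cohomology_map_ident[OF A \<phi>] zero X by blast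
next
  case (Suc m)
  interpret coefficient_map A K K \<phi> by (rule coefficient_map.intro) fact+
  interpret A: comm_group A by fact
  obtain u where u: "u \<in> cocycles A K n" "X = coclass A K n u"
    using X by (auto simp: K.carrier_cohomology)
  have uc: "u \<in> carrier (cochains A K (Suc m))" using K.cocycles_carrier u Suc by blast
  then have uhom: "u \<in> hom (chains K (Suc m)) A" by (simp add: carrier_Hom_group)
  have mult: "u (x \<otimes>\<^bsub>chains K (Suc m)\<^esub> y) = u x \<otimes>\<^bsub>A\<^esub> u y"
    if "x \<in> carrier (chains K (Suc m))" "y \<in> carrier (chains K (Suc m))" for x y
    using uhom that by (auto simp: hom_def)
  have clos: "u x \<in> carrier A" if "x \<in> carrier (chains K (Suc m))" for x
    using uhom that by (auto simp: hom_def)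
  interpret C: group "chains K (Suc m)" by (rule K.group_chains)
  have cocyc: "u (bdry K (Suc m) y) = \<one>\<^bsub>A\<^esub>" if "y \<in> carrier (chains K (Suc (Suc m)))" for y
  proof -
    have "dual (chains K (Suc (Suc m))) (bdry K (Suc m)) u = \<one>\<^bsub>cochains A K (Suc (Suc m))\<^esub>"
      using u Suc by (simp add: cocycles_def kernel_def)
    from fun_cong[OF this, of y] show ?thesis using that by (simp add: dual_apply one_Hom_group)
  qed
  let ?v = "dual (chains K m) (H m) u"
  have v: "?v \<in> carrier (cochains A K m)" by (rule dual_closed[OF K.group_chains H uc])
  let ?b = "dual (chains K (Suc m)) (bdry K m) ?v"
  have b: "?b \<in> coboundaries A K (Suc m)" using v by (auto simp: coboundaries_def)
  have Hc: "H k x \<in> carrier (chains K (Suc k))" if "x \<in> carrier (chains K k)" for k x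
    using H[of k] that by (auto simp: hom_def)
  have dc: "bdry K k x \<in> carrier (chains K k)" if "x \<in> carrier (chains K (Suc k))" for k x
    using K.bdry_hom[of k] that by (auto simp: hom_def)
  have "dual (chains K (Suc m)) (\<phi> (Suc m)) u = ?b \<otimes>\<^bsub>cochains A K (Suc m)\<^esub> u"
  proof (rule Hom_group_eqI)
    show "?b \<otimes>\<^bsub>cochains A K (Suc m)\<^esub> u \<in> carrier (cochains A K (Suc m))"
      using subgroup.mem_carrier[OF K.subgroup_coboundaries b] uc by simp
    fix x assume x: "x \<in> carrier (chains K (Suc m))"
    show "dual (chains K (Suc m)) (\<phi> (Suc m)) u x = (?b \<otimes>\<^bsub>cochains A K (Suc m)\<^esub> u) x"
      using x by (simp add: dual_apply mult_Hom_group dc Hc mult cocyc clos assms(5))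
  qed (use uc in \<open>auto\<close>)
  then show ?thesis
    using u Suc uc b by (simp add: cohomology_map_coclass K.coclass_eqI)
qed

text \<open>\<open>h \<circ> g\<close> is a left inverse of \<open>f\<close> by the first identity
  and a right inverse by the second. In a cycle of three maps this applies to each of them by
  rotating the arguments.\<close>

lemma iso_if_cyclic_id:
  assumes "f \<in> hom X Y" "g \<in> hom Y Z" "h \<in> hom Z X"
    and "\<And>x. x \<in> carrier X \<Longrightarrow> h (g (f x)) = x"
    and "\<And>y. y \<in> carrier Y \<Longrightarrow> f (h (g y)) = y"
  shows "f \<in> iso X Y"
proof -
  have "bij_betw f (carrier X) (carrier Y)"
    by (rule bij_betw_byWitness[where f' = "h \<circ> g"]) (use assms in \<open>auto simp: hom_def Pi_iff\<close>)
  then show ?thesis using assms(1) by (simp add: iso_def)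
qed

section \<open>Complexes and chain maps given on bases\<close>

lemma keys_frag_extend_subset:
  "(\<And>x. x \<in> supp c \<Longrightarrow> supp (f x) \<subseteq> S) \<Longrightarrow> supp (frag_extend f c) \<subseteq> S"
  using keys_frag_extend[of f c] by blast

lemma chain_complex_freeI:
  assumes "\<And>k. chains K k = free_Abelian_group (B k)"
    and "\<And>k. bdry K k = frag_extend (d k)"
    and "\<And>k s. s \<in> B (Suc k) \<Longrightarrow> supp (d k s) \<subseteq> B k"
    and "\<And>k s. s \<in> B (Suc (Suc k)) \<Longrightarrow> frag_extend (d k) (d (Suc k) s) = 0"
  shows "chain_complex K"
proof -
  have "bdry K k (bdry K (Suc k) x) = \<one>\<^bsub>chains K k\<^esub>" if "x \<in> carrier (chains K (Suc (Suc k)))" for k x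
  proof -
    have "supp x \<subseteq> B (Suc (Suc k))" using that assms(1) by simp
    then have "frag_extend (d k) (frag_extend (d (Suc k)) x) = 0"
      by (induction x rule: frag_induction) (auto simp: frag_extend_diff assms(4))
    then show ?thesis by (simp add: assms)
  qed
  moreover have "bdry K k \<in> hom (chains K (Suc k)) (chains K k)" for k
    using assms(3) unfolding assms(1,2)
    by (fastforce intro!: homI simp: frag_extend_add intro!: keys_frag_extend_subset)
  ultimately show ?thesis
    by (auto simp: chain_complex_def assms(1) abelian_free_Abelian_group)
qed

lemma chain_map_freeI:
  assumes "chain_complex K" "chain_complex L"
    and "\<And>k. chains K k = free_Abelian_group (B k)" "\<And>k. chains L k = free_Abelian_group (B' k)"
    and "\<And>k. bdry K k = frag_extend (d k)" "\<And>k. bdry L k = frag_extend (d' k)"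
    and "\<And>k. \<phi> k = frag_extend (f k)"
    and "\<And>k s. s \<in> B k \<Longrightarrow> supp (f k s) \<subseteq> B' k"
    and "\<And>k s. s \<in> B (Suc k) \<Longrightarrow> frag_extend (f k) (d k s) = frag_extend (d' k) (f (Suc k) s)"
  shows "chain_map K L \<phi>"
proof -
  have "\<phi> k (bdry K k x) = bdry L k (\<phi> (Suc k) x)" if "x \<in> carrier (chains K (Suc k))" for k x
  proof -
    have "supp x \<subseteq> B (Suc k)" using that assms(3) by simp
    then have "frag_extend (f k) (frag_extend (d k) x) = frag_extend (d' k) (frag_extend (f (Suc k)) x)"
      by (induction x rule: frag_induction) (auto simp: frag_extend_diff assms(9))
    then show ?thesis by (simp add: assms)
  qed
  moreover have "\<phi> k \<in> hom (chains K k) (chains L k)" for k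
    using assms(8) unfolding assms(3,4,7)
    by (fastforce intro!: homI simp: frag_extend_add intro!: keys_frag_extend_subset)
  ultimately show ?thesis
    using assms(1,2) by (auto simp: chain_map_def)
qed

section \<open>Chains on lists\<close>

lemma frag_extend_frag_extend:
  "frag_extend f (frag_extend g u) = frag_extend (\<lambda>x. frag_extend f (g x)) u"
  using subset_UNIV by (induction u rule: frag_induction) (auto simp: frag_extend_diff)

lemma frag_extend_fun_add: "frag_extend (\<lambda>x. f x + g x) u = frag_extend f u + frag_extend g u"
  by (simp add: frag_extend_def frag_cmul_distrib2 sum.distrib)

lemma frag_extend_fun_diff: "frag_extend (\<lambda>x. f x - g x) u = frag_extend f u - frag_extend g u"
  using subset_UNIV by (induction u rule: frag_induction) (auto simp: frag_extend_diff)

lemma frag_extend_fun_minus: "frag_extend (\<lambda>x. - f x) u = - frag_extend f u"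
  using subset_UNIV by (induction u rule: frag_induction) (auto simp: frag_extend_diff)

lemma frag_extend_fun_cmul: "frag_extend (\<lambda>x. frag_cmul c (f x)) u = frag_cmul c (frag_extend f u)"
  by (simp add: frag_extend_def frag_cmul_sum mult.commute)

lemma frag_extend_zero [simp]: "frag_extend (\<lambda>x. 0) u = 0"
  by (simp add: frag_extend_def)

lemma frag_extend_frag_of [simp]: "frag_extend frag_of u = u"
  by (metis frag_expansion)

lemma frag_extend_Sum:
  "finite I \<Longrightarrow> frag_extend f (\<Sum>i\<in>I. frag_cmul (c i) (frag_of (g i))) = (\<Sum>i\<in>I. frag_cmul (c i) (f (g i)))"
  by (simp add: frag_extend_sum frag_extend_cmul)

lemmas frag_extend_lin = frag_extend_add frag_extend_diff frag_extend_minus frag_extend_cmul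
  frag_extend_fun_add frag_extend_fun_diff frag_extend_fun_minus
  frag_extend_fun_cmul

lemmas frag_extend_linear = frag_extend_lin frag_extend_frag_extend

section \<open>Deleting entries and the augmented boundary\<close>

definition del :: "nat \<Rightarrow> 'a list \<Rightarrow> 'a list" where
  "del i xs = take i xs @ drop (Suc i) xs"

lemma length_del: "i < length xs \<Longrightarrow> length (del i xs) = length xs - 1"
  by (auto simp: del_def)

lemma nth_del: "t < length xs - 1 \<Longrightarrow> i < length xs \<Longrightarrow> del i xs ! t = (if t < i then xs ! t else xs ! Suc t)"
  by (auto simp: del_def nth_append)

lemma set_del_subset: "set (del i xs) \<subseteq> set xs"
  by (auto simp: del_def dest: in_set_takeD in_set_dropD)

lemma map_del: "map f (del i xs) = del i (map f xs)"
  by (simp add: del_def take_map drop_map)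

lemma del_0: "del 0 (x # xs) = xs" and del_Suc: "del (Suc i) (x # xs) = x # del i xs"
  by (simp_all add: del_def)

lemma sorted_wrt_del: "sorted_wrt P xs \<Longrightarrow> sorted_wrt P (del i xs)"
proof -
  assume "sorted_wrt P xs"
  then have "sorted_wrt P (take i xs @ drop i xs)" by simp
  then show ?thesis
    unfolding del_def sorted_wrt_append
    by (metis Cons_nth_drop_Suc drop_all in_set_dropD le_Suc_eq linorder_not_le
        list.set_intros(2) sorted_wrt.simps(2) drop_eq_Nil)
qed

text \<open>
  The boundary is augmented: a list of length \<open>1\<close> has the empty list as boundary, so that prepending
  a fixed element is a contraction in all degrees.
\<close>

primrec bd :: "'a list \<Rightarrow> 'a list \<Rightarrow>\<^sub>0 int" where
  "bd [] = 0"
| "bd (x # xs) = frag_of xs - frag_map (\<lambda>l. x # l) (bd xs)"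

lemma bd_sum: "bd xs = (\<Sum>i<length xs. frag_cmul ((-1) ^ i) (frag_of (del i xs)))"
proof (induction xs)
  case (Cons x xs)
  have "(\<Sum>i<length xs. frag_cmul ((-1) ^ Suc i) (frag_of (x # del i xs)))
      = - frag_map (\<lambda>l. x # l) (bd xs)"
    unfolding Cons by (simp add: frag_extend_Sum flip: sum_negf)
  then show ?case
    by (simp add: sum.lessThan_Suc_shift del_0 del_Suc del: power_Suc sum.lessThan_Suc)
qed simp

lemma keys_bd: "supp (bd xs) \<subseteq> (\<lambda>i. del i xs) ` {..<length xs}"
proof (induction xs)
  case (Cons x xs)
  have "supp (bd (x # xs)) \<subseteq> {xs} \<union> Cons x ` supp (bd xs)"
    using keys_diff[of "frag_of xs" "frag_map (\<lambda>l. x # l) (bd xs)"]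
      keys_frag_extend[of "\<lambda>l. frag_of (x # l)" "bd xs"] by auto
  also have "\<dots> \<subseteq> {del 0 (x # xs)} \<union> (\<lambda>i. del (Suc i) (x # xs)) ` {..<length xs}"
    using Cons by (auto simp: del_0 del_Suc)
  finally show ?case by auto
qed simp

lemma length_keys_bd: "l \<in> supp (bd xs) \<Longrightarrow> Suc (length l) = length xs"
  using keys_bd[of xs] by (auto simp: length_del)

text \<open>The boundary of \<open>x # l\<close> is \<open>l\<close> minus \<open>x\<close> put in
  front of the boundary of \<open>l\<close>. Taking the boundary once more, the two copies of
  \<open>bd l\<close> cancel and only \<open>x\<close> in front of the double boundary of
  \<open>l\<close> is left.\<close>

lemma bd_bd: "frag_extend bd (bd xs) = 0"
proof (induction xs)
  case (Cons x xs)
  have "frag_extend (\<lambda>l. frag_map (\<lambda>m. x # m) (bd l)) (bd xs)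
      = frag_map (\<lambda>m. x # m) (frag_extend bd (bd xs))"
    by (simp only: frag_extend_frag_extend)
  then show ?case by (simp add: frag_extend_linear Cons)
qed simp

text \<open>The recursion read at the other end, for \<open>shuf\<close>, which grows at the end of
  its lists.\<close>

lemma bd_snoc: "bd (xs @ [x]) = frag_map (\<lambda>l. l @ [x]) (bd xs) + frag_cmul ((-1) ^ length xs) (frag_of xs)"
  by (induction xs) (simp_all add: frag_extend_linear)

lemma bd_map: "bd (map f xs) = frag_map (map f) (bd xs)"
  by (induction xs) (simp_all add: frag_extend_linear)

text \<open>The tensor product of two augmented list complexes. A list of length p + 1 has degree p,
  so the sign of the second differential, including the minus, is (-1)^p as in
  \<open>tot_vdiff\<close>.\<close>

definition tbd :: "'a list \<times> 'b list \<Rightarrow> ('a list \<times> 'b list) \<Rightarrow>\<^sub>0 int" where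
  "tbd = (\<lambda>(as, bs). frag_map (\<lambda>l. (l, bs)) (bd as)
     - frag_cmul ((-1) ^ length as) (frag_map (\<lambda>l. (as, l)) (bd bs)))"

text \<open>Projection to the quotient by the pairs with an empty component. Such pairs come from
  the augmentation and correspond to no bisimplex; \<open>ptbd\<close> is the boundary of the
  quotient.\<close>

definition nonaug :: "'a list \<times> 'b list \<Rightarrow> ('a list \<times> 'b list) \<Rightarrow>\<^sub>0 int" where
  "nonaug x = (if fst x = [] \<or> snd x = [] then 0 else frag_of x)"

definition ptbd :: "'a list \<times> 'b list \<Rightarrow> ('a list \<times> 'b list) \<Rightarrow>\<^sub>0 int" where
  "ptbd x = frag_extend nonaug (tbd x)"

text \<open>With the augmentation, prepending to the first list contracts the whole tensor product
  without exceptional cases. This is why identities are first proved for \<open>tbd\<close> and only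
  then projected.\<close>

lemma tbd_Cons: "tbd (a # as, bs) = frag_of (as, bs) - frag_extend (\<lambda>(l, m). frag_of (a # l, m)) (tbd (as, bs))"
  by (simp add: tbd_def frag_extend_linear)

lemma tbd_tbd: "frag_extend tbd (tbd (as, bs)) = 0"
proof (induction as)
  case Nil
  have "frag_extend (\<lambda>l. tbd ([], l)) (bd bs) =
      - frag_map (\<lambda>l. ([], l)) (frag_extend bd (bd bs))"
    by (simp add: tbd_def frag_extend_linear)
  then show ?case by (simp add: tbd_def frag_extend_linear bd_bd)
next
  case (Cons a as)
  have "frag_extend (\<lambda>x. frag_extend tbd (case x of (l, m) \<Rightarrow> frag_of (a # l, m))) (tbd (as, bs))
    = tbd (as, bs) - frag_extend (\<lambda>(l, m). frag_of (a # l, m)) (frag_extend tbd (tbd (as, bs)))"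
    by (simp add: tbd_Cons frag_extend_linear split_def)
  then show ?case by (simp add: tbd_Cons frag_extend_linear Cons)
qed

text \<open>The pairs with an empty component span a subcomplex, as \<open>tbd\<close> of such a
  pair consists of such pairs again; so the boundary descends to the quotient.\<close>

lemma ptbd_ptbd: "frag_extend ptbd (ptbd x) = 0"
proof -
  have "frag_extend nonaug (tbd y) = 0" if "fst y = [] \<or> snd y = []" for y :: "'a list \<times> 'b list"
    using that by (cases y) (auto simp: tbd_def nonaug_def frag_extend_linear)
  then have "frag_extend ptbd (nonaug y) = frag_extend nonaug (tbd y)" for y :: "'a list \<times> 'b list"
    by (auto simp: nonaug_def ptbd_def)
  then have "frag_extend ptbd (ptbd x) = frag_extend nonaug (frag_extend tbd (tbd x))"
    by (simp add: ptbd_def[of x] frag_extend_frag_extend)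
  then show ?thesis using tbd_tbd[of "fst x" "snd x"] by simp
qed

lemma tbd_map:
  "tbd (map f as, map g bs) = frag_extend (\<lambda>(l, m). frag_of (map f l, map g m)) (tbd (as, bs))"
  by (simp add: tbd_def bd_map frag_extend_linear)

lemma ptbd_map:
  "ptbd (map f as, map g bs) = frag_extend (\<lambda>(l, m). frag_of (map f l, map g m)) (ptbd (as, bs))"
proof -
  have "nonaug (map f l, map g m) = frag_extend (\<lambda>(l, m). frag_of (map f l, map g m)) (nonaug (l, m))" for l m
    by (simp add: nonaug_def)
  then show ?thesis by (simp add: ptbd_def tbd_map frag_extend_linear split_def)
qed

section \<open>Alexander--Whitney and shuffle maps on lists\<close>

text \<open>The first summand is the one whose front face is the single first vertex; in all others
  the front face starts with that vertex, and removing it leaves a summand for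
  \<open>w\<close>.\<close>

primrec AW :: "('a \<times> 'b) list \<Rightarrow> ('a list \<times> 'b list) \<Rightarrow>\<^sub>0 int" where
  "AW [] = 0"
| "AW (x # w) = frag_of ([fst x], map snd (x # w)) + frag_extend (\<lambda>(l, m). frag_of (fst x # l, m)) (AW w)"

lemma AW_sum: "AW w = (\<Sum>p<length w. frag_of (map fst (take (Suc p) w), map snd (drop p w)))"
proof (induction w)
  case (Cons x w)
  show ?case
    unfolding list.size(4) add_0_right add_Suc_right sum.lessThan_Suc_shift
    by (simp add: Cons frag_extend_sum)
qed simp

text \<open>Face terms at the splitting point cancel between neighbouring summands. Only the two
  outermost survive, with an empty front or an empty back face; both are augmentation terms and
  vanish after projecting with \<open>nonaug\<close>.\<close>

lemma tbd_AW:
  "frag_extend tbd (AW w) = frag_extend AW (bd w) + frag_of ([], map snd w)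
     - frag_cmul ((-1) ^ length w) (frag_of (map fst w, []))"
proof (induction w)
  case (Cons x w)
  have snd_bd: "frag_map (\<lambda>l. ([fst x], snd x # map snd l)) (bd w)
      = frag_map (\<lambda>l. ([fst x], snd x # l)) (bd (map snd w))"
    by (simp add: bd_map frag_extend_linear)
  let ?c = "\<lambda>(l, m). frag_of (fst x # l, m)"
  have "frag_extend tbd (AW (x # w)) = tbd ([fst x], map snd (x # w)) + AW w
      - frag_extend ?c (frag_extend tbd (AW w))"
    by (simp add: frag_extend_linear split_def tbd_Cons)
  also have "\<dots> = frag_extend AW (bd (x # w)) + frag_of ([], map snd (x # w))
     - frag_cmul ((-1) ^ length (x # w)) (frag_of (map fst (x # w), []))"
    unfolding Cons by (simp add: tbd_def frag_extend_linear snd_bd split_def)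
  finally show ?case .
qed simp

lemma AW_nonaug: "frag_extend nonaug (AW w) = AW w"
  by (auto simp: AW_sum frag_extend_sum nonaug_def intro!: sum.cong)

lemma ptbd_AW: "frag_extend ptbd (AW w) = frag_extend AW (bd w)"
proof -
  have "frag_extend ptbd (AW w) = frag_extend nonaug (frag_extend tbd (AW w))"
    by (simp add: ptbd_def[abs_def] frag_extend_frag_extend)
  also have "\<dots> = frag_extend AW (bd w)"
    unfolding tbd_AW by (simp add: frag_extend_linear AW_nonaug nonaug_def)
  finally show ?thesis .
qed

lemma AW_map: "AW (map (map_prod f g) w) = frag_extend (\<lambda>(l, m). frag_of (map f l, map g m)) (AW w)"
  by (simp add: AW_sum frag_extend_sum take_map drop_map)

text \<open>
  The arguments are reversed, so that the recursion splits off the last step of a lattice path.  If that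
  step is in the first direction, it comes after all steps in the second one, whence the sign; the last
  summand is the start of the path.
\<close>

fun shuf_rev :: "'a list \<Rightarrow> 'b list \<Rightarrow> ('a \<times> 'b) list \<Rightarrow>\<^sub>0 int" where
  "shuf_rev [] bs = 0"
| "shuf_rev (a # as) [] = 0"
| "shuf_rev (a # as) (b # bs) = frag_map (\<lambda>w. w @ [(a, b)])
     (frag_cmul ((-1) ^ length bs) (shuf_rev as (b # bs)) + shuf_rev (a # as) bs
      + (if as = [] \<and> bs = [] then frag_of [] else 0))"

definition shuf :: "'a list \<Rightarrow> 'b list \<Rightarrow> ('a \<times> 'b) list \<Rightarrow>\<^sub>0 int" where
  "shuf as bs = shuf_rev (rev as) (rev bs)"

lemma shuf_Nil [simp]: "shuf [] bs = 0" "shuf as [] = 0"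
  by (simp_all add: shuf_def) (cases "rev as"; simp)

lemma shuf_snoc:
  "shuf (as @ [a]) (bs @ [b]) = frag_map (\<lambda>w. w @ [(a, b)])
     (frag_cmul ((-1) ^ length bs) (shuf as (bs @ [b])) + shuf (as @ [a]) bs
      + (if as = [] \<and> bs = [] then frag_of [] else 0))"
  by (simp add: shuf_def)

lemma shuf_induct [case_names Nil1 Nil2 snoc]:
  assumes "\<And>bs. P [] bs" "\<And>as. P as []"
    and "\<And>as a bs b. P as (bs @ [b]) \<Longrightarrow> P (as @ [a]) bs \<Longrightarrow> P (as @ [a]) (bs @ [b])"
  shows "P as bs"
proof -
  have "P (rev xs) (rev ys)" for xs ys
    by (induction xs ys rule: shuf_rev.induct) (use assms in auto)
  from this[of "rev as" "rev bs"] show ?thesis by simp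
qed

lemma shuf_map: "shuf (map f as) (map g bs) = frag_map (map (map_prod f g)) (shuf as bs)"
  by (induction as bs rule: shuf_induct) (simp_all add: shuf_snoc frag_extend_linear)

lemma keys_shuf_snoc:
  assumes "w \<in> supp (shuf (as @ [a]) (bs @ [b]))"
  obtains v where "w = v @ [(a, b)]"
    "v \<in> supp (shuf as (bs @ [b])) \<or> v \<in> supp (shuf (as @ [a]) bs)
      \<or> v = [] \<and> as = [] \<and> bs = []"
proof -
  have "supp (shuf (as @ [a]) (bs @ [b])) \<subseteq> (\<lambda>w. w @ [(a, b)]) `
      (supp (shuf as (bs @ [b])) \<union> supp (shuf (as @ [a]) bs)
        \<union> (if as = [] \<and> bs = [] then {[]} else {}))"
    unfolding shuf_snoc
    by (rule order_trans[OF keys_frag_extend])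
       (auto dest!: set_mp[OF keys_add] split: if_split_asm)
  then show ?thesis using assms that by (auto split: if_split_asm)
qed

lemma keys_shuf:
  "w \<in> supp (shuf as bs) \<Longrightarrow>
     Suc (length w) = length as + length bs \<and> set (map fst w) \<subseteq> set as \<and> set (map snd w) \<subseteq> set bs"
proof (induction as bs arbitrary: w rule: shuf_induct)
  case (snoc as a bs b)
  from snoc.prems obtain v where w: "w = v @ [(a, b)]" and
    v: "v \<in> supp (shuf as (bs @ [b])) \<or> v \<in> supp (shuf (as @ [a]) bs)
      \<or> v = [] \<and> as = [] \<and> bs = []"
    by (rule keys_shuf_snoc)
  from v show ?case
    using snoc.IH[of v] unfolding w by (elim disjE) auto
qed simp_all

lemma sorted_keys_shuf:
  fixes as :: "'a :: linorder list" and bs :: "'b :: linorder list"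
  shows "sorted as \<Longrightarrow> sorted bs \<Longrightarrow> w \<in> supp (shuf as bs) \<Longrightarrow>
     sorted (map fst w) \<and> sorted (map snd w)"
proof (induction as bs arbitrary: w rule: shuf_induct)
  case (snoc as a bs b)
  from snoc.prems(3) obtain v where w: "w = v @ [(a, b)]" and
    v: "v \<in> supp (shuf as (bs @ [b])) \<or> v \<in> supp (shuf (as @ [a]) bs)
      \<or> v = [] \<and> as = [] \<and> bs = []"
    by (rule keys_shuf_snoc)
  have "sorted (map fst v) \<and> sorted (map snd v)"
    using v snoc by (auto simp: sorted_append)
  moreover have "set (map fst v) \<subseteq> set (as @ [a])" "set (map snd v) \<subseteq> set (bs @ [b])"
    using v keys_shuf[of v as "bs @ [b]"] keys_shuf[of v "as @ [a]" bs] by auto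
  ultimately show ?case
    using snoc.prems unfolding w by (force simp: sorted_append)
qed simp_all

text \<open>The empty list occurs in \<open>bd xs\<close> only if \<open>xs\<close> has one entry,
  and then with coefficient 1. This follows the start-of-path summand of \<open>shuf_snoc\<close>
  through the boundary.\<close>

lemma bd_count_Nil: "frag_extend (\<lambda>l. if l = [] \<and> P then v else 0) (bd xs) = (if length xs = 1 \<and> P then v else 0)"
  by (cases xs; cases "tl xs") (auto simp: frag_extend_linear)

text \<open>The last summand corrects for the augmentation.\<close>

lemma bd_shuf:
  "frag_extend bd (shuf as bs) = frag_extend (\<lambda>(l, m). shuf l m) (tbd (as, bs))
     + (if length as = 1 \<and> length bs = 1 then frag_of [] else 0)"
proof (induction as bs rule: shuf_induct)
  case (snoc as a bs b)
  let ?A = "frag_map (\<lambda>w. w @ [(a, b)])"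
  let ?p = "(-1::int) ^ length as" and ?q = "(-1::int) ^ length bs"
  \<comment> \<open>\<open>U\<close> and \<open>W\<close> hold the paths without their end point,
    for a last step in the first and in the second direction. The \<open>X\<close> and
    \<open>Y\<close> are the constituents of their boundaries; \<open>X3\<close>, where
    \<open>a\<close> and \<open>b\<close> are both removed, arises from \<open>U\<close> and from
    \<open>W\<close> and in the end with opposite signs.\<close>
  define U where "U = shuf as (bs @ [b])"
  define W where "W = shuf (as @ [a]) bs"
  define X1 where "X1 = frag_extend (\<lambda>l. shuf l (bs @ [b])) (bd as)"
  define X2 where "X2 = frag_extend (\<lambda>m. shuf as (m @ [b])) (bd bs)"
  define X3 where "X3 = shuf as bs"
  define Y1 where "Y1 = frag_extend (\<lambda>l. shuf (l @ [a]) bs) (bd as)"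
  define Y2 where "Y2 = frag_extend (\<lambda>m. shuf (as @ [a]) m) (bd bs)"
  define e :: "('a \<times> 'b) list \<Rightarrow>\<^sub>0 int" where "e = (if as = [] \<and> bs = [] then frag_of [] else 0)"
  define e1 :: "('a \<times> 'b) list \<Rightarrow>\<^sub>0 int" where "e1 = (if length as = 1 \<and> bs = [] then frag_of [] else 0)"
  define e2 :: "('a \<times> 'b) list \<Rightarrow>\<^sub>0 int" where "e2 = (if as = [] \<and> length bs = 1 then frag_of [] else 0)"
  have bdU: "frag_extend bd U = X1 - frag_cmul ?p (X2 + frag_cmul ?q X3) + e1"
    using snoc(1) by (simp add: tbd_def bd_snoc frag_extend_linear U_def X1_def X2_def X3_def e1_def)
  have bdW: "frag_extend bd W = Y1 + frag_cmul ?p X3 + frag_cmul ?p Y2 + e2"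
    using snoc(2) by (simp add: tbd_def bd_snoc frag_extend_linear W_def X3_def Y1_def Y2_def e2_def)
  \<comment> \<open>The summand with sign \<open>?p * ?q\<close> deletes the end point
    \<open>(a, b)\<close>, which has index \<open>length as + length bs\<close>.\<close>
  have bdA: "frag_extend bd (?A S) = ?A (frag_extend bd S) + frag_cmul (?p * ?q) S"
    if "\<And>w. w \<in> supp S \<Longrightarrow> length w = length as + length bs" for S
  proof -
    have "frag_extend bd (?A S) = frag_extend (\<lambda>w. bd (w @ [(a, b)])) S"
      by (simp add: frag_extend_linear)
    also have "\<dots> = frag_extend (\<lambda>w. ?A (bd w) + frag_cmul (?p * ?q) (frag_of w)) S"
      by (rule frag_extend_eq) (simp add: bd_snoc that power_add)
    finally show ?thesis by (simp add: frag_extend_linear)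
  qed
  have lenU: "length w = length as + length bs" if "w \<in> supp U" for w
    using keys_shuf[of w as "bs @ [b]"] that by (simp add: U_def)
  have lenW: "length w = length as + length bs" if "w \<in> supp W" for w
    using keys_shuf[of w "as @ [a]" bs] that by (simp add: W_def)
  have "frag_extend bd (shuf (as @ [a]) (bs @ [b]))
      = frag_cmul ?q (frag_extend bd (?A U)) + frag_extend bd (?A W) + frag_extend bd (?A e)"
    unfolding shuf_snoc U_def[symmetric] W_def[symmetric] e_def[symmetric]
    by (simp add: frag_extend_add frag_extend_cmul)
  also have "\<dots> = frag_cmul ?q (?A (frag_extend bd U) + frag_cmul (?p * ?q) U)
      + (?A (frag_extend bd W) + frag_cmul (?p * ?q) W) + e"
    by (simp add: bdA[OF lenU] bdA[OF lenW] e_def)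
  finally have L: "frag_extend bd (shuf (as @ [a]) (bs @ [b])) = \<dots>" .
  have A: "frag_extend (\<lambda>l. ?A (F l)) u = ?A (frag_extend F u)" for F and u :: "'c list \<Rightarrow>\<^sub>0 int"
    by (simp only: frag_extend_frag_extend)
  have R1: "frag_extend (\<lambda>l. shuf (l @ [a]) (bs @ [b])) (bd as) = ?A (frag_cmul ?q X1 + Y1 + e1)"
    unfolding shuf_snoc A
    by (simp add: frag_extend_lin X1_def Y1_def e1_def bd_count_Nil del: One_nat_def)
  \<comment> \<open>Lists in \<open>bd bs\<close> are one entry shorter than \<open>bs\<close>, so
    the sign in \<open>shuf_snoc\<close> is opposite to \<open>?q\<close>.\<close>
  have "frag_extend (\<lambda>m. shuf (as @ [a]) (m @ [b])) (bd bs)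
      = frag_extend (\<lambda>m. ?A (frag_cmul (- ?q) (shuf as (m @ [b])) + shuf (as @ [a]) m
      + (if m = [] \<and> as = [] then frag_of [] else 0))) (bd bs)"
  proof (rule frag_extend_eq)
    fix m assume "m \<in> supp (bd bs)"
    then have "length bs = Suc (length m)" using length_keys_bd by metis
    then show "shuf (as @ [a]) (m @ [b]) = ?A (frag_cmul (- ?q) (shuf as (m @ [b])) + shuf (as @ [a]) m
      + (if m = [] \<and> as = [] then frag_of [] else 0))"
      by (auto simp: shuf_snoc)
  qed
  also have "\<dots> = ?A (frag_cmul (- ?q) X2 + Y2 + e2)"
    unfolding A by (auto simp: frag_extend_lin X2_def Y2_def e2_def bd_count_Nil simp del: One_nat_def)
  finally have R2: "frag_extend (\<lambda>m. shuf (as @ [a]) (m @ [b])) (bd bs) = \<dots>" .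
  have R: "frag_extend (\<lambda>(l, m). shuf l m) (tbd (as @ [a], bs @ [b])) =
    ?A (frag_cmul ?q X1 + Y1 + e1) + frag_cmul ?p U
      + frag_cmul ?p (?A (frag_cmul (- ?q) X2 + Y2 + e2) + frag_cmul ?q W)"
    using R1 R2 by (simp add: tbd_def bd_snoc frag_extend_add frag_extend_diff frag_extend_cmul
        frag_extend_compose[unfolded comp_def] U_def W_def frag_cmul_distrib2)
  \<comment> \<open>The two sides differ by the factor \<open>?q\<close> on \<open>e1\<close> and
    \<open>?p\<close> on \<open>e2\<close>. Where \<open>e1\<close> or \<open>e2\<close> is nonzero,
    the list whose length gives the sign is empty and the factor is 1.\<close>
  have e1: "odd (length bs) \<Longrightarrow> e1 = 0" and e2: "odd (length as) \<Longrightarrow> e2 = 0"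
    by (auto simp: e1_def e2_def)
  have "(if length (as @ [a]) = 1 \<and> length (bs @ [b]) = 1 then frag_of [] else 0) = e"
    by (simp add: e_def)
  then show ?case
    unfolding L R bdU bdW using e1 e2
    by (cases "even (length as)"; cases "even (length bs)")
       (simp_all add: frag_extend_linear frag_cmul_distrib2 algebra_simps)
qed (simp_all add: tbd_def frag_extend_linear)

text \<open>\<open>shuf\<close> vanishes on pairs with an empty component, so it factors through the
  quotient. The correction term of \<open>bd_shuf\<close> occurs only for two singletons, that is,
  in degree 0.\<close>

lemma bd_shuf_ptbd:
  assumes "length as + length bs \<noteq> 2"
  shows "frag_extend bd (shuf as bs) = frag_extend (\<lambda>(l, m). shuf l m) (ptbd (as, bs))"
proof -
  have "frag_extend (\<lambda>(l, m). shuf l m) (nonaug x) = (case x of (l, m) \<Rightarrow> shuf l m)"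
    for x :: "'a list \<times> 'b list"
    by (auto simp: nonaug_def split: prod.split)
  then have "frag_extend (\<lambda>(l, m). shuf l m) (ptbd (as, bs)) = frag_extend (\<lambda>(l, m). shuf l m) (tbd (as, bs))"
    by (simp add: ptbd_def frag_extend_frag_extend)
  then show ?thesis using assms by (simp add: bd_shuf)
qed

section \<open>Degeneracies on lists and sums over shuffle permutations\<close>

definition dup :: "nat \<Rightarrow> 'a list \<Rightarrow> 'a list" where
  "dup i xs = take (Suc i) xs @ drop i xs"

lemma length_dup: "i < length xs \<Longrightarrow> length (dup i xs) = Suc (length xs)"
  by (simp add: dup_def)

lemma nth_dup: "i < length xs \<Longrightarrow> t \<le> length xs \<Longrightarrow> dup i xs ! t = (if t \<le> i then xs ! t else xs ! (t - 1))"
  by (auto simp: dup_def nth_append min_def intro!: arg_cong[of _ _ "(!) xs"])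

lemma dup_snoc: "i < length xs \<Longrightarrow> dup i (xs @ [x]) = dup i xs @ [x]"
  by (simp add: dup_def)

lemma set_dup: "i < length xs \<Longrightarrow> set (dup i xs) = set xs"
  by (metis append_take_drop_id dup_def set_append Un_assoc Un_absorb take_Suc_conv_app_nth
      hd_drop_conv_nth list.set_intros(1) list.simps(15) Cons_nth_drop_Suc insert_is_Un Un_commute)

lemma last_dup: "i < length xs \<Longrightarrow> last (dup i xs) = last xs"
  by (simp add: dup_def)

lemma dup_last: "xs \<noteq> [] \<Longrightarrow> dup (length xs - 1) xs = xs @ [last xs]"
  by (cases xs rule: rev_cases) (auto simp: dup_def)

text \<open>The degeneracies of \<open>nabla_term\<close> acting on one index list; a shuffle counts
  positions from 1, \<open>dup\<close> from 0.\<close>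

definition dups :: "(nat \<Rightarrow> nat) \<Rightarrow> nat \<Rightarrow> nat \<Rightarrow> 'a list \<Rightarrow> 'a list" where
  "dups f a m xs = fold (\<lambda>i. dup (f i - 1)) [a..<a + m] xs"

lemma dups_0 [simp]: "dups f a 0 xs = xs"
  by (simp add: dups_def)

lemma dups_Suc: "dups f a (Suc m) xs = dup (f (a + m) - 1) (dups f a m xs)"
  by (simp add: dups_def)

text \<open>After \<open>j\<close> repetitions there are \<open>length xs + j\<close> entries, so
  the hypothesis says that each position to be repeated exists. It also keeps all repetitions within
  the old list, so that an entry appended at the end stays in place.\<close>

lemma dups_props:
  assumes "\<And>j. j < m \<Longrightarrow> f (a + j) \<le> length xs + j" "xs \<noteq> []"
  shows "length (dups f a m xs) = length xs + m \<and> set (dups f a m xs) = set xs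
    \<and> last (dups f a m xs) = last xs \<and> dups f a m (xs @ [x]) = dups f a m xs @ [x]"
  using assms(1)
proof (induction m)
  case (Suc m)
  then have IH: "length (dups f a m xs) = length xs + m \<and> set (dups f a m xs) = set xs
    \<and> last (dups f a m xs) = last xs \<and> dups f a m (xs @ [x]) = dups f a m xs @ [x]"
    by simp
  have "f (a + m) \<le> length xs + m" using Suc.prems[of m] by simp
  then have "f (a + m) - 1 < length (dups f a m xs)"
    using IH assms(2) by (cases "f (a + m)") auto
  then show ?case using IH by (simp add: dups_Suc length_dup set_dup last_dup dup_snoc)
qed simp

lemma dups_cong: "(\<And>j. j < m \<Longrightarrow> f (a + j) = g (b + j)) \<Longrightarrow> dups f a m xs = dups g b m xs"
  by (induction m) (simp_all add: dups_Suc)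

text \<open>Where \<open>bs\<close> repeats an entry, the path moves in the first direction. So the
  first block of a shuffle, which lists the moments of the steps in the first direction, acts on
  \<open>bs\<close>, and the second block on \<open>as\<close>.\<close>

definition shuf_term :: "nat \<Rightarrow> nat \<Rightarrow> (nat \<Rightarrow> nat) \<Rightarrow> 'a list \<Rightarrow> 'b list \<Rightarrow> ('a \<times> 'b) list" where
  "shuf_term p q \<beta> as bs = zip (dups \<beta> (Suc p) q as) (dups \<beta> 1 p bs)"

lemma strict_mono_on_gap:
  fixes \<beta> :: "nat \<Rightarrow> nat"
  assumes "strict_mono_on {a..b} \<beta>" "a \<le> i" "i \<le> b"
  shows "\<beta> i + (b - i) \<le> \<beta> b"
  using assms(3,2)
proof (induction i rule: inc_induct)
  case (step i)
  have "\<beta> i < \<beta> (Suc i)" using assms(1) step by (auto simp: strict_mono_on_def)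
  then show ?case using step by auto
qed simp

lemma shuffle_perms_range: "\<beta> \<in> shuffle_perms p q \<Longrightarrow> i \<in> {1..p + q} \<Longrightarrow> \<beta> i \<in> {1..p + q}"
  unfolding shuffle_perms_def by (metis (no_types, lifting) mem_Collect_eq permutes_in_image)

text \<open>The later values of the block are larger and still at most \<open>p + q\<close>, so
  \<open>\<beta> (1 + j)\<close> has to leave room for them. This is the bound that
  \<open>dups_props\<close> asks for.\<close>

lemma shuffle_perms_le1:
  assumes "\<beta> \<in> shuffle_perms p q" "j < p" shows "\<beta> (1 + j) \<le> Suc q + j"
proof -
  have "\<beta> (1 + j) + (p - (1 + j)) \<le> \<beta> p"
    using assms by (intro strict_mono_on_gap) (auto simp: shuffle_perms_def)
  moreover have "\<beta> p \<le> p + q" using shuffle_perms_range[OF assms(1), of p] assms(2) by simp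
  ultimately show ?thesis using assms(2) by simp
qed

lemma shuffle_perms_le2:
  assumes "\<beta> \<in> shuffle_perms p q" "j < q" shows "\<beta> (Suc p + j) \<le> Suc p + j"
proof -
  have "\<beta> (Suc p + j) + ((p + q) - (Suc p + j)) \<le> \<beta> (p + q)"
    using assms by (intro strict_mono_on_gap) (auto simp: shuffle_perms_def)
  moreover have "\<beta> (p + q) \<le> p + q" using shuffle_perms_range[OF assms(1), of "p + q"] assms(2) by simp
  ultimately show ?thesis using assms(2) by simp
qed

text \<open>The cycle that sends \<open>a\<close> to \<open>a + q\<close> and lowers the
  \<open>q\<close> numbers after \<open>a\<close> by one. It carries the last step in the first
  direction past \<open>q\<close> steps in the second one; its sign \<open>(-1) ^ q\<close> is the
  sign in \<open>shuf_rev\<close>.\<close>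

primrec last_cycle :: "nat \<Rightarrow> nat \<Rightarrow> nat \<Rightarrow> nat" where
  "last_cycle a 0 = id"
| "last_cycle a (Suc q) = transpose (a + q) (Suc (a + q)) \<circ> last_cycle a q"

lemma last_cycle_permutes: "last_cycle a q permutes {a..a + q}"
proof (induction q)
  case (Suc q)
  have "last_cycle a q permutes {a..a + Suc q}"
    by (rule permutes_subset[OF Suc]) auto
  moreover have "transpose (a + q) (Suc (a + q)) permutes {a..a + Suc q}"
    by (rule permutes_swap_id) auto
  ultimately show ?case unfolding last_cycle.simps by (rule permutes_compose)
qed (simp only: last_cycle.simps permutes_id)

lemma last_cycle_apply:
  "last_cycle a q i = (if i = a then a + q else if a < i \<and> i \<le> a + q then i - 1 else i)"
  by (induction q) (auto simp: transpose_def)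

lemma sign_last_cycle: "sign (last_cycle a q) = (-1) ^ q"
proof (induction q)
  case (Suc q)
  have "permutation (last_cycle a q)"
    using last_cycle_permutes permutation_permutes by blast
  then show ?case
    unfolding last_cycle.simps by (subst sign_compose) (simp_all add: Suc sign_swap_id permutation_swap_id)
qed simp

lemma shuffle_perms_00: "shuffle_perms 0 0 = {id}"
  by (auto simp: shuffle_perms_def permutes_empty strict_mono_on_def)

lemma finite_shuffle_perms: "finite (shuffle_perms p q)"
  by (rule finite_subset[OF _ finite_permutations[of "{1..p + q}"]]) (auto simp: shuffle_perms_def)

text \<open>The largest value is attained in one of the two blocks, and by monotonicity at the end
  of that block.\<close>

lemma shuffle_perms_last_cases:
  assumes \<beta>: "\<beta> \<in> shuffle_perms p q" and "p + q \<noteq> 0"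
  shows "p \<noteq> 0 \<and> \<beta> p = p + q \<or> q \<noteq> 0 \<and> \<beta> (p + q) = p + q"
proof -
  have perm: "\<beta> permutes {1..p + q}" using \<beta> by (simp add: shuffle_perms_def)
  have "p + q \<in> \<beta> ` {1..p + q}" using permutes_image[OF perm] assms(2) by auto
  then obtain i where i: "i \<in> {1..p + q}" "\<beta> i = p + q" by auto
  show ?thesis
  proof (cases "i \<le> p")
    case True
    then have "\<beta> i + (p - i) \<le> \<beta> p"
      using i \<beta> by (intro strict_mono_on_gap[of 1]) (auto simp: shuffle_perms_def)
    moreover have "\<beta> p \<le> p + q" using shuffle_perms_range[OF \<beta>, of p] True i by simp
    ultimately show ?thesis using i True by auto
  next
    case False
    then have "\<beta> i + ((p + q) - i) \<le> \<beta> (p + q)"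
      using i \<beta> by (intro strict_mono_on_gap[of "p + 1"]) (auto simp: shuffle_perms_def)
    moreover have "\<beta> (p + q) \<le> p + q" using shuffle_perms_range[OF \<beta>, of "p + q"] i by simp
    ultimately show ?thesis using i False by auto
  qed
qed

lemma shuffle_perms_fix_last:
  "{\<beta> \<in> shuffle_perms p (Suc q). \<beta> (Suc (p + q)) = Suc (p + q)} = shuffle_perms p q"
proof (intro equalityI subsetI)
  fix \<beta> assume \<beta>: "\<beta> \<in> {\<beta> \<in> shuffle_perms p (Suc q). \<beta> (Suc (p + q)) = Suc (p + q)}"
  then have "\<beta> permutes {1..Suc (p + q)}" by (simp add: shuffle_perms_def)
  then have "\<beta> permutes {1..p + q}"
  proof (rule permutes_superset)
    fix x assume "x \<in> {1..Suc (p + q)} - {1..p + q}"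
    then have "x = Suc (p + q)" by auto
    then show "\<beta> x = x" using \<beta> by simp
  qed
  moreover have "strict_mono_on {p + 1..p + q} \<beta>"
    using \<beta> unfolding shuffle_perms_def by (auto simp: strict_mono_on_def)
  ultimately show "\<beta> \<in> shuffle_perms p q" using \<beta> by (simp add: shuffle_perms_def)
next
  fix \<beta> assume \<beta>: "\<beta> \<in> shuffle_perms p q"
  then have perm: "\<beta> permutes {1..p + q}" by (simp add: shuffle_perms_def)
  then have fx: "\<beta> (Suc (p + q)) = Suc (p + q)" by (rule permutes_not_in) simp
  have "\<beta> permutes {1..p + Suc q}" by (rule permutes_subset[OF perm]) auto
  moreover have "strict_mono_on {p + 1..p + Suc q} \<beta>"
  proof (rule strict_mono_onI)
    fix r s assume rs: "r \<in> {p + 1..p + Suc q}" "s \<in> {p + 1..p + Suc q}" "r < s"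
    show "\<beta> r < \<beta> s"
    proof (cases "s = Suc (p + q)")
      case True
      then have "\<beta> r \<le> p + q" using shuffle_perms_range[OF \<beta>, of r] rs by auto
      then show ?thesis using True fx by simp
    next
      case False
      then show ?thesis using \<beta> rs by (auto simp: shuffle_perms_def strict_mono_on_def)
    qed
  qed
  ultimately show "\<beta> \<in> {\<beta> \<in> shuffle_perms p (Suc q). \<beta> (Suc (p + q)) = Suc (p + q)}"
    using \<beta> fx by (simp add: shuffle_perms_def)
qed

lemma shuffle_perms_cycle:
  "{\<beta> \<in> shuffle_perms (Suc p) q. \<beta> (Suc p) = Suc (p + q)} = (\<lambda>\<beta>. \<beta> \<circ> last_cycle (Suc p) q) ` shuffle_perms p q"
  (is "?L = ?R")
proof (intro equalityI subsetI)
  let ?c = "last_cycle (Suc p) q"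
  have cp: "?c permutes {1..Suc (p + q)}"
    by (rule permutes_subset[OF last_cycle_permutes]) auto
  {
    fix \<beta> assume "\<beta> \<in> ?R"
    then obtain \<tau> where \<tau>: "\<tau> \<in> shuffle_perms p q" and \<beta>: "\<beta> = \<tau> \<circ> ?c" by auto
    have "\<tau> permutes {1..p + q}" using \<tau> by (simp add: shuffle_perms_def)
    then have tp: "\<tau> permutes {1..Suc (p + q)}" by (rule permutes_subset) auto
    have fx: "\<tau> (Suc (p + q)) = Suc (p + q)"
      by (rule permutes_not_in[OF \<open>\<tau> permutes {1..p + q}\<close>]) simp
    have "strict_mono_on {1..Suc p} \<beta>"
    proof (rule strict_mono_onI)
      fix r s assume rs: "r \<in> {1..Suc p}" "s \<in> {1..Suc p}" "r < s"
      show "\<beta> r < \<beta> s"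
      proof (cases "s = Suc p")
        case True
        then have "\<beta> r \<le> p + q"
          using shuffle_perms_range[OF \<tau>, of r] rs by (auto simp: \<beta> last_cycle_apply)
        then show ?thesis using True fx by (simp add: \<beta> last_cycle_apply)
      next
        case False
        then show ?thesis
          using \<tau> rs by (auto simp: \<beta> last_cycle_apply shuffle_perms_def strict_mono_on_def)
      qed
    qed
    moreover have "strict_mono_on {Suc p + 1..Suc p + q} \<beta>"
    proof (rule strict_mono_onI)
      fix r s assume rs: "r \<in> {Suc p + 1..Suc p + q}" "s \<in> {Suc p + 1..Suc p + q}" "r < s"
      have "strict_mono_on {p + 1..p + q} \<tau>" using \<tau> by (simp add: shuffle_perms_def)
      then have "\<tau> (r - 1) < \<tau> (s - 1)" by (rule strict_mono_onD) (use rs in auto)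
      then show "\<beta> r < \<beta> s" using rs by (simp add: \<beta> last_cycle_apply)
    qed
    moreover have "\<beta> permutes {1..Suc p + q}"
      using permutes_compose[OF cp tp] by (simp add: \<beta>)
    ultimately show "\<beta> \<in> ?L"
      using fx by (simp add: shuffle_perms_def \<beta> last_cycle_apply)
  }
  fix \<beta> assume \<beta>: "\<beta> \<in> ?L"
  define \<tau> where "\<tau> = \<beta> \<circ> inv_into UNIV ?c"
  have bij: "bij ?c" by (rule permutes_bij[OF cp])
  have \<beta>\<tau>: "\<beta> = \<tau> \<circ> ?c" by (simp add: \<tau>_def fun_eq_iff inv_f_f[OF bij_is_inj[OF bij]])
  have bp: "\<beta> permutes {1..Suc (p + q)}" using \<beta> by (simp add: shuffle_perms_def)
  have \<tau>: "\<tau> i = (if i = Suc (p + q) then \<beta> (Suc p) else if Suc p \<le> i \<and> i \<le> p + q then \<beta> (Suc i) else \<beta> i)" for i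
  proof -
    have "inv_into UNIV ?c i = (if i = Suc (p + q) then Suc p else if Suc p \<le> i \<and> i \<le> p + q then Suc i else i)"
      by (rule inv_f_eq[OF bij_is_inj[OF bij]]) (auto simp: last_cycle_apply)
    then show ?thesis by (simp add: \<tau>_def)
  qed
  have "\<tau> permutes {1..Suc (p + q)}"
    unfolding \<tau>_def by (rule permutes_compose[OF permutes_inv[OF cp] bp])
  then have "\<tau> permutes {1..p + q}"
  proof (rule permutes_superset)
    fix x assume "x \<in> {1..Suc (p + q)} - {1..p + q}"
    then have "x = Suc (p + q)" by auto
    then show "\<tau> x = x" using \<beta> \<tau>[of "Suc (p + q)"] by simp
  qed
  moreover have "strict_mono_on {1..p} \<tau>"
    using \<beta> by (auto simp: \<tau> shuffle_perms_def strict_mono_on_def)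
  moreover have "strict_mono_on {p + 1..p + q} \<tau>"
    using \<beta> by (auto simp: \<tau> shuffle_perms_def strict_mono_on_def)
  ultimately have "\<tau> \<in> shuffle_perms p q" by (simp add: shuffle_perms_def)
  then show "\<beta> \<in> ?R" using \<beta>\<tau> by auto
qed

definition shuf_sum :: "nat \<Rightarrow> nat \<Rightarrow> 'a list \<Rightarrow> 'b list \<Rightarrow> ('a \<times> 'b) list \<Rightarrow>\<^sub>0 int" where
  "shuf_sum p q as bs = (\<Sum>\<beta>\<in>shuffle_perms p q. frag_cmul (sign \<beta>) (frag_of (shuf_term p q \<beta> as bs)))"

text \<open>The degeneracy at the largest position comes last and repeats the last entry of
  \<open>as\<close>, while the degeneracies of the other block never reach the new entry
  \<open>b\<close>; so every path just gains one point.\<close>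

lemma shuf_sum_fix_last:
  assumes "length as = Suc p" "length bs = Suc q"
  shows "(\<Sum>\<beta>\<in>{\<beta> \<in> shuffle_perms p (Suc q). \<beta> (Suc (p + q)) = Suc (p + q)}.
      frag_cmul (sign \<beta>) (frag_of (shuf_term p (Suc q) \<beta> as (bs @ [b]))))
    = frag_map (\<lambda>w. w @ [(last as, b)]) (shuf_sum p q as bs)"
proof -
  have "shuf_term p (Suc q) \<beta> as (bs @ [b]) = shuf_term p q \<beta> as bs @ [(last as, b)]"
    if \<beta>: "\<beta> \<in> shuffle_perms p q" for \<beta>
  proof -
    have fx: "\<beta> (Suc (p + q)) = Suc (p + q)"
      using \<beta> shuffle_perms_fix_last[of p q] by blast
    have A: "length (dups \<beta> (Suc p) q as) = Suc (p + q) \<and> last (dups \<beta> (Suc p) q as) = last as"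
      using dups_props[of q \<beta> "Suc p" as] shuffle_perms_le2[OF \<beta>] assms by fastforce
    have B: "length (dups \<beta> 1 p bs) = Suc (p + q) \<and> dups \<beta> 1 p (bs @ [b]) = dups \<beta> 1 p bs @ [b]"
      using dups_props[of p \<beta> 1 bs b] shuffle_perms_le1[OF \<beta>] assms by fastforce
    have "dups \<beta> (Suc p) (Suc q) as = dups \<beta> (Suc p) q as @ [last as]"
      using dup_last[of "dups \<beta> (Suc p) q as"] A fx by (force simp: dups_Suc)
    then show ?thesis using A B by (simp add: shuf_term_def)
  qed
  then show ?thesis
    by (simp add: shuffle_perms_fix_last shuf_sum_def frag_extend_Sum[OF finite_shuffle_perms])
qed

lemma shuf_sum_cycle:
  assumes "length as = Suc p" "length bs = Suc q"
  shows "(\<Sum>\<beta>\<in>{\<beta> \<in> shuffle_perms (Suc p) q. \<beta> (Suc p) = Suc (p + q)}.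
      frag_cmul (sign \<beta>) (frag_of (shuf_term (Suc p) q \<beta> (as @ [a]) bs)))
    = frag_cmul ((-1) ^ q) (frag_map (\<lambda>w. w @ [(a, last bs)]) (shuf_sum p q as bs))"
proof -
  let ?c = "last_cycle (Suc p) q"
  have cp: "?c permutes {Suc p..Suc (p + q)}" using last_cycle_permutes[of "Suc p" q] by simp
  have "surj ?c" using permutes_surj[OF cp] .
  then have inj: "inj_on (\<lambda>\<beta>. \<beta> \<circ> ?c) X" for X :: "(nat \<Rightarrow> nat) set"
    by (auto simp: inj_on_def fun_eq_iff) (metis surjD)
  have T: "shuf_term (Suc p) q (\<beta> \<circ> ?c) (as @ [a]) bs = shuf_term p q \<beta> as bs @ [(a, last bs)]"
    if \<beta>: "\<beta> \<in> shuffle_perms p q" for \<beta>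
  proof -
    have fx: "\<beta> (Suc (p + q)) = Suc (p + q)"
      using \<beta> shuffle_perms_fix_last[of p q] by blast
    have A: "length (dups \<beta> (Suc p) q as) = Suc (p + q) \<and> dups \<beta> (Suc p) q (as @ [a]) = dups \<beta> (Suc p) q as @ [a]"
      using dups_props[of q \<beta> "Suc p" as a] shuffle_perms_le2[OF \<beta>] assms by fastforce
    have B: "length (dups \<beta> 1 p bs) = Suc (p + q) \<and> last (dups \<beta> 1 p bs) = last bs"
      using dups_props[of p \<beta> 1 bs] shuffle_perms_le1[OF \<beta>] assms by fastforce
    have C: "dups (\<beta> \<circ> ?c) (Suc (Suc p)) q (as @ [a]) = dups \<beta> (Suc p) q (as @ [a])"
      by (rule dups_cong) (simp add: last_cycle_apply)
    have "dups (\<beta> \<circ> ?c) 1 p bs = dups \<beta> 1 p bs"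
      by (rule dups_cong) (simp add: last_cycle_apply)
    then have "dups (\<beta> \<circ> ?c) 1 (Suc p) bs = dups \<beta> 1 p bs @ [last bs]"
      using dup_last[of "dups \<beta> 1 p bs"] B fx by (force simp: dups_Suc last_cycle_apply)
    then show ?thesis using A B C by (simp add: shuf_term_def)
  qed
  have S: "sign (\<beta> \<circ> ?c) = sign \<beta> * (-1) ^ q" if \<beta>: "\<beta> \<in> shuffle_perms p q" for \<beta>
  proof -
    have "permutation \<beta>" "permutation ?c"
      using \<beta> cp by (auto simp: shuffle_perms_def permutation_permutes)
    then show ?thesis by (simp add: sign_compose sign_last_cycle)
  qed
  have "(\<Sum>\<beta>\<in>shuffle_perms p q. frag_cmul (sign \<beta> * (-1) ^ q) (frag_of (shuf_term p q \<beta> as bs @ [(a, last bs)])))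
    = frag_cmul ((-1) ^ q) (\<Sum>\<beta>\<in>shuffle_perms p q. frag_cmul (sign \<beta>) (frag_of (shuf_term p q \<beta> as bs @ [(a, last bs)])))"
    by (subst frag_cmul_sum) (simp add: mult.commute)
  then show ?thesis
    unfolding shuffle_perms_cycle sum.reindex[OF inj]
    by (simp add: T S shuf_sum_def frag_extend_Sum[OF finite_shuffle_perms])
qed

text \<open>Shuffles are split by the place of their largest value just as \<open>shuf_snoc\<close>
  splits paths by their last step, and the two classes match the two recursive summands.\<close>

lemma shuf_eq_sum: "length as = Suc p \<Longrightarrow> length bs = Suc q \<Longrightarrow> shuf as bs = shuf_sum p q as bs"
proof (induction as bs arbitrary: p q rule: shuf_induct)
  case (snoc as a bs b)
  let ?A = "frag_map (\<lambda>w. w @ [(a, b)])"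
  let ?L1 = "if p = 0 then {} else {\<beta> \<in> shuffle_perms p q. \<beta> p = p + q}"
  \<comment> \<open>For \<open>q = 0\<close> the condition would coincide with that of
    \<open>?L1\<close>; the guard keeps the two classes disjoint.\<close>
  let ?L2 = "if q = 0 then {} else {\<beta> \<in> shuffle_perms p q. \<beta> (p + q) = p + q}"
  let ?t = "\<lambda>\<beta>. frag_cmul (sign \<beta>) (frag_of (shuf_term p q \<beta> (as @ [a]) (bs @ [b])))"
  have pq: "length as = p" "length bs = q" using snoc.prems by auto
  show ?case
  proof (cases "p + q = 0")
    case True
    then show ?thesis
      using pq shuf_snoc[of "[]" a "[]" b] by (simp add: shuf_sum_def shuffle_perms_00 shuf_term_def)
  next
    case False
    have un: "shuffle_perms p q = ?L1 \<union> ?L2"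
      using shuffle_perms_last_cases[OF _ False] by auto
    have dis: "?L1 \<inter> ?L2 = {}"
    proof -
      have False if "\<beta> \<in> shuffle_perms p q" "\<beta> p = p + q" "\<beta> (p + q) = p + q" "q \<noteq> 0" for \<beta>
      proof -
        have "inj \<beta>" using that(1) by (auto simp: shuffle_perms_def intro: permutes_inj)
        then show False using that(2-4) by (metis injD add.right_neutral add_left_cancel)
      qed
      then show ?thesis by auto
    qed
    have "shuf_sum p q (as @ [a]) (bs @ [b]) = sum ?t ?L1 + sum ?t ?L2"
      unfolding shuf_sum_def
      by (subst un, rule sum.union_disjoint) (use dis finite_shuffle_perms in auto)
    moreover have "sum ?t ?L1 = frag_cmul ((-1) ^ q) (?A (shuf as (bs @ [b])))"
    proof (cases p)
      case 0
      then show ?thesis using pq by simp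
    next
      case (Suc p')
      then show ?thesis
        using shuf_sum_cycle[of as p' "bs @ [b]" q a] snoc.IH(1)[of p' q] pq by simp
    qed
    moreover have "sum ?t ?L2 = ?A (shuf (as @ [a]) bs)"
    proof (cases q)
      case 0
      then show ?thesis using pq by simp
    next
      case (Suc q')
      then show ?thesis
        using shuf_sum_fix_last[of "as @ [a]" p bs q' b] snoc.IH(2)[of p q'] pq by simp
    qed
    ultimately show ?thesis
      using False pq by (auto simp: shuf_snoc frag_extend_add frag_extend_cmul)
  qed
qed simp_all

section \<open>Acyclic models\<close>

text \<open>\<open>Q i l\<close> is the basis in degree \<open>l\<close> of the model of shape
  \<open>i\<close>. Every element \<open>c\<close> arises from the generic one of its shape by the
  substitution \<open>act c\<close>, with which \<open>d\<close> and \<open>F\<close> commute, so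
  generic elements decide everything. \<open>cone\<close> contracts in positive degrees; degree 0 is
  covered by \<open>F_0\<close>.\<close>

locale acyclic_models =
  fixes Q :: "'i \<Rightarrow> nat \<Rightarrow> 'b set"
    and d F cone :: "'b \<Rightarrow> 'b \<Rightarrow>\<^sub>0 int"
    and shape :: "'b \<Rightarrow> 'i" and gen :: "'i \<Rightarrow> 'b" and act :: "'b \<Rightarrow> 'b \<Rightarrow> 'b"
  assumes d_Q: "c \<in> Q i (Suc l) \<Longrightarrow> supp (d c) \<subseteq> Q i l"
    and F_Q: "c \<in> Q i l \<Longrightarrow> supp (F c) \<subseteq> Q i l"
    and cone_Q: "c \<in> Q i l \<Longrightarrow> supp (cone c) \<subseteq> Q i (Suc l)"
    and d_cone: "c \<in> Q i (Suc l) \<Longrightarrow> frag_extend d (cone c) = frag_of c - frag_extend cone (d c)"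
    and d_d: "c \<in> Q i (Suc (Suc l)) \<Longrightarrow> frag_extend d (d c) = 0"
    and F_d: "c \<in> Q i (Suc l) \<Longrightarrow> frag_extend F (d c) = frag_extend d (F c)"
    and F_0: "c \<in> Q i 0 \<Longrightarrow> F c = frag_of c"
    and gen_Q: "c \<in> Q i l \<Longrightarrow> gen (shape c) \<in> Q (shape c) l"
    and act_gen: "c \<in> Q i l \<Longrightarrow> act c (gen (shape c)) = c"
    and act_Q: "\<lbrakk>b \<in> Q i l; c \<in> Q (shape b) m\<rbrakk> \<Longrightarrow> act b c \<in> Q i m"
    and shape_act: "\<lbrakk>b \<in> Q i l; c \<in> Q (shape b) m\<rbrakk> \<Longrightarrow> shape (act b c) = shape c"
    and act_act: "\<lbrakk>b \<in> Q i l; c \<in> Q (shape b) m; e \<in> Q (shape c) n\<rbrakk> \<Longrightarrow> act (act b c) e = act b (act c e)"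
    and act_d: "\<lbrakk>b \<in> Q i l; c \<in> Q (shape b) (Suc m)\<rbrakk> \<Longrightarrow> d (act b c) = frag_map (act b) (d c)"
    and act_F: "\<lbrakk>b \<in> Q i l; c \<in> Q (shape b) m\<rbrakk> \<Longrightarrow> F (act b c) = frag_map (act b) (F c)"
begin

text \<open>Each basis element \<open>s\<close> of a complex receives a map \<open>R s\<close> from
  the model of shape \<open>sh s\<close> that sends the generic element to \<open>s\<close> and
  respects boundary and endomorphism. The clause on \<open>R (R s c) e\<close> is functoriality of
  substitution; the naturality of the homotopy rests on it.\<close>

definition realizes ::
  "(nat \<Rightarrow> 's set) \<Rightarrow> (nat \<Rightarrow> 's \<Rightarrow> 's \<Rightarrow>\<^sub>0 int) \<Rightarrow> (nat \<Rightarrow> 's \<Rightarrow> 's \<Rightarrow>\<^sub>0 int) \<Rightarrow> ('s \<Rightarrow> 'b \<Rightarrow> 's) \<Rightarrow> ('s \<Rightarrow> 'i) \<Rightarrow> bool" where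
  "realizes B dB FB R sh \<longleftrightarrow>
     (\<forall>l. \<forall>s\<in>B l. gen (sh s) \<in> Q (sh s) l \<and> R s (gen (sh s)) = s \<and>
       (\<forall>m. \<forall>c\<in>Q (sh s) m. R s c \<in> B m \<and> sh (R s c) = shape c \<and>
          FB m (R s c) = frag_map (R s) (F c) \<and>
          (\<forall>n. \<forall>e\<in>Q (shape c) n. R (R s c) e = R s (act c e))) \<and>
       (\<forall>m. \<forall>c\<in>Q (sh s) (Suc m). dB m (R s c) = frag_map (R s) (d c)))"

text \<open>As the models are themselves realizations, \<open>real_htpy_step\<close> is available
  inside them while the homotopy is built degree by degree.\<close>

lemma realizes_self: "realizes (Q i) (\<lambda>_. d) (\<lambda>_. F) act shape"
  unfolding realizes_def
  by (auto simp: gen_Q act_gen act_Q shape_act act_d act_F act_act)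

text \<open>The generic element of each shape is sent to the cone on the cycle that has to be bounded.\<close>

primrec htpy :: "nat \<Rightarrow> 'i \<Rightarrow> 'b \<Rightarrow>\<^sub>0 int" where
  "htpy 0 i = 0"
| "htpy (Suc l) i = frag_extend cone (F (gen i) - frag_of (gen i)
     - frag_extend (\<lambda>b. frag_map (act b) (htpy l (shape b))) (d (gen i)))"

definition real_htpy :: "('s \<Rightarrow> 'b \<Rightarrow> 's) \<Rightarrow> ('s \<Rightarrow> 'i) \<Rightarrow> nat \<Rightarrow> 's \<Rightarrow> 's \<Rightarrow>\<^sub>0 int" where
  "real_htpy R sh l s = frag_map (R s) (htpy l (sh s))"

lemma keys_htpy: "gen i \<in> Q i l \<Longrightarrow> supp (htpy l i) \<subseteq> Q i (Suc l)"
proof (induction l arbitrary: i)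
  case (Suc l)
  let ?H = "\<lambda>b. frag_map (act b) (htpy l (shape b))"
  have "supp (?H b) \<subseteq> Q i (Suc l)" if "b \<in> supp (d (gen i))" for b
  proof -
    have b: "b \<in> Q i l" using that d_Q[OF Suc.prems] by auto
    show ?thesis
      using Suc.IH[OF gen_Q[OF b]] act_Q[OF b] by (intro keys_frag_extend_subset) auto
  qed
  then have "supp (frag_extend ?H (d (gen i))) \<subseteq> Q i (Suc l)"
    by (rule keys_frag_extend_subset)
  moreover have "supp (F (gen i) - frag_of (gen i)) \<subseteq> Q i (Suc l)"
    using keys_diff[of "F (gen i)" "frag_of (gen i)"] F_Q[OF Suc.prems] Suc.prems by auto
  ultimately have "supp (F (gen i) - frag_of (gen i) - frag_extend ?H (d (gen i))) \<subseteq> Q i (Suc l)"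
    using keys_diff[of "F (gen i) - frag_of (gen i)" "frag_extend ?H (d (gen i))"] by blast
  then show ?case
    unfolding htpy.simps using cone_Q by (intro keys_frag_extend_subset) blast
qed simp

lemma keys_real_htpy:
  assumes "realizes B dB FB R sh" "s \<in> B l"
  shows "supp (real_htpy R sh l s) \<subseteq> B (Suc l)"
proof -
  have "gen (sh s) \<in> Q (sh s) l" and R: "\<And>c. c \<in> Q (sh s) (Suc l) \<Longrightarrow> R s c \<in> B (Suc l)"
    using assms by (auto simp: realizes_def)
  then show ?thesis
    unfolding real_htpy_def using keys_htpy by (intro keys_frag_extend_subset) auto
qed

text \<open>The homotopy at \<open>R s c\<close> substitutes \<open>R s c\<close> into the chain
  chosen for \<open>shape c\<close>. By functoriality this amounts to substituting \<open>c\<close>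
  first and applying \<open>R s\<close> afterwards.\<close>

lemma real_htpy_natural:
  assumes "realizes B dB FB R sh" "s \<in> B l" "supp u \<subseteq> Q (sh s) m"
  shows "frag_extend (real_htpy R sh m) (frag_map (R s) u)
    = frag_map (R s) (frag_extend (real_htpy act shape m) u)"
proof -
  have "real_htpy R sh m (R s c) = frag_map (R s) (real_htpy act shape m c)"
    if "c \<in> supp u" for c
  proof -
    have c: "c \<in> Q (sh s) m" using that assms(3) by auto
    have eq: "R (R s c) e = R s (act c e)" if "e \<in> supp (htpy m (shape c))" for e
      using assms(1,2) c that keys_htpy[OF gen_Q[OF c]] unfolding realizes_def by blast
    have "sh (R s c) = shape c" using assms(1,2) c unfolding realizes_def by blast
    then have "real_htpy R sh m (R s c) = frag_map (R (R s c)) (htpy m (shape c))"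
      by (simp add: real_htpy_def)
    also have "\<dots> = frag_map (\<lambda>x. R s (act c x)) (htpy m (shape c))"
      by (rule frag_extend_eq) (simp add: eq)
    finally show ?thesis by (simp add: real_htpy_def frag_extend_frag_extend)
  qed
  then show ?thesis
    by (simp add: frag_extend_frag_extend cong: frag_extend_eq)
qed

text \<open>Boundary, endomorphism and homotopy all commute with \<open>R s\<close>, and
  \<open>R s\<close> takes the generic element to \<open>s\<close>; so the identity assumed for the
  generic element carries over to \<open>s\<close>.\<close>

lemma real_htpy_step:
  assumes R: "realizes B dB FB R sh" and s: "s \<in> B (Suc l)"
    and gen: "frag_extend d (htpy (Suc l) (sh s)) = F (gen (sh s)) - frag_of (gen (sh s))
      - frag_extend (real_htpy act shape l) (d (gen (sh s)))"
  shows "frag_extend (dB (Suc l)) (real_htpy R sh (Suc l) s)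
    = FB (Suc l) s - frag_of s - frag_extend (real_htpy R sh l) (dB l s)"
proof -
  let ?g = "gen (sh s)" and ?R = "frag_map (R s)"
  have g: "?g \<in> Q (sh s) (Suc l)" and Rg: "R s ?g = s" using R s unfolding realizes_def by blast+
  have "FB (Suc l) (R s ?g) = ?R (F ?g)" using R s g unfolding realizes_def by blast
  then have Fs: "FB (Suc l) s = ?R (F ?g)" unfolding Rg .
  have "dB l (R s ?g) = ?R (d ?g)" using R s g unfolding realizes_def by blast
  then have ds: "dB l s = ?R (d ?g)" unfolding Rg .
  have "frag_extend (dB (Suc l)) (real_htpy R sh (Suc l) s)
      = frag_extend (\<lambda>x. dB (Suc l) (R s x)) (htpy (Suc l) (sh s))"
    by (simp only: real_htpy_def frag_extend_frag_extend frag_extend_of)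
  also have "\<dots> = frag_extend (\<lambda>x. ?R (d x)) (htpy (Suc l) (sh s))"
  proof (rule frag_extend_eq)
    fix x assume "x \<in> supp (htpy (Suc l) (sh s))"
    then have "x \<in> Q (sh s) (Suc (Suc l))" using keys_htpy[OF g] by blast
    then show "dB (Suc l) (R s x) = ?R (d x)" using R s unfolding realizes_def by blast
  qed
  also have "\<dots> = ?R (frag_extend d (htpy (Suc l) (sh s)))"
    by (simp only: frag_extend_frag_extend)
  also have "\<dots> = ?R (F ?g) - ?R (frag_of ?g) - ?R (frag_extend (real_htpy act shape l) (d ?g))"
    unfolding gen by (simp only: frag_extend_diff)
  also have "?R (frag_extend (real_htpy act shape l) (d ?g)) = frag_extend (real_htpy R sh l) (dB l s)"
    unfolding ds by (rule real_htpy_natural[OF R s d_Q[OF g], symmetric])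
  finally show ?thesis by (simp add: Fs Rg)
qed

lemma d_cone_linear:
  "supp v \<subseteq> Q i (Suc l) \<Longrightarrow>
     frag_extend d (frag_extend cone v) = v - frag_extend cone (frag_extend d v)"
  by (induction v rule: frag_induction) (auto simp: frag_extend_diff d_cone)

text \<open>Induction on the degree: the chain to be bounded is a cycle because the identity already
  holds one degree lower, and the cone on a cycle of positive degree has that cycle as its
  boundary.\<close>

lemma d_htpy:
  assumes "gen i \<in> Q i (Suc l)"
  shows "frag_extend d (htpy (Suc l) i) = F (gen i) - frag_of (gen i)
      - frag_extend (real_htpy act shape l) (d (gen i))"
  using assms
proof (induction l arbitrary: i)
  case (0 i)
  \<comment> \<open>\<open>d (gen i)\<close> lives in degree 0, where \<open>F\<close> is the
    identity; so \<open>F (gen i)\<close> and \<open>gen i\<close> have the same boundary.\<close>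
  have "frag_extend F (d (gen i)) = frag_extend frag_of (d (gen i))"
    using d_Q[OF 0] F_0 by (intro frag_extend_eq) auto
  then have cyc: "frag_extend d (F (gen i) - frag_of (gen i)) = 0"
    using F_d[OF 0] by (simp add: frag_extend_diff)
  let ?y = "F (gen i) - frag_of (gen i)"
  have y: "supp ?y \<subseteq> Q i (Suc 0)"
    using keys_diff[of "F (gen i)" "frag_of (gen i)"] F_Q[OF 0] 0 by auto
  have "frag_extend d (frag_extend cone ?y) = ?y" using d_cone_linear[OF y] cyc by simp
  then show ?case by (simp add: real_htpy_def)
next
  case (Suc l i)
  let ?g = "gen i" and ?H = "\<lambda>l. frag_extend (real_htpy act shape l)"
  have "frag_extend d (?H (Suc l) (d ?g)) = frag_extend (\<lambda>b. frag_extend d (real_htpy act shape (Suc l) b)) (d ?g)"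
    by (simp only: frag_extend_frag_extend)
  also have "\<dots> = frag_extend (\<lambda>b. F b - frag_of b - ?H l (d b)) (d ?g)"
  proof (rule frag_extend_eq)
    fix b assume "b \<in> supp (d ?g)"
    then have b: "b \<in> Q i (Suc l)" using d_Q[OF Suc.prems] by auto
    show "frag_extend d (real_htpy act shape (Suc l) b) = F b - frag_of b - ?H l (d b)"
      using real_htpy_step[OF realizes_self b Suc.IH[OF gen_Q[OF b]]] .
  qed
  also have "\<dots> = frag_extend F (d ?g) - d ?g - ?H l (frag_extend d (d ?g))"
    by (simp add: frag_extend_fun_diff frag_extend_frag_extend)
  finally have cyc: "frag_extend d (F ?g - frag_of ?g - ?H (Suc l) (d ?g)) = 0"
    using F_d[OF Suc.prems] d_d[OF Suc.prems] by (simp add: frag_extend_diff)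
  let ?y = "F ?g - frag_of ?g - ?H (Suc l) (d ?g)"
  have "supp (?H (Suc l) (d ?g)) \<subseteq> Q i (Suc (Suc l))"
    using d_Q[OF Suc.prems] keys_real_htpy[OF realizes_self]
    by (intro keys_frag_extend_subset) blast
  then have y: "supp ?y \<subseteq> Q i (Suc (Suc l))"
    using keys_diff[of "F ?g" "frag_of ?g"] keys_diff[of "F ?g - frag_of ?g" "?H (Suc l) (d ?g)"]
      F_Q[OF Suc.prems] Suc.prems by auto
  have "frag_extend d (frag_extend cone ?y) = ?y" using d_cone_linear[OF y] cyc by simp
  then show ?case by (simp only: htpy.simps(2)[of "Suc l"] real_htpy_def[abs_def])
qed

lemma cohomology_map_realization:
  assumes R: "realizes B dB FB R sh" and A: "comm_group A" and \<phi>: "chain_map K K \<phi>"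
    and chains: "\<And>k. chains K k = free_Abelian_group (B k)"
    and bdry: "\<And>k. bdry K k = frag_extend (dB k)" and map: "\<And>k. \<phi> k = frag_extend (FB k)"
    and X: "X \<in> carrier (cohomology A K n)"
  shows "cohomology_map A K K \<phi> n X = X"
proof (rule cohomology_map_homotopic_id[OF A \<phi>, where H = "\<lambda>n. frag_extend (real_htpy R sh n)"])
  show "frag_extend (real_htpy R sh n) \<in> hom (chains K n) (chains K (Suc n))" for n
    unfolding chains using keys_real_htpy[OF R]
    by (fastforce intro!: homI simp: frag_extend_add intro!: keys_frag_extend_subset)
next
  fix x assume "x \<in> carrier (chains K 0)"
  then have x: "supp x \<subseteq> B 0" by (simp add: chains)
  have "FB 0 s = frag_of s" if s: "s \<in> B 0" for s
  proof -
    have g: "gen (sh s) \<in> Q (sh s) 0" "R s (gen (sh s)) = s" using R s unfolding realizes_def by blast+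
    then have "FB 0 (R s (gen (sh s))) = frag_map (R s) (F (gen (sh s)))"
      using R s unfolding realizes_def by blast
    then show ?thesis using g by (simp add: F_0)
  qed
  then have "frag_extend (FB 0) x = frag_extend frag_of x"
    using x by (intro frag_extend_eq) auto
  then show "\<phi> 0 x = x" by (simp add: map)
next
  fix n x assume "x \<in> carrier (chains K (Suc n))"
  then have x: "supp x \<subseteq> B (Suc n)" by (simp add: chains)
  have "frag_extend (dB (Suc n)) (frag_extend (real_htpy R sh (Suc n)) x)
      = frag_extend (FB (Suc n)) x - x - frag_extend (real_htpy R sh n) (frag_extend (dB n) x)"
    using x
  proof (induction x rule: frag_induction)
    case (one s)
    then have "gen (sh s) \<in> Q (sh s) (Suc n)" using R unfolding realizes_def by blast
    from real_htpy_step[OF R one d_htpy[OF this]] show ?case by simp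
  qed (auto simp: frag_extend_diff)
  then show "\<phi> (Suc n) x = bdry K (Suc n) (frag_extend (real_htpy R sh (Suc n)) x) \<otimes>\<^bsub>chains K (Suc n)\<^esub>
      frag_extend (real_htpy R sh n) (bdry K n x) \<otimes>\<^bsub>chains K (Suc n)\<^esub> x"
    by (simp add: chains bdry map)
qed (rule X)

end

section \<open>The combinatorial models\<close>

definition rect :: "nat \<Rightarrow> nat \<Rightarrow> (nat \<times> nat) set" where
  "rect p q = {..p} \<times> {..q}"

definition stair :: "nat \<Rightarrow> (nat \<times> nat) set" where
  "stair k = {(i, j). i \<le> j \<and> j \<le> k}"

text \<open>Lists of lengths p + 1 and q + 1 have degree \<open>l\<close> = p + q. The whole
  rectangle spanned by them has to lie in \<open>V\<close>, because the two actions carry morphisms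
  across it.\<close>

definition bgrid :: "(nat \<times> nat) set \<Rightarrow> nat \<Rightarrow> (nat list \<times> nat list) set" where
  "bgrid V l = {(as, bs). as \<noteq> [] \<and> bs \<noteq> [] \<and> sorted as \<and> sorted bs \<and> set as \<times> set bs \<subseteq> V
     \<and> length as + length bs = Suc (Suc l)}"

definition dgrid :: "(nat \<times> nat) set \<Rightarrow> nat \<Rightarrow> (nat \<times> nat) list set" where
  "dgrid V l = {w. length w = Suc l \<and> sorted (map fst w) \<and> sorted (map snd w)
     \<and> set (map fst w) \<times> set (map snd w) \<subseteq> V}"

text \<open>A morphism of the product category from the point \<open>y\<close> to the point
  \<open>x\<close> runs through the corner \<open>(fst x, snd y)\<close>, where its two parts
  meet.\<close>

definition chain_rel :: "(nat \<times> nat) set \<Rightarrow> nat \<times> nat \<Rightarrow> nat \<times> nat \<Rightarrow> bool" where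
  "chain_rel V x y \<longleftrightarrow> fst x \<le> fst y \<and> snd x \<le> snd y \<and> (fst x, snd y) \<in> V"

text \<open>The relation is demanded of all pairs of entries, not only of neighbours: for arbitrary
  \<open>V\<close> it need not be transitive, and faces turn distant entries into
  neighbours.\<close>

definition ngrid :: "(nat \<times> nat) set \<Rightarrow> nat \<Rightarrow> (nat \<times> nat) list set" where
  "ngrid V l = {w. length w = Suc l \<and> sorted_wrt (chain_rel V) w \<and> set w \<subseteq> V}"

text \<open>This inclusion is \<Pi> on indices.\<close>

lemma dgrid_subset_ngrid: "dgrid V l \<subseteq> ngrid V l"
proof
  fix w assume w: "w \<in> dgrid V l"
  have "sorted_wrt (chain_rel V) w"
    unfolding sorted_wrt_iff_nth_less
  proof (intro allI impI)
    fix i j assume ij: "i < j" "j < length w"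
    have "map fst w ! i \<le> map fst w ! j" "map snd w ! i \<le> map snd w ! j"
      using w ij sorted_nth_mono[of "map fst w" i j] sorted_nth_mono[of "map snd w" i j]
      by (simp_all add: dgrid_def)
    moreover have "fst (w ! i) \<in> set (map fst w)" "snd (w ! j) \<in> set (map snd w)"
      using ij by auto
    then have "(fst (w ! i), snd (w ! j)) \<in> V" using w by (auto simp: dgrid_def)
    ultimately show "chain_rel V (w ! i) (w ! j)"
      using ij by (simp add: chain_rel_def)
  qed
  moreover have "set w \<subseteq> V" using w by (auto simp: dgrid_def subset_iff image_iff) (metis fst_conv snd_conv)
  ultimately show "w \<in> ngrid V l" using w by (simp add: dgrid_def ngrid_def)
qed

lemma keys_bd_dgrid:
  assumes "w \<in> dgrid V (Suc l)" shows "supp (bd w) \<subseteq> dgrid V l"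
proof
  fix v assume "v \<in> supp (bd w)"
  then obtain i where i: "i < length w" "v = del i w" using keys_bd by blast
  have "set (map fst v) \<subseteq> set (map fst w)" "set (map snd v) \<subseteq> set (map snd w)"
    unfolding i map_del by (rule set_del_subset)+
  then have "set (map fst v) \<times> set (map snd v) \<subseteq> V" using assms unfolding dgrid_def by blast
  moreover have "sorted (map fst v)" "sorted (map snd v)"
    using assms unfolding i map_del dgrid_def by (auto intro: sorted_wrt_del)
  moreover have "length v = Suc l" using assms i by (simp add: dgrid_def length_del)
  ultimately show "v \<in> dgrid V l" unfolding dgrid_def by blast
qed

lemma keys_bd_ngrid:
  assumes "w \<in> ngrid V (Suc l)" shows "supp (bd w) \<subseteq> ngrid V l"
proof
  fix v assume "v \<in> supp (bd w)"
  then obtain i where "i < length w" "v = del i w" using keys_bd by blast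
  then show "v \<in> ngrid V l"
    using assms set_del_subset[of i w] unfolding ngrid_def
    by (auto simp: length_del sorted_wrt_del)
qed

lemma keys_ptbd:
  assumes "x \<in> supp (ptbd (as, bs))"
  shows "fst x \<noteq> [] \<and> snd x \<noteq> [] \<and>
    ((\<exists>i<length as. x = (del i as, bs)) \<or> (\<exists>j<length bs. x = (as, del j bs)))"
proof -
  have "supp (tbd (as, bs)) \<subseteq>
      supp (frag_map (\<lambda>l. (l, bs)) (bd as)) \<union>
      supp (frag_map (\<lambda>l. (as, l)) (bd bs))"
    unfolding tbd_def prod.case by (rule order_trans[OF keys_diff]) auto
  also have "\<dots> \<subseteq> (\<lambda>l. (l, bs)) ` supp (bd as) \<union> (\<lambda>l. (as, l)) ` supp (bd bs)"
    by (rule Un_mono; rule order_trans[OF keys_frag_extend]; auto)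
  finally have "supp (tbd (as, bs)) \<subseteq> \<dots>" .
  then have T: "y \<in> (\<lambda>l. (l, bs)) ` supp (bd as) \<union> (\<lambda>l. (as, l)) ` supp (bd bs)"
    if "y \<in> supp (tbd (as, bs))" for y using that by blast
  from subsetD[OF keys_frag_extend assms[unfolded ptbd_def]]
  obtain y where y: "y \<in> supp (tbd (as, bs))" "x \<in> supp (nonaug y)" by blast
  then have x: "x = y" "fst x \<noteq> []" "snd x \<noteq> []" by (auto simp: nonaug_def split: if_split_asm)
  from T[OF y(1)] have "(\<exists>i<length as. x = (del i as, bs)) \<or> (\<exists>j<length bs. x = (as, del j bs))"
    unfolding x(1)[symmetric] using keys_bd[of as] keys_bd[of bs] by blast
  then show ?thesis using x by blast
qed

lemma keys_ptbd_bgrid: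
  assumes "c \<in> bgrid V (Suc l)" shows "supp (ptbd c) \<subseteq> bgrid V l"
proof
  fix x assume x: "x \<in> supp (ptbd c)"
  obtain as bs where c: "c = (as, bs)" by (cases c)
  from keys_ptbd[OF x[unfolded c]] consider
    i where "i < length as" "x = (del i as, bs)" "del i as \<noteq> []"
    | j where "j < length bs" "x = (as, del j bs)" "del j bs \<noteq> []" by auto
  then show "x \<in> bgrid V l"
  proof cases
    case 1
    then show ?thesis
      using assms set_del_subset[of i as] unfolding c bgrid_def
      by (auto simp: length_del sorted_wrt_del)
  next
    case 2
    then show ?thesis
      using assms set_del_subset[of j bs] unfolding c bgrid_def
      by (auto simp: length_del sorted_wrt_del)
  qed
qed

lemma keys_AW: "supp (AW w) \<subseteq> (\<lambda>p. (map fst (take (Suc p) w), map snd (drop p w))) ` {..<length w}"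
proof -
  have "supp (AW w) \<subseteq>
      (\<Union>p<length w. supp (frag_of (map fst (take (Suc p) w), map snd (drop p w))))"
    unfolding AW_sum by (rule keys_sum)
  then show ?thesis by auto
qed

text \<open>In the summand that splits at \<open>p\<close>, first coordinates come from positions up
  to \<open>p\<close> and second ones from positions from \<open>p\<close> on. So each point of its
  rectangle is an entry of \<open>w\<close> or the corner of two entries.\<close>

lemma keys_AW_ngrid:
  assumes "w \<in> ngrid V l" shows "supp (AW w) \<subseteq> bgrid V l"
proof
  fix x assume "x \<in> supp (AW w)"
  then obtain p where p: "p < length w" and x: "x = (map fst (take (Suc p) w), map snd (drop p w))"
    using keys_AW by blast
  have rel: "chain_rel V (w ! i) (w ! j)" if "i < j" "j < length w" for i j
    using assms that by (simp add: ngrid_def sorted_wrt_iff_nth_less)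
  have "(fst (w ! i), snd (w ! j)) \<in> V" if "i \<le> j" "j < length w" for i j
  proof (cases "i = j")
    case True
    then show ?thesis using assms that nth_mem[of i w] by (auto simp: ngrid_def)
  next
    case False
    then show ?thesis using rel[of i j] that by (simp add: chain_rel_def)
  qed
  note V = this
  have T: "\<exists>i\<le>p. x = w ! i" if "x \<in> set (take (Suc p) w)" for x
    using that p by (auto simp: in_set_conv_nth less_Suc_eq_le)
  have D: "\<exists>j\<ge>p. j < length w \<and> x = w ! j" if "x \<in> set (drop p w)" for x
  proof -
    obtain i where "i < length w - p" "x = drop p w ! i" using \<open>x \<in> set (drop p w)\<close> by (auto simp: in_set_conv_nth)
    then show ?thesis using p by (intro exI[of _ "p + i"]) auto
  qed
  have "(fst x, snd y) \<in> V" if "x \<in> set (take (Suc p) w)" "y \<in> set (drop p w)" for x y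
    using T[OF that(1)] D[OF that(2)] V le_trans by blast
  then have "set (map fst (take (Suc p) w)) \<times> set (map snd (drop p w)) \<subseteq> V"
    by auto
  moreover have "sorted (map fst w)" "sorted (map snd w)"
    using rel by (auto simp: sorted_wrt_iff_nth_less chain_rel_def)
  then have "sorted (take (Suc p) (map fst w))" "sorted (drop p (map snd w))"
    by (auto intro: sorted_wrt_take sorted_wrt_drop)
  ultimately show "x \<in> bgrid V l"
    using assms p by (auto simp: x bgrid_def take_map drop_map ngrid_def)
qed

lemma keys_shuf_dgrid:
  assumes "(as, bs) \<in> bgrid V l" shows "supp (shuf as bs) \<subseteq> dgrid V l"
proof
  fix w assume w: "w \<in> supp (shuf as bs)"
  have "sorted (map fst w) \<and> sorted (map snd w)"
    using sorted_keys_shuf[OF _ _ w] assms by (simp add: bgrid_def)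
  moreover have "set (map fst w) \<times> set (map snd w) \<subseteq> V"
    using keys_shuf[OF w] assms unfolding bgrid_def by blast
  moreover have "length w = Suc l" using keys_shuf[OF w] assms by (simp add: bgrid_def)
  ultimately show "w \<in> dgrid V l" by (simp add: dgrid_def)
qed

definition Fdiag :: "('a \<times> 'b) list \<Rightarrow> ('a \<times> 'b) list \<Rightarrow>\<^sub>0 int" where
  "Fdiag w = frag_extend (\<lambda>(l, m). shuf l m) (AW w)"

definition Ftot :: "'a list \<times> 'b list \<Rightarrow> ('a list \<times> 'b list) \<Rightarrow>\<^sub>0 int" where
  "Ftot = (\<lambda>(l, m). frag_extend AW (shuf l m))"

text \<open>The image lies in \<open>dgrid\<close> even for \<open>w\<close> in
  \<open>ngrid\<close>: a round trip that starts in the nerve passes through diagonal bisimplices,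
  to which \<Pi> can be applied.\<close>

lemma keys_Fdiag_ngrid:
  assumes "w \<in> ngrid V l" shows "supp (Fdiag w) \<subseteq> dgrid V l"
  unfolding Fdiag_def
proof (rule keys_frag_extend_subset)
  fix x assume "x \<in> supp (AW w)"
  then have "x \<in> bgrid V l" using keys_AW_ngrid[OF assms] by blast
  then show "supp (case x of (l, m) \<Rightarrow> shuf l m) \<subseteq> dgrid V l"
    by (cases x) (simp add: keys_shuf_dgrid)
qed

lemma keys_Ftot_bgrid:
  assumes "c \<in> bgrid V l" shows "supp (Ftot c) \<subseteq> bgrid V l"
proof (cases c)
  case (Pair as bs)
  then have "supp (shuf as bs) \<subseteq> ngrid V l"
    using keys_shuf_dgrid[of as bs] assms dgrid_subset_ngrid[of V l] by blast
  then show ?thesis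
    unfolding Ftot_def Pair prod.case using keys_AW_ngrid
    by (intro keys_frag_extend_subset) blast
qed

lemma ptbd_shuf:
  assumes "c \<in> bgrid V (Suc l)"
  shows "frag_extend (\<lambda>(l, m). shuf l m) (ptbd c) = frag_extend bd (case c of (l, m) \<Rightarrow> shuf l m)"
  using assms by (cases c) (auto simp: bgrid_def bd_shuf_ptbd)

lemma Fdiag_bd:
  assumes "w \<in> ngrid V (Suc l)"
  shows "frag_extend Fdiag (bd w) = frag_extend bd (Fdiag w)"
proof -
  have "frag_extend Fdiag (bd w) = frag_extend (\<lambda>(l, m). shuf l m) (frag_extend ptbd (AW w))"
    by (simp add: Fdiag_def[abs_def] ptbd_AW frag_extend_frag_extend)
  also have "\<dots> = frag_extend (\<lambda>c. frag_extend bd (case c of (l, m) \<Rightarrow> shuf l m)) (AW w)"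
    unfolding frag_extend_frag_extend
    using keys_AW_ngrid[OF assms] ptbd_shuf by (intro frag_extend_eq) blast
  finally show ?thesis by (simp add: Fdiag_def frag_extend_frag_extend)
qed

lemma Ftot_ptbd:
  assumes "c \<in> bgrid V (Suc l)"
  shows "frag_extend Ftot (ptbd c) = frag_extend ptbd (Ftot c)"
proof -
  have "frag_extend Ftot (ptbd c) = frag_extend AW (frag_extend (\<lambda>(l, m). shuf l m) (ptbd c))"
    by (simp add: Ftot_def frag_extend_frag_extend split_def)
  also have "\<dots> = frag_extend ptbd (Ftot c)"
    unfolding ptbd_shuf[OF assms]
    by (simp add: Ftot_def frag_extend_frag_extend split_def ptbd_AW)
  finally show ?thesis .
qed

lemma shuf_singleton: "shuf [a] [b] = frag_of [(a, b)]"
  using shuf_snoc[of "[]" a "[]" b] by simp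

definition dact :: "(nat \<times> nat) list \<Rightarrow> (nat \<times> nat) list \<Rightarrow> (nat \<times> nat) list" where
  "dact w = map (map_prod (\<lambda>i. fst (w ! i)) (\<lambda>j. snd (w ! j)))"

definition bact :: "nat list \<times> nat list \<Rightarrow> nat list \<times> nat list \<Rightarrow> nat list \<times> nat list" where
  "bact = (\<lambda>(as, bs) (l, m). (map ((!) as) l, map ((!) bs) m))"

definition dgen :: "nat \<Rightarrow> (nat \<times> nat) list" where
  "dgen k = map (\<lambda>i. (i, i)) [0..<Suc k]"

definition bgen :: "nat \<times> nat \<Rightarrow> nat list \<times> nat list" where
  "bgen = (\<lambda>(p, q). ([0..<Suc p], [0..<Suc q]))"

definition bshape :: "'a list \<times> 'b list \<Rightarrow> nat \<times> nat" where
  "bshape = (\<lambda>(l, m). (length l - 1, length m - 1))"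

text \<open>
  Prepending \<open>0\<close> to the first list contracts the first direction only onto the constant list \<open>[0]\<close>; the
  second summand then contracts the second direction.
\<close>

definition cone_tot :: "nat list \<times> nat list \<Rightarrow> (nat list \<times> nat list) \<Rightarrow>\<^sub>0 int" where
  "cone_tot = (\<lambda>(l, m). frag_of (0 # l, m) + (if length l = 1 then frag_of ([0], 0 # m) else 0))"

lemma Fdiag_dact: "Fdiag (dact w v) = frag_map (dact w) (Fdiag v)"
  by (simp add: Fdiag_def dact_def AW_map frag_extend_frag_extend split_def shuf_map)

lemma bd_dact: "bd (dact w v) = frag_map (dact w) (bd v)"
  by (simp add: dact_def bd_map)

lemma Ftot_bact: "Ftot (bact b c) = frag_map (bact b) (Ftot c)"
  by (cases b; cases c)
     (simp add: Ftot_def bact_def AW_map frag_extend_frag_extend split_def shuf_map)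

lemma ptbd_bact: "ptbd (bact b c) = frag_map (bact b) (ptbd c)"
  by (cases b; cases c) (simp add: bact_def ptbd_map split_def)

lemma sorted_map_nth:
  fixes xs :: "'a :: linorder list"
  assumes "sorted xs" "sorted is" "\<forall>i\<in>set is. i < length xs"
  shows "sorted (map ((!) xs) is)"
  unfolding sorted_wrt_map
  by (rule sorted_wrt_mono_rel[OF _ assms(2)]) (use assms in \<open>auto intro: sorted_nth_mono\<close>)

lemma bact_bgrid:
  assumes b: "b \<in> bgrid V l" and c: "c \<in> bgrid (rect (fst (bshape b)) (snd (bshape b))) m"
  shows "bact b c \<in> bgrid V m"
proof -
  obtain as bs l m' where bc: "b = (as, bs)" "c = (l, m')" by (cases b; cases c)
  have ne: "as \<noteq> []" "bs \<noteq> []" "l \<noteq> []" "m' \<noteq> []" using b c by (auto simp: bc bgrid_def)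
  have "set l \<times> set m' \<subseteq> {..length as - 1} \<times> {..length bs - 1}"
    using c by (simp add: bc bgrid_def rect_def bshape_def)
  then have lm: "\<forall>i\<in>set l. i < length as" "\<forall>i\<in>set m'. i < length bs"
    using ne unfolding times_subset_iff by (auto simp: subset_iff Suc_le_eq less_Suc_eq_le[symmetric])
  have "sorted (map ((!) as) l)" "sorted (map ((!) bs) m')"
    using b c lm by (auto simp: bc bgrid_def intro!: sorted_map_nth)
  moreover have "set (map ((!) as) l) \<subseteq> set as" "set (map ((!) bs) m') \<subseteq> set bs"
    using lm by auto
  moreover have "set as \<times> set bs \<subseteq> V" using b by (simp add: bc bgrid_def)
  ultimately have "set (map ((!) as) l) \<times> set (map ((!) bs) m') \<subseteq> V" by blast
  then show ?thesis
    using c ne \<open>sorted (map ((!) as) l)\<close> \<open>sorted (map ((!) bs) m')\<close>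
    by (simp add: bc bgrid_def bact_def)
qed

text \<open>For a first list with at least two entries this is the usual contraction. For a first
  list \<open>[a]\<close>, the boundary of the first summand leaves a term with first list
  \<open>[0]\<close>, since the augmentation that would account for it is projected away; the
  boundary of the second summand contains the same term with the opposite sign.\<close>

lemma d_cone_tot:
  assumes "c \<in> bgrid V (Suc l)"
  shows "frag_extend ptbd (cone_tot c) = frag_of c - frag_extend cone_tot (ptbd c)"
proof -
  obtain as bs where c: "c = (as, bs)" by (cases c)
  have ne: "as \<noteq> []" "bs \<noteq> []" and len: "length as + length bs = l + 3"
    using assms by (auto simp: c bgrid_def)
  have ptbd_alt: "ptbd (as, bs) = frag_extend (\<lambda>l. nonaug (l, bs)) (bd as)
     - frag_cmul ((-1) ^ length as) (frag_extend (\<lambda>l. nonaug (as, l)) (bd bs))"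
    for as bs :: "nat list"
    by (simp add: ptbd_def tbd_def frag_extend_linear)
  show ?thesis
  proof (cases "length as = 1")
    case False
    \<comment> \<open>The boundary of a list of length 2 is a difference of two singletons, on which
      the second summand of the cone takes the same value; from longer lists no singleton
      arises.\<close>
    have one: "frag_extend (\<lambda>l. if length l = Suc 0 then v else 0) (bd as) = 0" for v :: "(nat list \<times> nat list) \<Rightarrow>\<^sub>0 int"
    proof (cases "length as = 2")
      case True
      then obtain x y where "as = [x, y]" by (auto simp: numeral_2_eq_2 length_Suc_conv)
      then show ?thesis by (simp add: frag_extend_diff)
    next
      case False
      then show ?thesis by (intro frag_extend_eq_0) (use length_keys_bd[of _ as] in fastforce)
    qed
    have "frag_extend cone_tot (nonaug (l, bs)) = frag_of (0 # l, bs) + (if length l = 1 then frag_of ([0], 0 # bs) else 0)"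
      if "l \<in> supp (bd as)" for l
      using length_keys_bd[OF that] False ne by (auto simp: nonaug_def cone_tot_def)
    then have 1: "frag_extend (\<lambda>l. frag_extend cone_tot (nonaug (l, bs))) (bd as)
        = frag_map (\<lambda>l. (0 # l, bs)) (bd as)"
      by (simp add: frag_extend_fun_add one cong: frag_extend_eq)
    have 2: "frag_extend cone_tot (nonaug (as, l)) = nonaug (0 # as, l)" for l
      using False ne by (simp add: nonaug_def cone_tot_def)
    have 3: "cone_tot (as, bs) = frag_of (0 # as, bs)" "nonaug (as, bs) = frag_of (as, bs)"
      "nonaug (0 # l, bs) = frag_of (0 # l, bs)" for l
      using False ne by (simp_all add: nonaug_def cone_tot_def)
    show ?thesis
      unfolding c 3 frag_extend_of ptbd_alt
      by (simp add: frag_extend_linear 1 2 3)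
  next
    case True
    then obtain a where a: "as = [a]" by (auto simp: length_Suc_conv)
    have nb: "l \<noteq> []" if "l \<in> supp (bd bs)" for l
      using length_keys_bd[OF that] len a by auto
    have 1: "frag_extend (\<lambda>l. nonaug (xs, l)) (bd bs) = frag_map (\<lambda>l. (xs, l)) (bd bs)" if "xs \<noteq> []" for xs :: "nat list"
      using nb that by (intro frag_extend_eq) (simp add: nonaug_def)
    have 2: "nonaug ([], l) = 0" "cone_tot ([a], l) = frag_of ([0, a], l) + frag_of ([0], 0 # l)"
      for l :: "nat list"
      by (simp_all add: nonaug_def cone_tot_def)
    have 3: "nonaug (xs, 0 # l) = frag_of (xs, 0 # l)" "nonaug (xs, bs) = frag_of (xs, bs)"
      if "xs \<noteq> []" for xs l :: "nat list"
      using ne that by (simp_all add: nonaug_def)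
    show ?thesis
      unfolding c a by (simp add: 2 3 ptbd_alt frag_extend_add frag_extend_diff frag_extend_minus 1)
        (simp add: frag_extend_linear 2 3)
  qed
qed

interpretation tot: acyclic_models "\<lambda>i. bgrid (rect (fst i) (snd i))" ptbd Ftot cone_tot bshape bgen bact
proof
  fix c i l assume c: "c \<in> bgrid (rect (fst i) (snd i)) l"
  show "supp (Ftot c) \<subseteq> bgrid (rect (fst i) (snd i)) l"
    by (rule keys_Ftot_bgrid[OF c])
  show "supp (cone_tot c) \<subseteq> bgrid (rect (fst i) (snd i)) (Suc l)"
  proof -
    obtain as bs where cc: "c = (as, bs)" by (cases c)
    have "supp (cone_tot c) \<subseteq> {(0 # as, bs)} \<union> (if length as = 1 then {([0], 0 # bs)} else {})"
      unfolding cc cone_tot_def prod.case by (rule order_trans[OF keys_add]) auto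
    also have "\<dots> \<subseteq> bgrid (rect (fst i) (snd i)) (Suc l)"
      using c by (auto simp: cc bgrid_def rect_def times_subset_iff)
    finally show ?thesis .
  qed
  show "bgen (bshape c) \<in> bgrid (rect (fst (bshape c)) (snd (bshape c))) l"
    using c by (cases c) (auto simp: bgen_def bshape_def bgrid_def rect_def simp del: upt_Suc)
  show "bact c (bgen (bshape c)) = c"
    using c by (cases c) (auto simp: bgen_def bshape_def bact_def bgrid_def map_nth simp del: upt_Suc)
next
  fix b i l c m
  assume b: "b \<in> bgrid (rect (fst i) (snd i)) l" and c: "c \<in> bgrid (rect (fst (bshape b)) (snd (bshape b))) m"
  show "bact b c \<in> bgrid (rect (fst i) (snd i)) m" by (rule bact_bgrid[OF b c])
  show "bshape (bact b c) = bshape c" by (cases b; cases c) (simp add: bshape_def bact_def)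
  fix e n assume e: "e \<in> bgrid (rect (fst (bshape c)) (snd (bshape c))) n"
  obtain l1 l2 m1 m2 where lm: "c = (l1, l2)" "e = (m1, m2)" by (cases c; cases e)
  have ne: "l1 \<noteq> []" "l2 \<noteq> []" "m1 \<noteq> []" "m2 \<noteq> []" using c e by (auto simp: lm bgrid_def)
  have "set m1 \<times> set m2 \<subseteq> {..length l1 - 1} \<times> {..length l2 - 1}"
    using e by (simp add: lm bgrid_def rect_def bshape_def)
  then have "\<forall>i\<in>set m1. i < length l1" "\<forall>i\<in>set m2. i < length l2"
    using ne unfolding times_subset_iff by (auto simp: subset_iff less_Suc_eq_le[symmetric])
  then show "bact (bact b c) e = bact b (bact c e)"
    by (cases b) (simp add: lm bact_def)
next
  fix c i assume "c \<in> bgrid (rect (fst i) (snd i)) 0"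
  then obtain a b where "c = ([a], [b])"
    by (cases c; cases "fst c"; cases "snd c") (auto simp: bgrid_def)
  then show "Ftot c = frag_of c" by (simp add: Ftot_def shuf_singleton)
qed (simp_all add: keys_ptbd_bgrid ptbd_ptbd Ftot_ptbd ptbd_bact Ftot_bact d_cone_tot)

lemma dact_dact:
  assumes "\<And>x. x \<in> set e \<Longrightarrow> fst x < length c \<and> snd x < length c"
  shows "dact (dact b c) e = dact b (dact c e)"
  using assms by (auto simp: dact_def)

lemma dact_dgen: "w \<noteq> [] \<Longrightarrow> dact w (dgen (length w - 1)) = w"
  by (rule nth_equalityI) (auto simp: dact_def dgen_def simp del: upt_Suc)

lemma Fdiag_singleton: "length w = Suc 0 \<Longrightarrow> Fdiag w = frag_of w"
  by (auto simp: length_Suc_conv Fdiag_def shuf_singleton)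

lemma dgrid_rect_lt:
  assumes "c \<in> dgrid (rect (n - 1) (n - 1)) m" "0 < n" "x \<in> set c"
  shows "fst x < n \<and> snd x < n"
proof -
  have "(fst x, snd x) \<in> set (map fst c) \<times> set (map snd c)"
    by (rule SigmaI) (use assms(3) in auto)
  then have "(fst x, snd x) \<in> rect (n - 1) (n - 1)"
    using assms(1) unfolding dgrid_def by blast
  then show ?thesis using assms(2) by (auto simp: rect_def)
qed

interpretation diag: acyclic_models "\<lambda>k. dgrid (rect k k)" bd Fdiag "\<lambda>w. frag_of ((0, 0) # w)"
  "\<lambda>w. length w - 1" dgen dact
proof
  fix c k l assume c: "c \<in> dgrid (rect k k) l"
  show "supp (Fdiag c) \<subseteq> dgrid (rect k k) l"
    using keys_Fdiag_ngrid dgrid_subset_ngrid c by blast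
  show "supp (frag_of ((0, 0) # c)) \<subseteq> dgrid (rect k k) (Suc l)"
    using c by (auto simp: dgrid_def rect_def)
  show "dgen (length c - 1) \<in> dgrid (rect (length c - 1) (length c - 1)) l"
    using c by (auto simp: dgen_def dgrid_def rect_def comp_def simp del: upt_Suc)
  show "dact c (dgen (length c - 1)) = c"
    using c by (intro dact_dgen) (auto simp: dgrid_def)
next
  fix b k l c m
  assume b: "b \<in> dgrid (rect k k) l" and c: "c \<in> dgrid (rect (length b - 1) (length b - 1)) m"
  have lt: "fst x < length b \<and> snd x < length b" if "x \<in> set c" for x
    using dgrid_rect_lt[OF c _ that] b by (cases "b = []") (auto simp: dgrid_def)
  have "sorted (map ((!) (map fst b)) (map fst c))" "sorted (map ((!) (map snd b)) (map snd c))"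
    by (rule sorted_map_nth; use b c lt in \<open>auto simp: dgrid_def\<close>)+
  moreover have "map ((!) (map fst b)) (map fst c) = map fst (dact b c)"
    "map ((!) (map snd b)) (map snd c) = map snd (dact b c)"
    using lt by (auto simp: dact_def)
  moreover have "set (map fst (dact b c)) \<subseteq> set (map fst b)" "set (map snd (dact b c)) \<subseteq> set (map snd b)"
    using lt by (auto simp: dact_def)
  moreover have "set (map fst b) \<times> set (map snd b) \<subseteq> rect k k" using b unfolding dgrid_def by blast
  ultimately have "set (map fst (dact b c)) \<times> set (map snd (dact b c)) \<subseteq> rect k k"
      "sorted (map fst (dact b c))" "sorted (map snd (dact b c))"
    by (blast, simp_all)
  moreover have "length (dact b c) = Suc m" using c by (simp add: dgrid_def dact_def)
  ultimately show "dact b c \<in> dgrid (rect k k) m" unfolding dgrid_def by blast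
  show "length (dact b c) - 1 = length c - 1" by (simp add: dact_def)
  fix e n assume e: "e \<in> dgrid (rect (length c - 1) (length c - 1)) n"
  show "dact (dact b c) e = dact b (dact c e)"
    by (rule dact_dact) (use c dgrid_rect_lt[OF e] in \<open>auto simp: dgrid_def\<close>)
next
  fix c k l assume "c \<in> dgrid (rect k k) (Suc l)"
  then show "frag_extend Fdiag (bd c) = frag_extend bd (Fdiag c)"
    using Fdiag_bd dgrid_subset_ngrid by blast
next
  fix c k assume "c \<in> dgrid (rect k k) 0"
  then show "Fdiag c = frag_of c" by (intro Fdiag_singleton) (simp add: dgrid_def)
qed (simp_all add: keys_bd_dgrid bd_bd Fdiag_dact bd_dact)

lemma ngrid_stair_lt:
  assumes "c \<in> ngrid (stair k) m" "x \<in> set c"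
  shows "fst x \<le> snd x \<and> snd x \<le> k"
  using assms by (auto simp: ngrid_def stair_def)

text \<open>A point \<open>(i, j)\<close> with \<open>i \<le> j\<close> is replaced by the corner of
  the entries \<open>i\<close> and \<open>j\<close> of \<open>b\<close>, and such corners are
  exactly what \<open>ngrid\<close> guarantees to lie in \<open>V\<close>. This is why the nerve is
  modelled on staircases.\<close>

lemma dact_ngrid:
  assumes b: "b \<in> ngrid V l" and c: "c \<in> ngrid (stair (length b - 1)) m"
  shows "dact b c \<in> ngrid V m"
proof -
  have len: "length b = Suc l" using b by (simp add: ngrid_def)
  have rel: "chain_rel V (b ! i) (b ! j)" if "i < j" "j < length b" for i j
    using b that by (simp add: ngrid_def sorted_wrt_iff_nth_less)
  have V: "(fst (b ! i), snd (b ! j)) \<in> V" if "i \<le> j" "j < length b" for i j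
  proof (cases "i = j")
    case True
    then show ?thesis using b that nth_mem[of i b] by (auto simp: ngrid_def)
  next
    case False
    then show ?thesis using rel[of i j] that by (simp add: chain_rel_def)
  qed
  have mono: "fst (b ! i) \<le> fst (b ! j)" "snd (b ! i) \<le> snd (b ! j)" if "i \<le> j" "j < length b" for i j
    using rel[of i j] that by (cases "i = j"; simp add: chain_rel_def)+
  have lt: "fst x \<le> snd x \<and> snd x < length b" if "x \<in> set c" for x
    using ngrid_stair_lt[OF c that] len by simp
  have "sorted_wrt (\<lambda>x y. chain_rel V (map_prod (\<lambda>i. fst (b ! i)) (\<lambda>j. snd (b ! j)) x)
      (map_prod (\<lambda>i. fst (b ! i)) (\<lambda>j. snd (b ! j)) y)) c"
  proof (rule sorted_wrt_mono_rel)
    show "sorted_wrt (chain_rel (stair (length b - 1))) c" using c by (simp add: ngrid_def)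
    fix x y assume xy: "x \<in> set c" "y \<in> set c" "chain_rel (stair (length b - 1)) x y"
    then show "chain_rel V (map_prod (\<lambda>i. fst (b ! i)) (\<lambda>j. snd (b ! j)) x)
      (map_prod (\<lambda>i. fst (b ! i)) (\<lambda>j. snd (b ! j)) y)"
      using lt[of x] lt[of y] by (auto simp: chain_rel_def stair_def intro!: mono V)
  qed
  moreover have "set (dact b c) \<subseteq> V" using lt V by (auto simp: dact_def)
  ultimately show ?thesis using c by (simp add: ngrid_def dact_def sorted_wrt_map)
qed

text \<open>The vertex \<open>(0, 0)\<close> may be put in front because the corner that it forms
  with a point \<open>(i, j)\<close> is \<open>(0, j)\<close>, which is again in the
  staircase.\<close>

interpretation bow: acyclic_models "\<lambda>k. ngrid (stair k)" bd Fdiag "\<lambda>w. frag_of ((0, 0) # w)"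
  "\<lambda>w. length w - 1" dgen dact
proof
  fix c k l assume c: "c \<in> ngrid (stair k) l"
  show "supp (Fdiag c) \<subseteq> ngrid (stair k) l"
    using keys_Fdiag_ngrid[OF c] dgrid_subset_ngrid by blast
  show "supp (frag_of ((0, 0) # c)) \<subseteq> ngrid (stair k) (Suc l)"
    using c ngrid_stair_lt[OF c] by (auto simp: ngrid_def stair_def chain_rel_def)
  show "dgen (length c - 1) \<in> ngrid (stair (length c - 1)) l"
    using c by (auto simp: dgen_def ngrid_def stair_def chain_rel_def sorted_wrt_map
        sorted_wrt_iff_nth_less simp del: upt_Suc)
  show "dact c (dgen (length c - 1)) = c"
    using c by (intro dact_dgen) (auto simp: ngrid_def)
next
  fix b k l c m
  assume b: "b \<in> ngrid (stair k) l" and c: "c \<in> ngrid (stair (length b - 1)) m"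
  show "dact b c \<in> ngrid (stair k) m" by (rule dact_ngrid[OF b c])
  show "length (dact b c) - 1 = length c - 1" by (simp add: dact_def)
  fix e n assume e: "e \<in> ngrid (stair (length c - 1)) n"
  have "length c = Suc m" using c by (simp add: ngrid_def)
  then show "dact (dact b c) e = dact b (dact c e)"
    by (intro dact_dact) (use ngrid_stair_lt[OF e] in \<open>auto simp: less_Suc_eq_le intro: le_trans\<close>)
next
  fix c k assume "c \<in> ngrid (stair k) 0"
  then show "Fdiag c = frag_of c" by (intro Fdiag_singleton) (simp add: ngrid_def)
qed (simp_all add: keys_bd_ngrid bd_bd Fdiag_bd Fdiag_dact bd_dact)

section \<open>Grids in a matched pair\<close>

definition steps :: "('a \<Rightarrow> 'a \<Rightarrow> 'b) \<Rightarrow> 'a list \<Rightarrow> 'b list" where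
  "steps f xs = map (\<lambda>t. f (xs ! t) (xs ! Suc t)) [0..<length xs - 1]"

lemma length_steps [simp]: "length (steps f xs) = length xs - 1"
  by (simp add: steps_def)

lemma nth_steps [simp]: "t < length xs - 1 \<Longrightarrow> steps f xs ! t = f (xs ! t) (xs ! Suc t)"
  by (simp add: steps_def)

lemma steps_eq_Nil: "steps f xs = [] \<longleftrightarrow> length xs \<le> 1"
  by (simp add: steps_def)

lemma steps_cong: "(\<And>t. Suc t < length xs \<Longrightarrow> f (xs ! t) (xs ! Suc t) = g (xs ! t) (xs ! Suc t)) \<Longrightarrow> steps f xs = steps g xs"
  by (simp add: steps_def)

lemma map_steps: "map g (steps f xs) = steps (\<lambda>x y. g (f x y)) xs"
  by (simp add: steps_def)

lemma steps_map: "steps f (map h xs) = steps (\<lambda>x y. f (h x) (h y)) xs"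
  by (simp add: steps_def)

lemma hd_steps: "2 \<le> length xs \<Longrightarrow> hd (steps f xs) = f (xs ! 0) (xs ! 1)"
  by (subst hd_conv_nth) (auto simp: steps_eq_Nil)

lemma last_steps: "2 \<le> length xs \<Longrightarrow> last (steps f xs) = f (xs ! (length xs - 2)) (xs ! (length xs - 1))"
  by (subst last_conv_nth) (auto simp: steps_eq_Nil Suc_diff_Suc numeral_2_eq_2)

lemma steps_del_0: "2 \<le> length xs \<Longrightarrow> steps f (del 0 xs) = tl (steps f xs)"
  by (cases xs) (auto simp: del_0 nth_tl intro!: nth_equalityI)

lemma steps_del_last: "2 \<le> length xs \<Longrightarrow> steps f (del (length xs - 1) xs) = butlast (steps f xs)"
  by (rule nth_equalityI) (auto simp: length_del nth_del nth_butlast)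

lemma steps_del_mid:
  assumes "0 < i" "Suc i < length xs"
    and "cmp E (f (xs ! (i - 1)) (xs ! i)) (f (xs ! i) (xs ! Suc i)) = f (xs ! (i - 1)) (xs ! Suc i)"
  shows "steps f (del i xs) = merge_at E i (steps f xs)"
proof (rule nth_equalityI)
  show "length (steps f (del i xs)) = length (merge_at E i (steps f xs))"
    using assms by (auto simp: merge_at_def length_del)
  fix t assume "t < length (steps f (del i xs))"
  then have t: "t < length xs - 2" using assms by (simp add: length_del)
  consider "t < i - 1" | "t = i - 1" | "i \<le> t" by linarith
  then show "steps f (del i xs) ! t = merge_at E i (steps f xs) ! t"
  proof cases
    case 1
    then have "t < i" "Suc t < i" by auto
    then show ?thesis using 1 assms t by (simp add: merge_at_def nth_append nth_del length_del)
  next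
    case 2
    then show ?thesis using assms t by (simp add: merge_at_def nth_append nth_del length_del)
  next
    case 3
    then obtain u where "t = i + u" using le_Suc_ex by blast
    moreover have "\<not> i + u < i - 1" by simp
    ultimately show ?thesis
      using assms t by (simp add: merge_at_def nth_append nth_del length_del nth_Cons Suc_diff_le split: nat.splits)
  qed
qed

lemma steps_dup:
  assumes "i < length xs"
  shows "steps f (dup i xs) = take i (steps f xs) @ [f (xs ! i) (xs ! i)] @ drop i (steps f xs)"
proof (rule nth_equalityI)
  show "length (steps f (dup i xs)) = length (take i (steps f xs) @ [f (xs ! i) (xs ! i)] @ drop i (steps f xs))"
    using assms by (auto simp: length_dup)
  fix t assume "t < length (steps f (dup i xs))"
  then have t: "t < length xs" using assms by (simp add: length_dup)
  consider "t < i" | "t = i" | "i < t" by linarith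
  then show "steps f (dup i xs) ! t = (take i (steps f xs) @ [f (xs ! i) (xs ! i)] @ drop i (steps f xs)) ! t"
  proof cases
    case 1
    then have "t < length xs - 1" using assms by simp
    then show ?thesis using 1 assms t by (simp add: nth_append nth_dup length_dup min_def)
  next
    case 3
    then obtain u where "t = i + Suc u" using less_imp_Suc_add by auto
    moreover have "i < length xs - 1" using 3 t by simp
    ultimately show ?thesis using assms t by (simp add: nth_append nth_dup length_dup nth_Cons min_def)
  qed (use assms t in \<open>simp_all add: nth_append nth_dup length_dup min_def\<close>)
qed

text \<open>\<open>g t\<close> stands for the composite of \<open>f t\<close> up to
  \<open>f (b - 1)\<close>; the hypotheses build it from the right end, in the association used by
  \<open>composite\<close>.\<close>

lemma composite_upt:
  assumes "a < b" "\<And>t. a \<le> t \<Longrightarrow> Suc t = b \<Longrightarrow> f t = g t"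
    and "\<And>t. a \<le> t \<Longrightarrow> Suc t < b \<Longrightarrow> cmp E (f t) (g (Suc t)) = g t"
  shows "composite E (map f [a..<b]) = g a"
  using assms
proof (induction "b - a" arbitrary: a)
  case (Suc n)
  show ?case
  proof (cases "Suc a = b")
    case True
    then show ?thesis using Suc.prems by (simp add: upt_rec)
  next
    case False
    then have lt: "Suc a < b" using Suc.prems by simp
    then have "composite E (map f [Suc a..<b]) = g (Suc a)"
      using Suc.prems Suc.hyps by (intro Suc.hyps(1)) auto
    moreover have "[a..<b] = a # Suc a # [Suc (Suc a)..<b]" "[Suc a..<b] = Suc a # [Suc (Suc a)..<b]"
      using lt by (simp_all add: upt_conv_Cons)
    ultimately show ?thesis using Suc.prems lt by simp
  qed
qed simp

lemma composite_steps:
  assumes "i < k" "k < length xs"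
    and "\<And>t. i \<le> t \<Longrightarrow> Suc t < k \<Longrightarrow> cmp E (f (xs ! t) (xs ! Suc t)) (f (xs ! Suc t) (xs ! k)) = f (xs ! t) (xs ! k)"
  shows "composite E (drop i (take k (steps f xs))) = f (xs ! i) (xs ! k)"
proof -
  have "drop i (take k (steps f xs)) = map (\<lambda>t. f (xs ! t) (xs ! Suc t)) [i..<k]"
    using assms by (simp add: steps_def take_map drop_map)
  also have "composite E \<dots> = f (xs ! i) (xs ! k)"
    using assms by (intro composite_upt[where g = "\<lambda>t. f (xs ! t) (xs ! k)"]) auto
  finally show ?thesis .
qed

abbreviation csteps :: "(nat \<Rightarrow> nat \<Rightarrow> nat \<Rightarrow> 'm) \<Rightarrow> nat \<Rightarrow> nat list \<Rightarrow> 'm list" where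
  "csteps cf j \<equiv> steps (\<lambda>a a'. cf a a' j)"

abbreviation zsteps :: "(nat \<Rightarrow> nat \<Rightarrow> nat \<Rightarrow> 'm) \<Rightarrow> (nat \<Rightarrow> nat \<Rightarrow> nat \<Rightarrow> 'm) \<Rightarrow> (nat \<times> nat) list \<Rightarrow> ('m \<times> 'm) list" where
  "zsteps cf df \<equiv> steps (\<lambda>x y. (df (fst x) (snd x) (snd y), cf (fst x) (fst y) (snd y)))"

text \<open>
  A commuting grid with vertices \<open>V\<close>: \<open>cf i i' j\<close> is the morphism of the left category from
  \<open>(i', j)\<close> to \<open>(i, j)\<close>, and \<open>df i j j'\<close> the morphism of the right category from \<open>(i, j')\<close> to \<open>(i, j)\<close>;
  \<open>cf i i j\<close> is the object at \<open>(i, j)\<close>.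
\<close>

locale mgrid =
  fixes M :: "'m mpair" and V :: "(nat \<times> nat) set" and cf df :: "nat \<Rightarrow> nat \<Rightarrow> nat \<Rightarrow> 'm"
  assumes cf_Obj: "(i, j) \<in> V \<Longrightarrow> cf i i j \<in> Obj (Lcat M)"
    and df_refl: "(i, j) \<in> V \<Longrightarrow> df i j j = cf i i j"
    and cf_Mor: "\<lbrakk>i \<le> i'; (i, j) \<in> V; (i', j) \<in> V\<rbrakk> \<Longrightarrow> cf i i' j \<in> Mor (Lcat M)"
    and tgt_cf: "\<lbrakk>i \<le> i'; (i, j) \<in> V; (i', j) \<in> V\<rbrakk> \<Longrightarrow> tgt (Lcat M) (cf i i' j) = cf i i j"
    and src_cf: "\<lbrakk>i \<le> i'; (i, j) \<in> V; (i', j) \<in> V\<rbrakk> \<Longrightarrow> src (Lcat M) (cf i i' j) = cf i' i' j"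
    and df_Mor: "\<lbrakk>j \<le> j'; (i, j) \<in> V; (i, j') \<in> V\<rbrakk> \<Longrightarrow> df i j j' \<in> Mor (Rcat M)"
    and tgt_df: "\<lbrakk>j \<le> j'; (i, j) \<in> V; (i, j') \<in> V\<rbrakk> \<Longrightarrow> tgt (Rcat M) (df i j j') = cf i i j"
    and src_df: "\<lbrakk>j \<le> j'; (i, j) \<in> V; (i, j') \<in> V\<rbrakk> \<Longrightarrow> src (Rcat M) (df i j j') = cf i i j'"
    and cf_cmp: "\<lbrakk>i \<le> i'; i' \<le> i''; (i, j) \<in> V; (i', j) \<in> V; (i'', j) \<in> V\<rbrakk>
      \<Longrightarrow> cmp (Lcat M) (cf i i' j) (cf i' i'' j) = cf i i'' j"
    and df_cmp: "\<lbrakk>j \<le> j'; j' \<le> j''; (i, j) \<in> V; (i, j') \<in> V; (i, j'') \<in> V\<rbrakk>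
      \<Longrightarrow> cmp (Rcat M) (df i j j') (df i j' j'') = df i j j''"
    and lact_cf: "\<lbrakk>i \<le> i'; j \<le> j'; (i, j) \<in> V; (i', j) \<in> V; (i, j') \<in> V; (i', j') \<in> V\<rbrakk>
      \<Longrightarrow> lact M (cf i i' j) (df i' j j') = df i j j'"
    and ract_cf: "\<lbrakk>i \<le> i'; j \<le> j'; (i, j) \<in> V; (i', j) \<in> V; (i, j') \<in> V; (i', j') \<in> V\<rbrakk>
      \<Longrightarrow> ract M (cf i i' j) (df i' j j') = cf i i' j'"

text \<open>The stored path runs along the row at height \<open>bs ! 0\<close> and then along the
  column at \<open>last as\<close>; the middle object sits at the corner of the two.\<close>

definition bis :: "(nat \<Rightarrow> nat \<Rightarrow> nat \<Rightarrow> 'm) \<Rightarrow> (nat \<Rightarrow> nat \<Rightarrow> nat \<Rightarrow> 'm) \<Rightarrow> nat list \<times> nat list \<Rightarrow> 'm bisimplex" where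
  "bis cf df = (\<lambda>(as, bs). (csteps cf (bs ! 0) as,
      cf (last as) (last as) (bs ! 0), steps (df (last as)) bs))"

definition bisd :: "(nat \<Rightarrow> nat \<Rightarrow> nat \<Rightarrow> 'm) \<Rightarrow> (nat \<Rightarrow> nat \<Rightarrow> nat \<Rightarrow> 'm) \<Rightarrow> (nat \<times> nat) list \<Rightarrow> 'm bisimplex" where
  "bisd cf df w = bis cf df (map fst w, map snd w)"

definition ner :: "(nat \<Rightarrow> nat \<Rightarrow> nat \<Rightarrow> 'm) \<Rightarrow> (nat \<Rightarrow> nat \<Rightarrow> nat \<Rightarrow> 'm) \<Rightarrow> (nat \<times> nat) list
    \<Rightarrow> ('m \<times> 'm) \<times> ('m \<times> 'm) list" where
  "ner cf df w = ((cf (fst (w ! 0)) (fst (w ! 0)) (snd (w ! 0)), cf (fst (w ! 0)) (fst (w ! 0)) (snd (w ! 0))),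
     zsteps cf df w)"

lemma composableI:
  assumes "\<And>t. t < length es \<Longrightarrow> es ! t \<in> Mor E"
    and "\<And>t. Suc t < length es \<Longrightarrow> src E (es ! t) = tgt E (es ! Suc t)"
  shows "composable E es"
  using assms by (auto simp: composable_def in_set_conv_nth successively_conv_nth)

lemma bgrid_nth:
  assumes "(as, bs) \<in> bgrid V l"
  shows "s < length as \<Longrightarrow> t < length bs \<Longrightarrow> (as ! s, bs ! t) \<in> V"
    and "s \<le> s' \<Longrightarrow> s' < length as \<Longrightarrow> as ! s \<le> as ! s'"
    and "t \<le> t' \<Longrightarrow> t' < length bs \<Longrightarrow> bs ! t \<le> bs ! t'"
    and "0 < length as" "0 < length bs" "length as + length bs = Suc (Suc l)"
  using assms by (auto simp: bgrid_def sorted_nth_mono subset_iff)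

lemma ngrid_nth:
  assumes "w \<in> ngrid V l"
  shows "s \<le> t \<Longrightarrow> t < length w \<Longrightarrow> (fst (w ! s), snd (w ! t)) \<in> V"
    and "s \<le> t \<Longrightarrow> t < length w \<Longrightarrow> fst (w ! s) \<le> fst (w ! t)"
    and "s \<le> t \<Longrightarrow> t < length w \<Longrightarrow> snd (w ! s) \<le> snd (w ! t)"
    and "length w = Suc l"
proof -
  have rel: "chain_rel V (w ! i) (w ! j)" if "i < j" "j < length w" for i j
    using assms that by (simp add: ngrid_def sorted_wrt_iff_nth_less)
  show "length w = Suc l" using assms by (simp add: ngrid_def)
  assume "s \<le> t" "t < length w"
  then show "(fst (w ! s), snd (w ! t)) \<in> V" "fst (w ! s) \<le> fst (w ! t)" "snd (w ! s) \<le> snd (w ! t)"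
    using rel[of s t] assms nth_mem[of s w]
    by (cases "s = t"; auto simp: chain_rel_def ngrid_def)+
qed

section \<open>Faces, degeneracies and comparison maps read off a grid\<close>

context mgrid begin

abbreviation B where "B \<equiv> bis cf df"
abbreviation Bd where "Bd \<equiv> bisd cf df"
abbreviation N where "N \<equiv> ner cf df"

lemma B_in:
  assumes "(as, bs) \<in> bgrid V l" shows "B (as, bs) \<in> bisimplices M (length as - 1) (length bs - 1)"
proof -
  note g = bgrid_nth[OF assms]
  have "composable (Lcat M) (csteps cf (bs ! 0) as)"
    by (rule composableI) (use g in \<open>auto simp: cf_Mor tgt_cf src_cf\<close>)
  moreover have "composable (Rcat M) (steps (df (as ! (length as - 1))) bs)"
    by (rule composableI) (use g in \<open>auto simp: df_Mor tgt_df src_df\<close>)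
  moreover have "src (Lcat M) (last (csteps cf (bs ! 0) as)) = cf (as ! (length as - 1)) (as ! (length as - 1)) (bs ! 0)"
    if "2 \<le> length as"
    using that g by (simp add: last_steps src_cf)
  moreover have "tgt (Rcat M) (hd (steps (df (as ! (length as - 1))) bs)) = cf (as ! (length as - 1)) (as ! (length as - 1)) (bs ! 0)"
    if "2 \<le> length bs"
    using that g by (simp add: hd_steps tgt_df)
  moreover have "last as = as ! (length as - 1)" using g by (simp add: last_conv_nth)
  ultimately show ?thesis
    using g by (auto simp: bis_def bisimplices_def steps_eq_Nil cf_Obj not_le)
qed

lemma composite_cf:
  assumes "(as, bs) \<in> bgrid V l" "s < length bs" "i < k" "k < length as"
  shows "composite (Lcat M) (drop i (take k (csteps cf (bs ! s) as))) = cf (as ! i) (as ! k) (bs ! s)"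
  by (rule composite_steps) (use assms(2-) bgrid_nth[OF assms(1)] in \<open>auto simp: cf_cmp\<close>)

lemma composite_df:
  assumes "(as, bs) \<in> bgrid V l" "s < length as" "i < k" "k < length bs"
  shows "composite (Rcat M) (drop i (take k (steps (df (as ! s)) bs))) = df (as ! s) (bs ! i) (bs ! k)"
  by (rule composite_steps) (use assms(2-) bgrid_nth[OF assms(1)] in \<open>auto simp: df_cmp\<close>)

text \<open>In entry \<open>t\<close> the right action lifts the row morphism from height
  \<open>bs ! 0\<close> to height \<open>bs ! t\<close>, and the left action of the lifted morphism
  moves the edge from column \<open>as ! s'\<close> to column \<open>as ! s\<close>.\<close>

lemma lact_tuple_steps:
  assumes "(as, bs) \<in> bgrid V l" "s \<le> s'" "s' < length as"
  shows "lact_tuple M (cf (as ! s) (as ! s') (bs ! 0)) (steps (df (as ! s')) bs) = steps (df (as ! s)) bs"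
proof (rule nth_equalityI)
  fix t assume "t < length (lact_tuple M (cf (as ! s) (as ! s') (bs ! 0)) (steps (df (as ! s')) bs))"
  then have t: "Suc t < length bs" by (simp add: lact_tuple_def)
  note g = bgrid_nth[OF assms(1)]
  have "composite (Rcat M) (take t (steps (df (as ! s')) bs)) = df (as ! s') (bs ! 0) (bs ! t)" if "t \<noteq> 0"
    using composite_df[OF assms(1,3), of 0 t] that t by simp
  then have eq: "(if t = 0 then cf (as ! s) (as ! s') (bs ! 0)
      else ract M (cf (as ! s) (as ! s') (bs ! 0)) (composite (Rcat M) (take t (steps (df (as ! s')) bs))))
      = cf (as ! s) (as ! s') (bs ! t)"
    using g assms(2,3) t by (auto simp: ract_cf)
  have "lact_tuple M (cf (as ! s) (as ! s') (bs ! 0)) (steps (df (as ! s')) bs) ! t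
      = lact M (if t = 0 then cf (as ! s) (as ! s') (bs ! 0)
      else ract M (cf (as ! s) (as ! s') (bs ! 0)) (composite (Rcat M) (take t (steps (df (as ! s')) bs))))
        (df (as ! s') (bs ! t) (bs ! Suc t))"
    using t by (simp add: lact_tuple_def)
  then show "lact_tuple M (cf (as ! s) (as ! s') (bs ! 0)) (steps (df (as ! s')) bs) ! t = steps (df (as ! s)) bs ! t"
    unfolding eq using g assms(2,3) t by (simp add: lact_cf)
qed (simp add: lact_tuple_def)

text \<open>Mirror image of \<open>lact_tuple_steps\<close>: the composite of the later row edges
  moves the column morphism to column \<open>as ! Suc t\<close>, where it lifts the edge of entry
  \<open>t\<close>.\<close>

lemma ract_tuple_steps:
  assumes "(as, bs) \<in> bgrid V l" "s \<le> s'" "s' < length bs"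
  shows "ract_tuple M (csteps cf (bs ! s) as) (df (last as) (bs ! s) (bs ! s')) = csteps cf (bs ! s') as"
proof (rule nth_equalityI)
  fix t assume "t < length (ract_tuple M (csteps cf (bs ! s) as) (df (last as) (bs ! s) (bs ! s')))"
  then have t: "Suc t < length as" by (simp add: ract_tuple_def)
  note g = bgrid_nth[OF assms(1)]
  let ?cs = "csteps cf (bs ! s) as"
  have la: "last as = as ! (length as - 1)" using g by (simp add: last_conv_nth)
  have "composite (Lcat M) (drop (Suc t) ?cs) = cf (as ! Suc t) (last as) (bs ! s)" if "Suc (Suc t) < length as"
    using composite_cf[OF assms(1) order.strict_trans1[OF assms(2,3)], of "Suc t" "length as - 1"] that la by simp
  moreover have "as ! Suc t = last as" if "\<not> Suc (Suc t) < length as"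
    using that t unfolding la by (intro arg_cong[of _ _ "(!) as"]) linarith
  ultimately have eq: "(if Suc t = length ?cs then df (last as) (bs ! s) (bs ! s')
      else lact M (composite (Lcat M) (drop (Suc t) ?cs)) (df (last as) (bs ! s) (bs ! s')))
      = df (as ! Suc t) (bs ! s) (bs ! s')"
    using g assms(2,3) t by (auto simp: lact_cf la)
  have "ract_tuple M ?cs (df (last as) (bs ! s) (bs ! s')) ! t
      = ract M (cf (as ! t) (as ! Suc t) (bs ! s)) (if Suc t = length ?cs then df (last as) (bs ! s) (bs ! s')
      else lact M (composite (Lcat M) (drop (Suc t) ?cs)) (df (last as) (bs ! s) (bs ! s')))"
    using t by (simp add: ract_tuple_def)
  then show "ract_tuple M ?cs (df (last as) (bs ! s) (bs ! s')) ! t = csteps cf (bs ! s') as ! t"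
    unfolding eq using g assms(2,3) t by (simp add: ract_cf)
qed (simp add: ract_tuple_def)

lemma hface_B:
  assumes "(as, bs) \<in> bgrid V l" "2 \<le> length as" "i < length as"
  shows "hface M i (B (as, bs)) = B (del i as, bs)"
proof -
  note g = bgrid_nth[OF assms(1)]
  have la: "last as = as ! (length as - 1)" using g by (simp add: last_conv_nth)
  have ld: "last (del i as) = del i as ! (length as - 2)"
    using assms(2,3) by (subst last_conv_nth) (auto simp: length_del numeral_2_eq_2 simp flip: length_greater_0_conv)
  consider "i = 0" | "0 < i" "Suc i < length as" | "i = length as - 1" "i \<noteq> 0" using assms(3) by linarith
  then show ?thesis
  proof cases
    case 1
    then have "last (del i as) = last as" using assms(2,3) unfolding ld la by (simp add: nth_del numeral_2_eq_2 Suc_diff_Suc)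
    then show ?thesis using 1 assms(2) by (simp add: hface_def bis_def steps_del_0)
  next
    case 2
    then have "last (del i as) = last as" using assms(2,3) unfolding ld la by (simp add: nth_del numeral_2_eq_2 Suc_diff_Suc)
    moreover have "csteps cf (bs ! 0) (del i as) = merge_at (Lcat M) i (csteps cf (bs ! 0) as)"
      by (rule steps_del_mid) (use 2 g in \<open>auto simp: cf_cmp\<close>)
    moreover have "i < length as - 1" using 2 by simp
    ultimately show ?thesis using 2 by (simp add: hface_def bis_def)
  next
    case 3
    \<comment> \<open>Deleting the last index changes the column in which the second list is read;
      the left action makes exactly this change.\<close>
    have l: "last (del i as) = as ! (length as - 2)"
      unfolding ld by (subst nth_del) (use assms(2,3) 3 in auto)
    have "lact_tuple M (cf (as ! (length as - 2)) (as ! (length as - 1)) (bs ! 0)) (steps (df (as ! (length as - 1))) bs)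
        = steps (df (as ! (length as - 2))) bs"
      by (rule lact_tuple_steps[OF assms(1)]) (use assms(2) in auto)
    then show ?thesis
      using 3 assms(2) g steps_del_last[OF assms(2), of "\<lambda>a a'. cf a a' (bs ! 0)"] l[unfolded 3(1)]
      by (simp add: hface_def bis_def la last_steps tgt_cf)
  qed
qed

lemma vface_B:
  assumes "(as, bs) \<in> bgrid V l" "2 \<le> length bs" "j < length bs"
  shows "vface M j (B (as, bs)) = B (as, del j bs)"
proof -
  note g = bgrid_nth[OF assms(1)]
  have la: "last as = as ! (length as - 1)" using g by (simp add: last_conv_nth)
  consider "j = 0" | "0 < j" "Suc j < length bs" | "j = length bs - 1" "j \<noteq> 0" using assms(3) by linarith
  then show ?thesis
  proof cases
    case 1
    have "ract_tuple M (csteps cf (bs ! 0) as) (df (last as) (bs ! 0) (bs ! 1)) = csteps cf (bs ! 1) as"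
      by (rule ract_tuple_steps[OF assms(1)]) (use assms(2) in auto)
    moreover have "del 0 bs ! 0 = bs ! 1" using assms(2) by (subst nth_del) auto
    moreover have "src (Rcat M) (df (last as) (bs ! 0) (bs ! 1)) = cf (last as) (last as) (bs ! 1)"
      unfolding la by (rule src_df) (use assms(2) g in auto)
    ultimately show ?thesis using 1 assms(2) by (simp add: vface_def bis_def steps_del_0 hd_steps)
  next
    case 2
    then have "del j bs ! 0 = bs ! 0" by (simp add: nth_del)
    moreover have "steps (df (last as)) (del j bs) = merge_at (Rcat M) j (steps (df (last as)) bs)"
      unfolding la by (rule steps_del_mid) (use 2 g in \<open>auto simp: df_cmp\<close>)
    moreover have "j < length bs - 1" using 2 by simp
    ultimately show ?thesis using 2 by (simp add: vface_def bis_def)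
  next
    case 3
    then have "del j bs ! 0 = bs ! 0" by (simp add: nth_del)
    then show ?thesis
      using 3 assms(2) steps_del_last[OF assms(2), of "df (last as)"]
      by (simp add: vface_def bis_def)
  qed
qed

lemma hdegen_B:
  assumes "(as, bs) \<in> bgrid V l" "i < length as"
  shows "hdegen M i (B (as, bs)) = B (dup i as, bs)"
proof -
  note g = bgrid_nth[OF assms(1)]
  have la: "last as = as ! (length as - 1)" using g by (simp add: last_conv_nth)
  have "(if i < length as - 1 then tgt (Lcat M) (csteps cf (bs ! 0) as ! i) else cf (last as) (last as) (bs ! 0))
      = cf (as ! i) (as ! i) (bs ! 0)"
  proof (cases "i < length as - 1")
    case True
    then show ?thesis using g by (simp add: tgt_cf)
  next
    case False
    then have "i = length as - 1" using assms(2) by simp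
    then show ?thesis using False la by simp
  qed
  then show ?thesis
    using assms(2) by (simp add: hdegen_def bis_def steps_dup last_dup)
qed

lemma vdegen_B:
  assumes "(as, bs) \<in> bgrid V l" "j < length bs"
  shows "vdegen M j (B (as, bs)) = B (as, dup j bs)"
proof -
  note g = bgrid_nth[OF assms(1)]
  have la: "last as = as ! (length as - 1)" using g by (simp add: last_conv_nth)
  have "(if j = 0 then cf (last as) (last as) (bs ! 0) else src (Rcat M) (steps (df (last as)) bs ! (j - 1)))
      = df (last as) (bs ! j) (bs ! j)"
    using assms(2) g unfolding la by (auto simp: src_df df_refl)
  moreover have "dup j bs ! 0 = bs ! 0" using assms(2) by (simp add: nth_dup)
  ultimately show ?thesis
    using assms(2) by (simp add: vdegen_def bis_def steps_dup)
qed

text \<open>At an interior vertex, composition in the product category exchanges a corner: the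
  \<C>-part of the first entry and the \<D>-part of the second are two sides of a square, and
  \<open>lact_cf\<close> and \<open>ract_cf\<close> give the other two.\<close>

lemma cat_face_N:
  assumes w: "w \<in> ngrid V l" and len: "2 \<le> length w" and i: "i < length w"
  shows "cat_face (zappa_szep M) i (N w) = N (del i w)"
proof -
  note g = ngrid_nth[OF w]
  let ?f = "\<lambda>x y. (df (fst x) (snd x) (snd y), cf (fst x) (fst y) (snd y))"
  consider "i = 0" | "0 < i" "Suc i < length w" | "i = length w - 1" "i \<noteq> 0" using i by linarith
  then show ?thesis
  proof cases
    case 1
    have "del 0 w ! 0 = w ! 1" using len by (subst nth_del) auto
    moreover have "src (Lcat M) (cf (fst (w ! 0)) (fst (w ! 1)) (snd (w ! 1))) = cf (fst (w ! 1)) (fst (w ! 1)) (snd (w ! 1))"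
      by (rule src_cf) (use g(1)[of 0 1] g(1)[of 1 1] g(2)[of 0 1] g(4) len in auto)
    ultimately show ?thesis
      using 1 len by (simp add: cat_face_def ner_def steps_del_0 hd_steps zappa_szep_def)
  next
    case 2
    then have "del i w ! 0 = w ! 0" by (simp add: nth_del)
    moreover have "steps ?f (del i w) = merge_at (zappa_szep M) i (steps ?f w)"
    proof (rule steps_del_mid)
      have v: "(fst (w ! a), snd (w ! b)) \<in> V" "fst (w ! a) \<le> fst (w ! b)" "snd (w ! a) \<le> snd (w ! b)"
        if "a \<le> b" "b \<le> Suc i" for a b using g(1-3)[of a b] that 2 by auto
      show "cmp (zappa_szep M) (?f (w ! (i - 1)) (w ! i)) (?f (w ! i) (w ! Suc i)) = ?f (w ! (i - 1)) (w ! Suc i)"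
        using 2 by (simp add: zappa_szep_def lact_cf ract_cf df_cmp cf_cmp v del: prod.collapse)
    qed (use 2 in auto)
    moreover have "i < length w - 1" using 2 by simp
    ultimately show ?thesis using 2 by (simp add: cat_face_def ner_def)
  next
    case 3
    then have "del i w ! 0 = w ! 0" by (simp add: nth_del)
    then show ?thesis
      using 3 len steps_del_last[OF len, of ?f] by (simp add: cat_face_def ner_def)
  qed
qed

lemma N_in:
  assumes w: "w \<in> ngrid V l" shows "N w \<in> nerve (zappa_szep M) l"
proof -
  note g = ngrid_nth[OF w]
  let ?f = "\<lambda>x y. (df (fst x) (snd x) (snd y), cf (fst x) (fst y) (snd y))"
  have "composable (zappa_szep M) (steps ?f w)"
    by (rule composableI) (use g in \<open>auto simp: zappa_szep_def df_Mor cf_Mor tgt_df src_df tgt_cf src_cf simp del: prod.collapse\<close>)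
  moreover have "tgt (zappa_szep M) (hd (steps ?f w)) = fst (N w)" if "2 \<le> length w"
    using that g by (simp add: hd_steps ner_def zappa_szep_def tgt_df del: prod.collapse)
  moreover have "fst (N w) \<in> Obj (zappa_szep M)"
  proof -
    have z: "(fst (w ! 0), snd (w ! 0)) \<in> V" using g(1)[of 0 0] g(4) by simp
    have "cf (fst (w ! 0)) (fst (w ! 0)) (snd (w ! 0)) \<in> Mor (Rcat M)"
      using df_Mor[OF _ z z] df_refl[OF z] by simp
    moreover have "tgt (Rcat M) (cf (fst (w ! 0)) (fst (w ! 0)) (snd (w ! 0))) = cf (fst (w ! 0)) (fst (w ! 0)) (snd (w ! 0))"
      "src (Rcat M) (cf (fst (w ! 0)) (fst (w ! 0)) (snd (w ! 0))) = cf (fst (w ! 0)) (fst (w ! 0)) (snd (w ! 0))"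
      using tgt_df[OF _ z z] src_df[OF _ z z] df_refl[OF z] by auto
    ultimately show ?thesis
      using cf_Obj[OF z] by (simp add: Obj_def zappa_szep_def ner_def)
  qed
  ultimately show ?thesis
    using g(4) by (auto simp: nerve_def ner_def steps_eq_Nil)
qed

lemma composite_N:
  assumes w: "w \<in> ngrid V l" and "i < k" "k < length w"
  shows "composite (zappa_szep M) (drop i (take k (zsteps cf df w)))
    = (df (fst (w ! i)) (snd (w ! i)) (snd (w ! k)), cf (fst (w ! i)) (fst (w ! k)) (snd (w ! k)))"
proof (rule composite_steps)
  fix t assume t: "i \<le> t" "Suc t < k"
  have v: "(fst (w ! a), snd (w ! b)) \<in> V" "fst (w ! a) \<le> fst (w ! b)" "snd (w ! a) \<le> snd (w ! b)"
    if "a \<le> b" "b < length w" for a b using ngrid_nth(1-3)[OF w, of a b] that by auto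
  then show "cmp (zappa_szep M) (df (fst (w ! t)) (snd (w ! t)) (snd (w ! Suc t)), cf (fst (w ! t)) (fst (w ! Suc t)) (snd (w ! Suc t)))
     (df (fst (w ! Suc t)) (snd (w ! Suc t)) (snd (w ! k)), cf (fst (w ! Suc t)) (fst (w ! k)) (snd (w ! k)))
    = (df (fst (w ! t)) (snd (w ! t)) (snd (w ! k)), cf (fst (w ! t)) (fst (w ! k)) (snd (w ! k)))"
    using t assms(2,3) by (simp add: zappa_szep_def lact_cf ract_cf df_cmp cf_cmp v del: prod.collapse)
qed (use assms in auto)

text \<open>The recursive call drops the first entry of \<open>as\<close> and the last one of
  \<open>bs\<close>, so by induction it returns the path through the points
  \<open>(as ! Suc t, bs ! t)\<close> next to the diagonal. With the first row edge in front and the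
  last column edge behind, this path and the diagonal staircase bound one square per step, and the
  two actions exchange the corner of each square.\<close>

lemma Pi_tuple_steps:
  assumes "sorted as" "sorted bs" "set as \<times> set bs \<subseteq> V" "length as = length bs" "as \<noteq> []"
  shows "Pi_tuple M (csteps cf (bs ! 0) as) (steps (df (last as)) bs)
    = zsteps cf df (zip as bs)"
  using assms
proof (induction as arbitrary: bs)
  case (Cons a as)
  show ?case
  proof (cases "as = []")
    case True
    then show ?thesis by (simp add: steps_def)
  next
    case False
    let ?f = "\<lambda>x y. (df (fst x) (snd x) (snd y), cf (fst x) (fst y) (snd y))"
    have V: "(s, t) \<in> V" if "s \<in> set (a # as)" "t \<in> set bs" for s t using Cons.prems(3) that by blast
    have mono: "(a # as) ! s \<le> (a # as) ! t" if "s \<le> t" "t \<le> length as" for s t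
      using sorted_nth_mono[OF Cons.prems(1)] that by simp
    have monob: "bs ! s \<le> bs ! t" if "s \<le> t" "t \<le> length as" for s t
      using sorted_nth_mono[OF Cons.prems(2)] that Cons.prems(4) by simp
    have lb: "length bs = Suc (length as)" using Cons.prems(4) by simp
    have Vn: "((a # as) ! s, bs ! t) \<in> V" if "s \<le> length as" "t \<le> length as" for s t
      using that lb by (intro V nth_mem) auto
    have b0: "butlast bs ! 0 = bs ! 0" using lb False by (simp add: nth_butlast)
    have bl: "butlast (steps (df (last as)) bs) = steps (df (last as)) (butlast bs)"
      by (rule nth_equalityI) (auto simp: nth_butlast)
    have st: "csteps cf (bs ! 0) (a # as) = cf a (as ! 0) (bs ! 0) # csteps cf (bs ! 0) as"
      using False by (intro nth_equalityI) (auto simp: nth_Cons split: nat.splits)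
    have "set (butlast bs) \<subseteq> set bs" by (auto dest: in_set_butlastD)
    then have sub: "set as \<times> set (butlast bs) \<subseteq> V" using V by auto
    have IH: "Pi_tuple M (csteps cf (bs ! 0) as) (butlast (steps (df (last as)) bs))
        = steps ?f (zip as (butlast bs))"
      unfolding bl using Cons.IH[OF _ _ sub] Cons.prems False
      by (simp add: b0 sorted_butlast)
    let ?b = "cf a (as ! 0) (bs ! 0) # map snd (steps ?f (zip as (butlast bs)))"
    let ?e = "map fst (steps ?f (zip as (butlast bs))) @ [last (steps (df (last as)) bs)]"
    have len: "length ?b = length as" "length ?e = length as"
      using lb False by (auto simp: Suc_le_eq)
    have b: "?b ! t = cf ((a # as) ! t) ((a # as) ! Suc t) (bs ! t)" if "t < length as" for t
      using that lb by (cases t) (auto simp: nth_butlast)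
    have e: "?e ! t = df ((a # as) ! Suc t) (bs ! t) (bs ! Suc t)" if "t < length as" for t
    proof (cases "Suc t < length as")
      case True
      then have "t < length as - 1" by simp
      then show ?thesis using True lb by (simp add: nth_append nth_butlast)
    next
      case F: False
      then have t: "length as = Suc t" using that by simp
      have "last (steps (df (last as)) bs) = df (last as) (bs ! t) (bs ! Suc t)"
        using lb t by (simp add: last_steps)
      moreover have "last as = as ! t" using False t by (simp add: last_conv_nth)
      ultimately show ?thesis using lb t by (simp add: nth_append)
    qed
    have "Pi_tuple M (csteps cf (bs ! 0) (a # as)) (steps (df (last (a # as))) bs)
      = map2 (\<lambda>b e. (lact M b e, ract M b e)) ?b ?e"
      using False by (simp only: st Pi_tuple.simps(2) Let_def last.simps if_False IH)
    also have "\<dots> = steps ?f (zip (a # as) bs)"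
    proof (rule nth_equalityI)
      show "length (map2 (\<lambda>b e. (lact M b e, ract M b e)) ?b ?e) = length (steps ?f (zip (a # as) bs))"
        using len lb by simp
      fix t assume "t < length (map2 (\<lambda>b e. (lact M b e, ract M b e)) ?b ?e)"
      then have t: "t < length as" using len by simp
      then have "map2 (\<lambda>b e. (lact M b e, ract M b e)) ?b ?e ! t
        = (lact M (?b ! t) (?e ! t), ract M (?b ! t) (?e ! t))"
        using len by simp
      also have "\<dots> = (df ((a # as) ! t) (bs ! t) (bs ! Suc t), cf ((a # as) ! t) ((a # as) ! Suc t) (bs ! Suc t))"
        unfolding b[OF t] e[OF t]
        using mono[of t "Suc t"] monob[of t "Suc t"] Vn[of t t] Vn[of "Suc t" t] Vn[of t "Suc t"] Vn[of "Suc t" "Suc t"] t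
        by (simp only: lact_cf ract_cf)
      finally show "map2 (\<lambda>b e. (lact M b e, ract M b e)) ?b ?e ! t = steps ?f (zip (a # as) bs) ! t"
        using t lb by simp
    qed
    finally show ?thesis .
  qed
qed simp

text \<open>The factors \<open>v\<close> lift the \<C>-parts before the split to the common height
  \<open>snd (w ! p)\<close>, and the factors \<open>u\<close> move the \<D>-parts after it to the
  common column \<open>fst (w ! p)\<close>. Both are parts of partial composites, which
  \<open>composite_N\<close> identifies as edges of the grid.\<close>

lemma Psi_steps:
  assumes w: "w \<in> ngrid V l" and p: "p \<le> l"
  defines "zs \<equiv> snd (N w)"
  shows "(Psi_C M p zs, if p = 0 then fst (fst (N w)) else src (Lcat M) (snd (zs ! (p - 1))), Psi_D M p zs)
    = B (map fst (take (Suc p) w), map snd (drop p w))"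
proof -
  note g = ngrid_nth[OF w]
  let ?f = "\<lambda>x y. (df (fst x) (snd x) (snd y), cf (fst x) (fst y) (snd y))"
  have zs: "zs = steps ?f w" by (simp add: zs_def ner_def)
  have v: "(fst (w ! a), snd (w ! b)) \<in> V" "fst (w ! a) \<le> fst (w ! b)" "snd (w ! a) \<le> snd (w ! b)"
    if "a \<le> b" "b \<le> l" for a b using g(1-3)[of a b] g(4) that by auto
  have p0: "map snd (drop p w) ! 0 = snd (w ! p)" using p g(4) by simp
  have "last (take (Suc p) w) = w ! p" using p g(4) by (simp add: take_Suc_conv_app_nth)
  then have lp: "last (map fst (take (Suc p) w)) = fst (w ! p)"
    using p g(4) by (subst last_map) auto
  have "Psi_C M p zs = csteps cf (snd (w ! p)) (map fst (take (Suc p) w))"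
  proof (rule nth_equalityI)
    fix t assume "t < length (Psi_C M p zs)"
    then have t: "t < p" by (simp add: Psi_C_def)
    have zt: "zs ! t = ?f (w ! t) (w ! Suc t)" using t p g(4) by (simp add: zs)
    have "Psi_C M p zs ! t = (if Suc t = p then snd (zs ! t)
      else ract M (snd (zs ! t)) (fst (composite (zappa_szep M) (drop (Suc t) (take p zs)))))"
      using t by (simp add: Psi_C_def)
    also have "\<dots> = cf (fst (w ! t)) (fst (w ! Suc t)) (snd (w ! p))"
    proof (cases "Suc t = p")
      case False
      then have "composite (zappa_szep M) (drop (Suc t) (take p zs)) = ?f (w ! Suc t) (w ! p)"
        unfolding zs by (intro composite_N[OF w]) (use t p g(4) in auto)
      then show ?thesis using False t p zt by (simp add: ract_cf v del: prod.collapse)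
    qed (use zt in simp)
    finally show "Psi_C M p zs ! t = csteps cf (snd (w ! p)) (map fst (take (Suc p) w)) ! t"
      using t p g(4) by simp
  qed (use p g(4) in \<open>simp add: Psi_C_def min_def\<close>)
  moreover have "Psi_D M p zs = steps (df (fst (w ! p))) (map snd (drop p w))"
  proof (rule nth_equalityI)
    have lz: "length zs = l" using g(4) by (simp add: zs)
    fix s assume "s < length (Psi_D M p zs)"
    then have s: "p + s < l" using lz by (simp add: Psi_D_def)
    let ?j = "p + s"
    have zt: "zs ! ?j = ?f (w ! ?j) (w ! Suc ?j)" using s g(4) by (simp add: zs)
    have "Psi_D M p zs ! s = (if ?j = p then fst (zs ! ?j)
      else lact M (snd (composite (zappa_szep M) (drop p (take ?j zs)))) (fst (zs ! ?j)))"
      using s lz by (simp add: Psi_D_def)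
    also have "\<dots> = df (fst (w ! p)) (snd (w ! ?j)) (snd (w ! Suc ?j))"
    proof (cases "?j = p")
      case False
      then have "composite (zappa_szep M) (drop p (take ?j zs)) = ?f (w ! p) (w ! ?j)"
        unfolding zs by (intro composite_N[OF w]) (use s p g(4) in auto)
      then show ?thesis using False s zt by (simp add: lact_cf v del: prod.collapse)
    qed (use zt in simp)
    finally show "Psi_D M p zs ! s = steps (df (fst (w ! p))) (map snd (drop p w)) ! s"
      using s g(4) by simp
  qed (use p g(4) in \<open>simp add: Psi_D_def zs\<close>)
  moreover have "(if p = 0 then fst (fst (N w)) else src (Lcat M) (snd (zs ! (p - 1)))) = cf (fst (w ! p)) (fst (w ! p)) (snd (w ! p))"
    using p g(4) v[of "p - 1" p] v[of p p] by (auto simp: ner_def zs src_cf simp del: prod.collapse)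
  ultimately show ?thesis by (simp add: bis_def p0 lp)
qed

end

lemma ptbd_alt: "ptbd (as, bs) = frag_extend (\<lambda>l. nonaug (l, bs)) (bd as)
   - frag_cmul ((-1) ^ length as) (frag_extend (\<lambda>l. nonaug (as, l)) (bd bs))"
  by (simp add: ptbd_def tbd_def frag_extend_linear)

text \<open>The bidegree is (l, l), hence the total degree \<open>2 * l\<close>.\<close>

lemma dgrid_bgrid: "w \<in> dgrid V l \<Longrightarrow> (map fst w, map snd w) \<in> bgrid V (2 * l)"
  by (auto simp: dgrid_def bgrid_def)

lemma bgrid_del:
  assumes "(as, bs) \<in> bgrid V (Suc l)" "2 \<le> length bs" "j < length bs"
  shows "(as, del j bs) \<in> bgrid V l"
proof -
  have "del j bs \<noteq> []" using assms by (auto simp: length_del simp flip: length_greater_0_conv)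
  moreover have "set as \<times> set (del j bs) \<subseteq> V"
    using assms(1) set_del_subset[of j bs] unfolding bgrid_def by blast
  ultimately show ?thesis
    using assms by (simp add: bgrid_def length_del sorted_wrt_del)
qed

lemma sorted_dup:
  fixes xs :: "'a :: linorder list"
  assumes "sorted xs" "i < length xs"
  shows "sorted (dup i xs)"
  unfolding sorted_iff_nth_mono
proof (intro allI impI)
  fix s t assume st: "s \<le> t" "t < length (dup i xs)"
  then have "t \<le> length xs" using assms by (simp add: length_dup)
  then show "dup i xs ! s \<le> dup i xs ! t"
    using st assms by (auto simp: nth_dup intro!: sorted_nth_mono)
qed

lemma dups_bgrid:
  assumes "(as, bs) \<in> bgrid V l" "\<And>j. j < m \<Longrightarrow> f (a + j) \<le> length bs + j"
  shows "(as, dups f a m bs) \<in> bgrid V (l + m)"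
proof -
  have ne: "bs \<noteq> []" using assms(1) by (simp add: bgrid_def)
  have "sorted (dups f a m bs)" using assms(2)
  proof (induction m)
    case (Suc m)
    have "f (a + m) \<le> length bs + m" using Suc.prems[of m] by simp
    then have "f (a + m) - 1 < length (dups f a m bs)"
      using dups_props[of m f a bs] Suc.prems ne by (cases "f (a + m)") auto
    then show ?case using Suc by (simp add: dups_Suc sorted_dup)
  qed (use assms in \<open>simp add: bgrid_def\<close>)
  moreover have D: "length (dups f a m bs) = length bs + m \<and> set (dups f a m bs) = set bs"
    using dups_props[of m f a bs] assms(2) ne by blast
  moreover have "dups f a m bs \<noteq> []" using D ne by (metis add_is_0 length_0_conv)
  ultimately show ?thesis using assms(1) by (simp add: bgrid_def)
qed

lemma dups_bgrid':
  assumes "(as, bs) \<in> bgrid V l" "\<And>j. j < m \<Longrightarrow> f (a + j) \<le> length as + j"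
  shows "(dups f a m as, bs) \<in> bgrid V (l + m)"
proof -
  have "(bs, as) \<in> bgrid (prod.swap ` V) l" using assms(1) by (auto simp: bgrid_def)
  then have "(bs, dups f a m as) \<in> bgrid (prod.swap ` V) (l + m)"
    by (rule dups_bgrid) (rule assms(2))
  then show ?thesis by (fastforce simp: bgrid_def subset_iff image_iff)
qed

context mgrid begin

text \<open>The augmented boundary of a single vertex is the empty list; \<open>nonaug\<close>
  removes it, in agreement with the case without horizontal faces in
  \<open>tot_hdiff\<close>.\<close>

lemma hdiff_B:
  assumes "(as, bs) \<in> bgrid V l"
  shows "tot_hdiff M (B (as, bs)) = frag_extend (\<lambda>l. frag_map B (nonaug (l, bs))) (bd as)"
proof -
  note g = bgrid_nth[OF assms]
  have hd: "tot_hdiff M (B (as, bs)) = (if length as \<le> 1 then 0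
      else (\<Sum>i\<le>length as - 1. frag_cmul ((-1) ^ i) (frag_of (hface M i (B (as, bs))))))"
    by (simp add: tot_hdiff_def bis_def steps_eq_Nil)
  show ?thesis
  proof (cases "length as \<le> 1")
    case True
    then obtain a where "as = [a]" using g by (cases as) auto
    moreover have "tot_hdiff M (B (as, bs)) = 0" using hd True by simp
    ultimately show ?thesis by (simp add: nonaug_def)
  next
    case False
    have "{..length as - 1} = {..<length as}" using False by auto
    then have "tot_hdiff M (B (as, bs)) = (\<Sum>i<length as. frag_cmul ((-1) ^ i) (frag_of (B (del i as, bs))))"
      using False by (auto simp: hd hface_B[OF assms] intro!: sum.cong)
    also have "\<dots> = frag_map (\<lambda>l. B (l, bs)) (bd as)"
      by (simp add: bd_sum frag_extend_Sum)
    also have "\<dots> = frag_extend (\<lambda>l. frag_map B (nonaug (l, bs))) (bd as)"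
    proof (rule frag_extend_eq)
      fix l assume "l \<in> supp (bd as)"
      then have "l \<noteq> []" using length_keys_bd[of l as] False by auto
      then show "frag_of (B (l, bs)) = frag_map B (nonaug (l, bs))"
        using g by (simp add: nonaug_def)
    qed
    finally show ?thesis .
  qed
qed

lemma vdiff_B:
  assumes "(as, bs) \<in> bgrid V l"
  shows "tot_vdiff M (B (as, bs)) = - frag_cmul ((-1) ^ length as)
     (frag_extend (\<lambda>l. frag_map B (nonaug (as, l))) (bd bs))"
proof -
  note g = bgrid_nth[OF assms]
  \<comment> \<open>\<open>length as\<close> is one more than the horizontal degree.\<close>
  have sg: "- ((-1) ^ length as) = (-1::int) ^ (length as - 1)"
    using g by (cases as) auto
  have hd: "tot_vdiff M (B (as, bs)) = (if length bs \<le> 1 then 0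
      else frag_cmul ((-1) ^ (length as - 1)) (\<Sum>i\<le>length bs - 1. frag_cmul ((-1) ^ i) (frag_of (vface M i (B (as, bs))))))"
    by (simp add: tot_vdiff_def bis_def steps_eq_Nil)
  show ?thesis
  proof (cases "length bs \<le> 1")
    case True
    then obtain a where "bs = [a]" using g by (cases bs) auto
    moreover have "tot_vdiff M (B (as, bs)) = 0" using hd True by simp
    ultimately show ?thesis by (simp add: nonaug_def)
  next
    case False
    have "{..length bs - 1} = {..<length bs}" using False by auto
    then have "(\<Sum>i\<le>length bs - 1. frag_cmul ((-1) ^ i) (frag_of (vface M i (B (as, bs)))))
        = (\<Sum>i<length bs. frag_cmul ((-1) ^ i) (frag_of (B (as, del i bs))))"
      using False by (auto simp: vface_B[OF assms] intro!: sum.cong)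
    also have "\<dots> = frag_map (\<lambda>l. B (as, l)) (bd bs)"
      by (simp add: bd_sum frag_extend_Sum)
    also have "\<dots> = frag_extend (\<lambda>l. frag_map B (nonaug (as, l))) (bd bs)"
    proof (rule frag_extend_eq)
      fix l assume "l \<in> supp (bd bs)"
      then have "l \<noteq> []" using length_keys_bd[of l bs] False by auto
      then show "frag_of (B (as, l)) = frag_map B (nonaug (as, l))"
        using g by (simp add: nonaug_def)
    qed
    finally show ?thesis using False by (simp add: hd sg)
  qed
qed

lemma tot_bdry_B:
  assumes "c \<in> bgrid V l"
  shows "bdry (tot_complex M) k (frag_of (B c)) = frag_map B (ptbd c)"
proof (cases c)
  case (Pair as bs)
  then show ?thesis
    using assms unfolding Pair
    by (simp add: tot_complex_def hdiff_B vdiff_B ptbd_alt frag_extend_diff frag_extend_cmul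
        frag_extend_frag_extend)
qed

lemma Bd_in: "w \<in> dgrid V k \<Longrightarrow> Bd w \<in> bisimplices M k k"
  using B_in[OF dgrid_bgrid, of w k] by (simp add: bisd_def dgrid_def)

lemma diag_bdry_Bd:
  assumes w: "w \<in> dgrid V (Suc k)"
  shows "bdry (diag_complex M) k (frag_of (Bd w)) = frag_map Bd (bd w)"
proof -
  have len: "length w = Suc (Suc k)" using w by (simp add: dgrid_def)
  have b: "(map fst w, map snd w) \<in> bgrid V (Suc (Suc (2 * k)))" using dgrid_bgrid[OF w] by simp
  have "hface M i (vface M i (Bd w)) = Bd (del i w)" if "i < length w" for i
  proof -
    have "(map fst w, del i (map snd w)) \<in> bgrid V (Suc (2 * k))"
      by (rule bgrid_del[OF b]) (use that len in auto)
    then show ?thesis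
      using that len by (simp add: bisd_def vface_B[OF b] hface_B map_del)
  qed
  moreover have "{..Suc k} = {..<length w}" using len by auto
  ultimately show ?thesis
    by (simp add: diag_complex_def bd_sum frag_extend_Sum del: sum.atMost_Suc sum.lessThan_Suc)
qed

lemma bow_bdry_N:
  assumes w: "w \<in> ngrid V (Suc k)"
  shows "bdry (bowtie_complex M) k (frag_of (N w)) = frag_map N (bd w)"
proof -
  have len: "length w = Suc (Suc k)" using w by (simp add: ngrid_def)
  have "{..Suc k} = {..<length w}" using len by auto
  then show ?thesis
    using len by (simp add: bowtie_complex_def cat_complex_def bd_sum frag_extend_Sum cat_face_N[OF w]
        del: sum.atMost_Suc sum.lessThan_Suc)
qed

lemma vdegens_B:
  assumes "(as, bs) \<in> bgrid V l" "\<And>j. j < m \<Longrightarrow> f (a + j) \<le> length bs + j"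
  shows "fold (\<lambda>i. vdegen M (f i - 1)) [a..<a + m] (B (as, bs)) = B (as, dups f a m bs)"
  using assms(2)
proof (induction m)
  case (Suc m)
  have ne: "bs \<noteq> []" using assms(1) by (simp add: bgrid_def)
  have "f (a + m) \<le> length bs + m" using Suc.prems[of m] by simp
  then have "f (a + m) - 1 < length (dups f a m bs)"
    using dups_props[of m f a bs] Suc.prems ne by (cases "f (a + m)") auto
  moreover have "(as, dups f a m bs) \<in> bgrid V (l + m)"
    by (rule dups_bgrid[OF assms(1)]) (use Suc.prems in auto)
  ultimately show ?case using Suc by (simp add: dups_Suc vdegen_B)
qed simp

lemma hdegens_B:
  assumes "(as, bs) \<in> bgrid V l" "\<And>j. j < m \<Longrightarrow> f (a + j) \<le> length as + j"
  shows "fold (\<lambda>i. hdegen M (f i - 1)) [a..<a + m] (B (as, bs)) = B (dups f a m as, bs)"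
  using assms(2)
proof (induction m)
  case (Suc m)
  have ne: "as \<noteq> []" using assms(1) by (simp add: bgrid_def)
  have "f (a + m) \<le> length as + m" using Suc.prems[of m] by simp
  then have "f (a + m) - 1 < length (dups f a m as)"
    using dups_props[of m f a as] Suc.prems ne by (cases "f (a + m)") auto
  moreover have "(dups f a m as, bs) \<in> bgrid V (l + m)"
    by (rule dups_bgrid'[OF assms(1)]) (use Suc.prems in auto)
  ultimately show ?case using Suc by (simp add: dups_Suc hdegen_B)
qed simp

text \<open>The degeneracies become repetitions of indices, in range by
  \<open>shuffle_perms_le1\<close> and \<open>shuffle_perms_le2\<close>; then
  \<open>shuf_eq_sum\<close> passes from permutations to paths.\<close>

lemma Nabla_B:
  assumes "(as, bs) \<in> bgrid V l"
  shows "Nabla M k (frag_of (B (as, bs))) = frag_map Bd (shuf as bs)"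
proof -
  define p where "p = length as - 1"
  define q where "q = length bs - 1"
  have len: "length as = Suc p" "length bs = Suc q"
    using bgrid_nth(4,5)[OF assms] by (auto simp: p_def q_def)
  have "nabla_term M p q \<beta> (B (as, bs)) = Bd (shuf_term p q \<beta> as bs)" if \<beta>: "\<beta> \<in> shuffle_perms p q" for \<beta>
  proof -
    have 1: "\<beta> (1 + j) \<le> length bs + j" if "j < p" for j
      using shuffle_perms_le1[OF \<beta> that] len by simp
    have 2: "\<beta> (Suc p + j) \<le> length as + j" if "j < q" for j
      using shuffle_perms_le2[OF \<beta> that] len by simp
    have "fold (\<lambda>i. vdegen M (\<beta> i - 1)) [1..<p + 1] (B (as, bs)) = B (as, dups \<beta> 1 p bs)"
      using vdegens_B[OF assms 1] by (simp add: add.commute)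
    moreover have "fold (\<lambda>i. hdegen M (\<beta> i - 1)) [p + 1..<p + q + 1] (B (as, dups \<beta> 1 p bs))
        = B (dups \<beta> (Suc p) q as, dups \<beta> 1 p bs)"
      using hdegens_B[OF dups_bgrid[OF assms 1] 2] by simp
    moreover have "length (dups \<beta> (Suc p) q as) = length (dups \<beta> 1 p bs)"
      using dups_props[OF 1] dups_props[OF 2] len by fastforce
    ultimately show ?thesis by (simp add: nabla_term_def bisd_def shuf_term_def)
  qed
  then have "(\<Sum>\<beta>\<in>shuffle_perms p q. frag_cmul (sign \<beta>) (frag_of (nabla_term M p q \<beta> (B (as, bs)))))
      = frag_map Bd (shuf as bs)"
    by (simp add: shuf_eq_sum[OF len] shuf_sum_def frag_extend_Sum[OF finite_shuffle_perms])
  then show ?thesis by (simp add: Nabla_def bis_def p_def q_def)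
qed

lemma Pi_Bd:
  assumes w: "w \<in> dgrid V l"
  shows "Pi_map M k (frag_of (Bd w)) = frag_of (N w)"
proof -
  have ne: "w \<noteq> []" and len: "length w = Suc l" using w by (auto simp: dgrid_def)
  note g = bgrid_nth[OF dgrid_bgrid[OF w]]
  have "Pi_tuple M (csteps cf (map snd w ! 0) (map fst w)) (steps (df (last (map fst w))) (map snd w))
    = snd (N w)"
    using Pi_tuple_steps[of "map fst w" "map snd w"] w ne by (simp add: dgrid_def zip_map_fst_snd ner_def)
  moreover have "(if csteps cf (map snd w ! 0) (map fst w) = []
      then cf (last (map fst w)) (last (map fst w)) (map snd w ! 0)
      else tgt (Lcat M) (hd (csteps cf (map snd w ! 0) (map fst w)))) = cf (fst (w ! 0)) (fst (w ! 0)) (snd (w ! 0))"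
  proof (cases "length w = 1")
    case True
    then obtain x where "w = [x]" by (auto simp: length_Suc_conv)
    then show ?thesis by (simp add: steps_def)
  next
    case False
    then have "2 \<le> length w" using len by simp
    moreover have "map fst w ! 0 = fst (w ! 0)" "map snd w ! 0 = snd (w ! 0)" using ne by simp_all
    ultimately show ?thesis
      using g(1)[of 0 0] g(1)[of 1 0] g(2)[of 0 1] ne
      by (simp add: steps_eq_Nil hd_steps tgt_cf del: prod.collapse nth_map)
  qed
  ultimately show ?thesis
    by (simp add: Pi_map_def bisd_def bis_def ner_def Let_def)
qed

lemma Psi_N:
  assumes w: "w \<in> ngrid V k"
  shows "Psi_map M k (frag_of (N w)) = frag_map B (AW w)"
proof -
  obtain y zs where yz: "N w = (y, zs)" by (cases "N w")
  have len: "{..k} = {..<length w}" using w by (auto simp: ngrid_def)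
  have "Psi_map M k (frag_of (N w)) = (\<Sum>p\<le>k. frag_of (Psi_C M p zs,
      if p = 0 then fst y else src (Lcat M) (snd (zs ! (p - 1))), Psi_D M p zs))"
    by (simp add: Psi_map_def yz)
  also have "\<dots> = (\<Sum>p\<le>k. frag_of (B (map fst (take (Suc p) w), map snd (drop p w))))"
  proof (rule sum.cong[OF refl])
    fix p assume "p \<in> {..k}"
    then have "p \<le> k" by simp
    from Psi_steps[OF w this]
    show "frag_of (Psi_C M p zs, if p = 0 then fst y else src (Lcat M) (snd (zs ! (p - 1))), Psi_D M p zs)
      = frag_of (B (map fst (take (Suc p) w), map snd (drop p w)))"
      unfolding yz fst_conv snd_conv by simp
  qed
  also have "\<dots> = frag_map B (AW w)"
    unfolding AW_sum len by (simp add: frag_extend_sum)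
  finally show ?thesis .
qed

end

section \<open>Grids pushed forward along a morphism of matched pairs\<close>

abbreviation push_cf :: "('a, 'b) mpair_map \<Rightarrow> (nat \<Rightarrow> nat \<Rightarrow> nat \<Rightarrow> 'a) \<Rightarrow> nat \<Rightarrow> nat \<Rightarrow> nat \<Rightarrow> 'b" where
  "push_cf f cf \<equiv> \<lambda>i i' j. fst f (cf i i' j)"

abbreviation push_df :: "('a, 'b) mpair_map \<Rightarrow> (nat \<Rightarrow> nat \<Rightarrow> nat \<Rightarrow> 'a) \<Rightarrow> nat \<Rightarrow> nat \<Rightarrow> nat \<Rightarrow> 'b" where
  "push_df f df \<equiv> \<lambda>i j j'. snd f (df i j j')"

lemma mgrid_push:
  assumes f: "mpair_morphism M M' f" and g: "mgrid M V cf df"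
  shows "mgrid M' V (push_cf f cf) (push_df f df)"
    and "(i, j) \<in> V \<Longrightarrow> snd f (cf i i j) = fst f (cf i i j)"
proof -
  interpret mgrid M V cf df by (rule g)
  have L: "\<And>c. c \<in> Mor (Lcat M) \<Longrightarrow> fst f c \<in> Mor (Lcat M') \<and> fst f (tgt (Lcat M) c) = tgt (Lcat M') (fst f c)
      \<and> fst f (src (Lcat M) c) = src (Lcat M') (fst f c)"
    "\<And>c c'. \<lbrakk>c \<in> Mor (Lcat M); c' \<in> Mor (Lcat M); src (Lcat M) c = tgt (Lcat M) c'\<rbrakk>
      \<Longrightarrow> fst f (cmp (Lcat M) c c') = cmp (Lcat M') (fst f c) (fst f c')"
    and R: "\<And>c. c \<in> Mor (Rcat M) \<Longrightarrow> snd f c \<in> Mor (Rcat M') \<and> snd f (tgt (Rcat M) c) = tgt (Rcat M') (snd f c)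
      \<and> snd f (src (Rcat M) c) = src (Rcat M') (snd f c)"
    "\<And>c c'. \<lbrakk>c \<in> Mor (Rcat M); c' \<in> Mor (Rcat M); src (Rcat M) c = tgt (Rcat M) c'\<rbrakk>
      \<Longrightarrow> snd f (cmp (Rcat M) c c') = cmp (Rcat M') (snd f c) (snd f c')"
    and A: "\<And>c d. \<lbrakk>c \<in> Mor (Lcat M); d \<in> Mor (Rcat M); src (Lcat M) c = tgt (Rcat M) d\<rbrakk> \<Longrightarrow>
        src (Lcat M') (fst f c) = tgt (Rcat M') (snd f d) \<and>
        lact M' (fst f c) (snd f d) = snd f (lact M c d) \<and> ract M' (fst f c) (snd f d) = fst f (ract M c d)"
    using f by (auto simp: mpair_morphism_def is_functor_def)
  \<comment> \<open>The two functors agree on the objects of the grid: an object is composable with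
    itself, so the condition on composable pairs makes the domain of its first image the codomain of
    the second, and identities are preserved. \<open>bowtie_push\<close> uses both images of the
    base object.\<close>
  have o: "snd f (cf i i j) = fst f (cf i i j)" if ij: "(i, j) \<in> V" for i j
  proof -
    have c: "cf i i j \<in> Mor (Lcat M)" "cf i i j \<in> Mor (Rcat M)"
      using cf_Mor[OF _ ij ij] df_Mor[OF _ ij ij] df_refl[OF ij] by auto
    have e: "src (Lcat M) (cf i i j) = cf i i j" "tgt (Rcat M) (cf i i j) = cf i i j"
      using src_cf[OF _ ij ij] tgt_df[OF _ ij ij] df_refl[OF ij] by auto
    have "src (Lcat M') (fst f (cf i i j)) = tgt (Rcat M') (snd f (cf i i j))"
      using A[OF c] e by simp
    then show ?thesis using L(1)[OF c(1)] R(1)[OF c(2)] e by simp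
  qed
  then show "(i, j) \<in> V \<Longrightarrow> snd f (cf i i j) = fst f (cf i i j)" .
  show "mgrid M' V (push_cf f cf) (push_df f df)"
  proof
    fix i j assume ij: "(i, j) \<in> V"
    show "snd f (df i j j) = fst f (cf i i j)" using df_refl[OF ij] o[OF ij] by simp
    have "cf i i j \<in> Mor (Lcat M)" "tgt (Lcat M) (cf i i j) = cf i i j" "src (Lcat M) (cf i i j) = cf i i j"
      using cf_Mor[OF _ ij ij] tgt_cf[OF _ ij ij] src_cf[OF _ ij ij] by auto
    then show "fst f (cf i i j) \<in> Obj (Lcat M')" using L(1) by (fastforce simp: Obj_def)
  next
    fix i i' j assume a: "i \<le> i'" "(i, j) \<in> V" "(i', j) \<in> V"
    show "fst f (cf i i' j) \<in> Mor (Lcat M')" "tgt (Lcat M') (fst f (cf i i' j)) = fst f (cf i i j)"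
      "src (Lcat M') (fst f (cf i i' j)) = fst f (cf i' i' j)"
      using L(1)[OF cf_Mor[OF a]] tgt_cf[OF a] src_cf[OF a] by auto
    fix i'' assume b: "i' \<le> i''" "(i'', j) \<in> V"
    show "cmp (Lcat M') (fst f (cf i i' j)) (fst f (cf i' i'' j)) = fst f (cf i i'' j)"
      using L(2)[of "cf i i' j" "cf i' i'' j"] a b cf_cmp[OF a(1) b(1) a(2,3) b(2)] cf_Mor[of i i' j] cf_Mor[of i' i'' j]
      by (simp add: src_cf tgt_cf)
  next
    fix i j j' assume a: "j \<le> j'" "(i, j) \<in> V" "(i, j') \<in> V"
    show "snd f (df i j j') \<in> Mor (Rcat M')" "tgt (Rcat M') (snd f (df i j j')) = fst f (cf i i j)"
      "src (Rcat M') (snd f (df i j j')) = fst f (cf i i j')"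
      using R(1)[OF df_Mor[OF a]] tgt_df[OF a] src_df[OF a] o a by auto
    fix j'' assume b: "j' \<le> j''" "(i, j'') \<in> V"
    show "cmp (Rcat M') (snd f (df i j j')) (snd f (df i j' j'')) = snd f (df i j j'')"
      using R(2)[of "df i j j'" "df i j' j''"] a b df_cmp[of j j' j'' i] by (simp add: df_Mor src_df tgt_df)
  next
    fix i i' j j' assume a: "i \<le> i'" "j \<le> j'" "(i, j) \<in> V" "(i', j) \<in> V" "(i, j') \<in> V" "(i', j') \<in> V"
    show "lact M' (fst f (cf i i' j)) (snd f (df i' j j')) = snd f (df i j j')"
      "ract M' (fst f (cf i i' j)) (snd f (df i' j j')) = fst f (cf i i' j')"
      using A[of "cf i i' j" "df i' j j'"] a lact_cf[OF a] ract_cf[OF a]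
      by (auto simp: cf_Mor df_Mor src_cf tgt_df)
  qed
qed

lemma bisimplex_push_bis:
  "bisimplex_push f k (frag_of (bis cf df c)) = frag_of (bis (push_cf f cf) (push_df f df) c)"
  by (cases c) (simp add: bisimplex_push_def bis_def map_steps)

lemma bowtie_push_ner:
  assumes "mpair_morphism M M' f" "mgrid M V cf df" "w \<in> ngrid V l"
  shows "bowtie_push f k (frag_of (ner cf df w)) = frag_of (ner (push_cf f cf) (push_df f df) w)"
proof -
  have "(fst (w ! 0), snd (w ! 0)) \<in> V" using ngrid_nth(1)[OF assms(3), of 0 0] ngrid_nth(4)[OF assms(3)] by simp
  from mgrid_push(2)[OF assms(1,2) this] show ?thesis
    by (simp add: bowtie_push_def ner_def map_steps)
qed

section \<open>Every simplex spans a grid\<close>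

text \<open>The morphism from vertex \<open>j\<close> to vertex \<open>i\<close>. The identities for
  \<open>i = j\<close> are supplied separately because \<open>composite\<close> has no meaningful
  value on the empty tuple.\<close>

definition pcomp :: "'m cat \<Rightarrow> 'm \<Rightarrow> 'm list \<Rightarrow> nat \<Rightarrow> nat \<Rightarrow> 'm" where
  "pcomp E x es i j = (if i < j then composite E (drop i (take j es)) else if i = 0 then x else src E (es ! (i - 1)))"

context small_category begin

lemma Obj_simps: "x \<in> Obj E \<Longrightarrow> tgt E x = x" "x \<in> Obj E \<Longrightarrow> src E x = x" "x \<in> Obj E \<Longrightarrow> x \<in> Mor E"
  by (auto simp: Obj_def)

context
  fixes x es k assumes nerve: "(x, es) \<in> nerve E k"
begin

lemma nerve_nth:
  "length es = k" "x \<in> Obj E" "t < k \<Longrightarrow> es ! t \<in> Mor E"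
  "Suc t < k \<Longrightarrow> src E (es ! t) = tgt E (es ! Suc t)" "0 < k \<Longrightarrow> tgt E (es ! 0) = x"
  using nerve by (auto simp: nerve_def composable_def successively_conv_nth hd_conv_nth)

lemma pcomp_refl: "i \<le> k \<Longrightarrow> pcomp E x es i i \<in> Obj E"
  using nerve_nth by (auto simp: pcomp_def src_Obj)

lemma tgt_nth: "i < k \<Longrightarrow> tgt E (es ! i) = pcomp E x es i i"
  using nerve_nth(4)[of "i - 1"] nerve_nth(5) by (auto simp: pcomp_def)

lemma src_nth: "i < k \<Longrightarrow> src E (es ! i) = pcomp E x es (Suc i) (Suc i)"
  by (simp add: pcomp_def)

lemma pcomp_Suc: "i < k \<Longrightarrow> pcomp E x es i (Suc i) = es ! i"
  using nerve_nth(1) by (simp add: pcomp_def drop_take Cons_nth_drop_Suc[symmetric])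

lemma pcomp_left: "i < j \<Longrightarrow> j \<le> k \<Longrightarrow> pcomp E x es i j = cmp E (es ! i) (pcomp E x es (Suc i) j)"
proof (cases "Suc i = j")
  case True
  assume "i < j" "j \<le> k"
  then show ?thesis
    using True nerve_nth(3)[of i] pcomp_Suc[of i] cmp_src[of "es ! i"] by (auto simp: src_nth)
next
  case False
  assume ij: "i < j" "j \<le> k"
  then have "drop i (take j es) = es ! i # drop (Suc i) (take j es)"
    "drop (Suc i) (take j es) = es ! Suc i # drop (Suc (Suc i)) (take j es)"
    using False nerve_nth(1) by (auto simp: Cons_nth_drop_Suc[symmetric])
  then show ?thesis using ij False by (simp add: pcomp_def)
qed

lemma pcomp_props:
  assumes "i \<le> j" "j \<le> k"
  shows "pcomp E x es i j \<in> Mor E \<and> tgt E (pcomp E x es i j) = pcomp E x es i i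
    \<and> src E (pcomp E x es i j) = pcomp E x es j j"
  using assms
proof (induction i rule: inc_induct)
  case base
  then show ?case using pcomp_refl[of j] by (auto simp: Obj_simps)
next
  case (step i)
  then show ?case
    using nerve_nth(3)[of i] tgt_nth[of i] src_nth[of i]
    by (auto simp: pcomp_left cmp_Mor tgt_cmp src_cmp)
qed

lemma pcomp_cmp:
  assumes "i \<le> j" "j \<le> l" "l \<le> k"
  shows "cmp E (pcomp E x es i j) (pcomp E x es j l) = pcomp E x es i l"
  using assms
proof (induction i rule: inc_induct)
  case base
  then show ?case using pcomp_props[of j l] cmp_tgt by metis
next
  case (step i)
  then show ?case
    using nerve_nth(3)[of i] src_nth[of i] pcomp_props[of "Suc i" j] pcomp_props[of j l]
    by (simp add: pcomp_left[of i] cmp_assoc)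
qed

end

end

context matched_pair begin

text \<open>The axiom speaks of composable quadruples; identities at both ends complete a composable
  pair to one. The next two lemmas complete a triple at one end.\<close>

lemma src_lact': "\<lbrakk>c \<in> Mor C; d \<in> Mor D; src C c = tgt D d\<rbrakk> \<Longrightarrow> src D (c \<triangleright> d) = tgt C (c \<triangleleft> d)"
  using src_lact[of "tgt C c" c d "src D d"] C.tgt_Obj[of c] D.src_Obj[of d]
  by (auto simp: C.Obj_simps D.Obj_simps)

lemma lact_cmp_right': "\<lbrakk>c \<in> Mor C; d1 \<in> Mor D; d2 \<in> Mor D; src C c = tgt D d1; src D d1 = tgt D d2\<rbrakk>
    \<Longrightarrow> c \<triangleright> cmp D d1 d2 = cmp D (c \<triangleright> d1) ((c \<triangleleft> d1) \<triangleright> d2)"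
  using lact_cmp_right[of "tgt C c" c d1 d2] C.tgt_Obj[of c] by (auto simp: C.Obj_simps)

lemma ract_cmp_left': "\<lbrakk>c1 \<in> Mor C; c2 \<in> Mor C; d \<in> Mor D; src C c1 = tgt C c2; src C c2 = tgt D d\<rbrakk>
    \<Longrightarrow> cmp C c1 c2 \<triangleleft> d = cmp C (c1 \<triangleleft> (c2 \<triangleright> d)) (c2 \<triangleleft> d)"
  using ract_cmp_left[of c1 c2 d "src D d"] D.src_Obj[of d] by (auto simp: D.Obj_simps)

end

section \<open>The Zappa--Szep product as a category\<close>

locale mpair_locale =
  fixes M :: "'m mpair" assumes mp: "is_matched_pair M"
begin

sublocale matched_pair "Lcat M" "Rcat M" "lact M" "ract M"
  using mp by (simp add: is_matched_pair_def)

abbreviation "LC \<equiv> Lcat M"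
abbreviation "RC \<equiv> Rcat M"

lemma Obj_both: "x \<in> Obj LC \<longleftrightarrow> x \<in> Obj RC"
  using Obj_eq by simp

lemma zs_simps:
  "(d, c) \<in> Mor (zappa_szep M) \<longleftrightarrow> d \<in> Mor RC \<and> c \<in> Mor LC \<and> src RC d = tgt LC c"
  "tgt (zappa_szep M) (d, c) = (tgt RC d, tgt RC d)" "src (zappa_szep M) (d, c) = (src LC c, src LC c)"
  "cmp (zappa_szep M) (d, c) (d', c') = (cmp RC d (lact M c d'), cmp LC (ract M c d') c')"
  by (auto simp: zappa_szep_def)

lemma zs_Obj: "x \<in> Obj LC \<Longrightarrow> (x, x) \<in> Obj (zappa_szep M)"
  using Obj_both[of x] by (auto simp: Obj_def zs_simps)

lemma zs_Obj_iff: "y \<in> Obj (zappa_szep M) \<longleftrightarrow> (\<exists>x\<in>Obj LC. y = (x, x))"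
proof
  assume y: "y \<in> Obj (zappa_szep M)"
  obtain d c where dc: "y = (d, c)" by (cases y)
  have "tgt RC d = d" "tgt RC d = c" "d \<in> Mor RC"
    using y by (auto simp: dc Obj_def zs_simps)
  then show "\<exists>x\<in>Obj LC. y = (x, x)" using D.tgt_Obj[of d] by (auto simp: dc Obj_both)
qed (auto simp: zs_Obj)

sublocale Z: small_category "zappa_szep M"
proof
  fix z assume z: "z \<in> Mor (zappa_szep M)"
  obtain d c where dc: "z = (d, c)" by (cases z)
  have m: "d \<in> Mor RC" "c \<in> Mor LC" "src RC d = tgt LC c" using z by (auto simp: dc zs_simps)
  show "tgt (zappa_szep M) z \<in> Obj (zappa_szep M)"
    using D.tgt_Obj[OF m(1)] by (auto simp: dc zs_simps Obj_both intro!: zs_Obj)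
  show "src (zappa_szep M) z \<in> Obj (zappa_szep M)"
    using C.src_Obj[OF m(2)] by (auto simp: dc zs_simps intro!: zs_Obj)
  have t: "tgt RC d \<in> Obj LC" "tgt RC d \<in> Obj RC" using D.tgt_Obj[OF m(1)] by (auto simp: Obj_both)
  have s: "src LC c \<in> Obj LC" "src LC c \<in> Obj RC" using C.src_Obj[OF m(2)] by (auto simp flip: Obj_both)
  show "cmp (zappa_szep M) (tgt (zappa_szep M) z) z = z"
    using m C.cmp_tgt[OF m(2)] D.cmp_tgt[OF m(1)] by (simp add: dc zs_simps lact_unit ract_tgt)
  show "cmp (zappa_szep M) z (src (zappa_szep M) z) = z"
    using m C.cmp_src[OF m(2)] D.cmp_src[OF m(1)] by (simp add: dc zs_simps lact_src ract_unit)
  fix z' assume z': "z' \<in> Mor (zappa_szep M)" and zz': "src (zappa_szep M) z = tgt (zappa_szep M) z'"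
  obtain d' c' where dc': "z' = (d', c')" by (cases z')
  have m': "d' \<in> Mor RC" "c' \<in> Mor LC" "src RC d' = tgt LC c'" using z' by (auto simp: dc' zs_simps)
  have e: "src LC c = tgt RC d'" using zz' by (simp add: dc dc' zs_simps)
  note q = lact_Mor[OF m(2) m'(1) e] ract_Mor[OF m(2) m'(1) e] tgt_lact[OF m(2) m'(1) e]
    src_ract[OF m(2) m'(1) e] src_lact'[OF m(2) m'(1) e]
  show "cmp (zappa_szep M) z z' \<in> Mor (zappa_szep M)"
    using m m' e q by (simp add: dc dc' zs_simps C.cmp_Mor D.cmp_Mor C.tgt_cmp D.src_cmp)
  show "tgt (zappa_szep M) (cmp (zappa_szep M) z z') = tgt (zappa_szep M) z"
    using m m' e q by (simp add: dc dc' zs_simps D.tgt_cmp)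
  show "src (zappa_szep M) (cmp (zappa_szep M) z z') = src (zappa_szep M) z'"
    using m m' e q by (simp add: dc dc' zs_simps C.src_cmp)
  fix z'' assume z'': "z'' \<in> Mor (zappa_szep M)" and zz'': "src (zappa_szep M) z' = tgt (zappa_szep M) z''"
  obtain d'' c'' where dc'': "z'' = (d'', c'')" by (cases z'')
  have m'': "d'' \<in> Mor RC" "c'' \<in> Mor LC" "src RC d'' = tgt LC c''" using z'' by (auto simp: dc'' zs_simps)
  have e': "src LC c' = tgt RC d''" using zz'' by (simp add: dc' dc'' zs_simps)
  note q' = lact_Mor[OF m'(2) m''(1) e'] ract_Mor[OF m'(2) m''(1) e'] tgt_lact[OF m'(2) m''(1) e']
    src_ract[OF m'(2) m''(1) e'] src_lact'[OF m'(2) m''(1) e']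
  \<comment> \<open>Facts 1 to 4 expand both bracketings by the matched pair axioms. What then
    remains is associativity of a triple product in each of the two factor categories, facts 5 and
    6.\<close>
  have 1: "lact M (cmp LC (ract M c d') c') d'' = lact M (ract M c d') (lact M c' d'')"
    by (rule lact_cmp_left) (use m m' m'' e e' q q' in auto)
  have 2: "ract M (cmp LC (ract M c d') c') d'' = cmp LC (ract M (ract M c d') (lact M c' d'')) (ract M c' d'')"
    by (rule ract_cmp_left') (use m m' m'' e e' q q' in auto)
  have 3: "lact M c (cmp RC d' (lact M c' d'')) = cmp RC (lact M c d') (lact M (ract M c d') (lact M c' d''))"
    by (rule lact_cmp_right') (use m m' m'' e e' q q' in auto)
  have 4: "ract M c (cmp RC d' (lact M c' d'')) = ract M (ract M c d') (lact M c' d'')"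
    by (rule ract_cmp_right) (use m m' m'' e e' q q' in auto)
  have e3: "src LC (ract M c d') = tgt RC (lact M c' d'')" using q q' m' by simp
  note q3 = lact_Mor[OF q(2) q'(1) e3] ract_Mor[OF q(2) q'(1) e3] tgt_lact[OF q(2) q'(1) e3]
    src_ract[OF q(2) q'(1) e3] src_lact'[OF q(2) q'(1) e3]
  have 5: "cmp RC (cmp RC d (lact M c d')) (lact M (ract M c d') (lact M c' d''))
    = cmp RC d (cmp RC (lact M c d') (lact M (ract M c d') (lact M c' d'')))"
    by (rule D.cmp_assoc) (use m q q3 in auto)
  have 6: "cmp LC (cmp LC (ract M (ract M c d') (lact M c' d'')) (ract M c' d'')) c''
    = cmp LC (ract M (ract M c d') (lact M c' d'')) (cmp LC (ract M c' d'') c'')"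
    by (rule C.cmp_assoc) (use m'' q' q3 in auto)
  show "cmp (zappa_szep M) (cmp (zappa_szep M) z z') z'' = cmp (zappa_szep M) z (cmp (zappa_szep M) z' z'')"
    by (simp add: dc dc' dc'' zs_simps 1 2 3 4 5 6)
qed

end

text \<open>
  A bisimplex is the path through its grid that runs along the row \<open>j = 0\<close> and then along the column
  \<open>i = p\<close>; the remaining morphisms are carried over from that path by the two actions.
\<close>

definition bhat_C :: "'m mpair \<Rightarrow> 'm bisimplex \<Rightarrow> nat \<Rightarrow> nat \<Rightarrow> 'm" where
  "bhat_C M = (\<lambda>(cs, x, ds). pcomp (Lcat M) (if cs = [] then x else tgt (Lcat M) (hd cs)) cs)"

definition bhat_D :: "'m mpair \<Rightarrow> 'm bisimplex \<Rightarrow> nat \<Rightarrow> nat \<Rightarrow> 'm" where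
  "bhat_D M = (\<lambda>(cs, x, ds). pcomp (Rcat M) x ds)"

definition bhat_df :: "'m mpair \<Rightarrow> 'm bisimplex \<Rightarrow> nat \<Rightarrow> nat \<Rightarrow> nat \<Rightarrow> 'm" where
  "bhat_df M s i j j' = lact M (ract M (bhat_C M s i (length (fst s))) (bhat_D M s 0 j)) (bhat_D M s j j')"

definition bhat_cf :: "'m mpair \<Rightarrow> 'm bisimplex \<Rightarrow> nat \<Rightarrow> nat \<Rightarrow> nat \<Rightarrow> 'm" where
  "bhat_cf M s i i' j = ract M (bhat_C M s i i') (lact M (bhat_C M s i' (length (fst s))) (bhat_D M s 0 j))"

text \<open>
  The composite of the entries from \<open>i\<close> to \<open>j\<close> of a nerve simplex runs from the vertex \<open>(i, i)\<close> to \<open>(i, j)\<close>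
  by its \<open>\<D>\<close>-part and on to \<open>(j, j)\<close> by its \<open>\<C>\<close>-part.
\<close>

definition nhat_df :: "'m mpair \<Rightarrow> ('m \<times> 'm) \<times> ('m \<times> 'm) list \<Rightarrow> nat \<Rightarrow> nat \<Rightarrow> nat \<Rightarrow> 'm" where
  "nhat_df M z i j j' = lact M (snd (pcomp (zappa_szep M) (fst z) (snd z) i j)) (fst (pcomp (zappa_szep M) (fst z) (snd z) j j'))"

definition nhat_cf :: "'m mpair \<Rightarrow> ('m \<times> 'm) \<times> ('m \<times> 'm) list \<Rightarrow> nat \<Rightarrow> nat \<Rightarrow> nat \<Rightarrow> 'm" where
  "nhat_cf M z i i' j = ract M (snd (pcomp (zappa_szep M) (fst z) (snd z) i i')) (fst (pcomp (zappa_szep M) (fst z) (snd z) i' j))"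

context mpair_locale begin

text \<open>\<open>d i j\<close> and \<open>g i j\<close> are the two parts of the composite of the
  entries from \<open>i\<close> to \<open>j\<close>. Compatibility of partial composites gives one
  identity in each factor category, \<open>cmp\<close>, and the grid laws follow from these with the
  matched pair axioms. Along the diagonal the acting morphisms are identities, so the entries of
  \<open>z\<close> are recovered.\<close>

lemma nhat:
  assumes z: "z \<in> nerve (zappa_szep M) k"
  shows "mgrid M (stair k) (nhat_cf M z) (nhat_df M z)" and "ner (nhat_cf M z) (nhat_df M z) (dgen k) = z"
proof -
  obtain y zs where yz: "z = (y, zs)" by (cases z)
  define g where "g i j = snd (pcomp (zappa_szep M) y zs i j)" for i j
  define d where "d i j = fst (pcomp (zappa_szep M) y zs i j)" for i j
  have P: "pcomp (zappa_szep M) y zs i j = (d i j, g i j)" for i j by (simp add: g_def d_def)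
  note nz = z[unfolded yz]
  have o: "g i i \<in> Obj LC" "d i i = g i i" if "i \<le> k" for i
    using Z.pcomp_refl[OF nz that] by (auto simp: P zs_Obj_iff)
  have dg: "d i j \<in> Mor RC" "g i j \<in> Mor LC" "src RC (d i j) = tgt LC (g i j)"
    "tgt RC (d i j) = g i i" "src LC (g i j) = g j j" if "i \<le> j" "j \<le> k" for i j
    using Z.pcomp_props[OF nz that] o[of i] o[of j] that by (auto simp: P zs_simps)
  have cmp: "cmp RC (d i j) (lact M (g i j) (d j l)) = d i l" "cmp LC (ract M (g i j) (d j l)) (g j l) = g i l"
    if "i \<le> j" "j \<le> l" "l \<le> k" for i j l
    using Z.pcomp_cmp[OF nz that] by (auto simp: P zs_simps)
  have gd: "src LC (g i j) = tgt RC (d j l)" if "i \<le> j" "j \<le> l" "l \<le> k" for i j l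
    using dg(4,5) that by simp
  have cf: "nhat_cf M z i i' j = ract M (g i i') (d i' j)" and df: "nhat_df M z i j j' = lact M (g i j) (d j j')"
    for i i' j j' by (simp_all add: nhat_cf_def nhat_df_def yz g_def d_def)
  have act: "lact M (g i j) (d j l) \<in> Mor RC" "ract M (g i j) (d j l) \<in> Mor LC"
    "tgt RC (lact M (g i j) (d j l)) = tgt LC (g i j)" "src LC (ract M (g i j) (d j l)) = src RC (d j l)"
    "src RC (lact M (g i j) (d j l)) = tgt LC (ract M (g i j) (d j l))" if "i \<le> j" "j \<le> l" "l \<le> k" for i j l
    using lact_Mor[of "g i j" "d j l"] ract_Mor[of "g i j" "d j l"] tgt_lact[of "g i j" "d j l"]
      src_ract[of "g i j" "d j l"] src_lact'[of "g i j" "d j l"] gd[OF that] dg that by auto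
  \<comment> \<open>The object at \<open>(i, j)\<close> is where the two parts of the composite from
    \<open>i\<close> to \<open>j\<close> meet.\<close>
  have cf_o: "nhat_cf M z i i j = tgt LC (g i j)" if "i \<le> j" "j \<le> k" for i j
  proof -
    have "ract M (tgt RC (d i j)) (d i j) = src RC (d i j)" by (rule ract_tgt) (use dg that in auto)
    then show ?thesis using dg[OF that] by (simp add: cf)
  qed
  \<comment> \<open>Acting with \<open>g i j\<close> is acting in two steps, because
    \<open>cmp\<close> factors it through the vertex \<open>(i', j)\<close>.\<close>
  have lg: "lact M (ract M (g i i') (d i' j)) (lact M (g i' j) (d j j')) = lact M (g i j) (d j j')"
    if "i \<le> i'" "i' \<le> j" "j \<le> j'" "j' \<le> k" for i i' j j'
  proof -
    have "lact M (cmp LC (ract M (g i i') (d i' j)) (g i' j)) (d j j')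
      = lact M (ract M (g i i') (d i' j)) (lact M (g i' j) (d j j'))"
      by (rule lact_cmp_left) (use dg act gd that in auto)
    then show ?thesis using cmp(2)[of i i' j] that by simp
  qed
  show "mgrid M (stair k) (nhat_cf M z) (nhat_df M z)"
  proof
    fix i j assume "(i, j) \<in> stair k"
    then have ij: "i \<le> j" "j \<le> k" by (auto simp: stair_def)
    show "nhat_cf M z i i j \<in> Obj LC" using cf_o[OF ij] dg[OF ij] C.tgt_Obj by simp
    have "d j j = src LC (g i j)" using o dg ij by simp
    then show "nhat_df M z i j j = nhat_cf M z i i j"
      using cf_o[OF ij] dg[OF ij] lact_src[of "g i j"] by (simp add: df)
  next
    fix i i' j assume a: "i \<le> i'" "(i, j) \<in> stair k" "(i', j) \<in> stair k"
    then have ij: "i \<le> i'" "i' \<le> j" "j \<le> k" by (auto simp: stair_def)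
    show "nhat_cf M z i i' j \<in> Mor LC" using act[OF ij] by (simp add: cf)
    have "tgt LC (ract M (g i i') (d i' j)) = tgt LC (cmp LC (ract M (g i i') (d i' j)) (g i' j))"
      by (rule C.tgt_cmp[symmetric]) (use act[OF ij] dg ij in auto)
    then show "tgt LC (nhat_cf M z i i' j) = nhat_cf M z i i j"
      using cmp(2)[OF ij] cf_o[of i j] ij by (simp add: cf)
    show "src LC (nhat_cf M z i i' j) = nhat_cf M z i' i' j"
      using act[OF ij] dg ij cf_o[of i' j] by (simp add: cf)
    fix i'' assume b: "i' \<le> i''" "(i'', j) \<in> stair k"
    then have ij': "i' \<le> i''" "i'' \<le> j" by (auto simp: stair_def)
    have e: "d i' j = cmp RC (d i' i'') (lact M (g i' i'') (d i'' j))" using cmp(1)[of i' i'' j] ij ij' by simp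
    have "ract M (g i i') (d i' j) = ract M (ract M (g i i') (d i' i'')) (lact M (g i' i'') (d i'' j))"
      unfolding e by (rule ract_cmp_right) (use dg act gd ij ij' in auto)
    moreover have "ract M (cmp LC (ract M (g i i') (d i' i'')) (g i' i'')) (d i'' j)
      = cmp LC (ract M (ract M (g i i') (d i' i'')) (lact M (g i' i'') (d i'' j))) (ract M (g i' i'') (d i'' j))"
      by (rule ract_cmp_left') (use dg act gd ij ij' in auto)
    ultimately show "cmp LC (nhat_cf M z i i' j) (nhat_cf M z i' i'' j) = nhat_cf M z i i'' j"
      using cmp(2)[of i i' i''] ij ij' by (simp add: cf)
  next
    fix i j j' assume a: "j \<le> j'" "(i, j) \<in> stair k" "(i, j') \<in> stair k"
    then have ij: "i \<le> j" "j \<le> j'" "j' \<le> k" by (auto simp: stair_def)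
    show "nhat_df M z i j j' \<in> Mor RC" using act[OF ij] by (simp add: df)
    show "tgt RC (nhat_df M z i j j') = nhat_cf M z i i j"
      using act[OF ij] cf_o[of i j] ij by (simp add: df)
    have "tgt LC (ract M (g i j) (d j j')) = tgt LC (cmp LC (ract M (g i j) (d j j')) (g j j'))"
      by (rule C.tgt_cmp[symmetric]) (use act[OF ij] dg ij in auto)
    then show "src RC (nhat_df M z i j j') = nhat_cf M z i i j'"
      using act[OF ij] cmp(2)[OF ij] cf_o[of i j'] ij by (simp add: df)
    fix j'' assume b: "j' \<le> j''" "(i, j'') \<in> stair k"
    then have ij': "j' \<le> j''" "j'' \<le> k" by (auto simp: stair_def)
    have e: "d j j'' = cmp RC (d j j') (lact M (g j j') (d j' j''))" using cmp(1)[of j j' j''] ij ij' by simp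
    have "lact M (g i j) (d j j'') = cmp RC (lact M (g i j) (d j j')) (lact M (ract M (g i j) (d j j')) (lact M (g j j') (d j' j'')))"
      unfolding e by (rule lact_cmp_right') (use dg act gd ij ij' in auto)
    then show "cmp RC (nhat_df M z i j j') (nhat_df M z i j' j'') = nhat_df M z i j j''"
      using lg[of i j j' j''] ij ij' by (simp add: df)
  next
    fix i i' j j' assume "i \<le> i'" "j \<le> j'" "(i, j) \<in> stair k" "(i', j) \<in> stair k" "(i, j') \<in> stair k" "(i', j') \<in> stair k"
    then have ij: "i \<le> i'" "i' \<le> j" "j \<le> j'" "j' \<le> k" by (auto simp: stair_def)
    show "lact M (nhat_cf M z i i' j) (nhat_df M z i' j j') = nhat_df M z i j j'"
      using lg[OF ij] by (simp add: cf df)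
    have e: "d i' j' = cmp RC (d i' j) (lact M (g i' j) (d j j'))" using cmp(1)[of i' j j'] ij by simp
    have "ract M (g i i') (d i' j') = ract M (ract M (g i i') (d i' j)) (lact M (g i' j) (d j j'))"
      unfolding e by (rule ract_cmp_right) (use dg act gd ij in auto)
    then show "ract M (nhat_cf M z i i' j) (nhat_df M z i' j j') = nhat_cf M z i i' j'"
      by (simp add: cf df)
  qed
  have nn: "length zs = k" "y \<in> Obj (zappa_szep M)" using nz by (auto simp: nerve_def)
  have "steps (\<lambda>x y. (nhat_df M z (fst x) (snd x) (snd y), nhat_cf M z (fst x) (fst y) (snd y))) (dgen k) = zs"
  proof (rule nth_equalityI)
    fix t assume "t < length (steps (\<lambda>x y. (nhat_df M z (fst x) (snd x) (snd y), nhat_cf M z (fst x) (fst y) (snd y))) (dgen k))"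
    then have t: "t < k" by (simp add: dgen_def)
    have "nhat_df M z t t (Suc t) = d t (Suc t)"
      using dg[of t "Suc t"] o[of t] t lact_unit[of "d t (Suc t)"] by (simp add: df)
    moreover have "nhat_cf M z t (Suc t) (Suc t) = g t (Suc t)"
      using dg[of t "Suc t"] o[of "Suc t"] t ract_unit[of "g t (Suc t)"] by (simp add: cf)
    moreover have "(d t (Suc t), g t (Suc t)) = zs ! t" using Z.pcomp_Suc[OF nz t] P by simp
    ultimately show "steps (\<lambda>x y. (nhat_df M z (fst x) (snd x) (snd y), nhat_cf M z (fst x) (fst y) (snd y))) (dgen k) ! t = zs ! t"
      using t by (simp add: dgen_def del: upt_Suc)
  qed (simp add: dgen_def nn)
  moreover have "nhat_cf M z 0 0 0 = g 0 0" using cf_o[of 0 0] o[of 0] by (simp add: C.Obj_simps)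
  moreover have "(g 0 0, g 0 0) = y"
  proof -
    have "pcomp (zappa_szep M) y zs 0 0 = y" by (simp add: pcomp_def)
    then show ?thesis using P[of 0 0] o[of 0] by simp
  qed
  moreover have "dgen k ! 0 = (0, 0)" unfolding dgen_def by (subst nth_map) (auto simp del: upt_Suc)
  ultimately show "ner (nhat_cf M z) (nhat_df M z) (dgen k) = z"
    by (simp add: ner_def yz)
qed

lemma bhat:
  assumes s: "s \<in> bisimplices M p q"
  shows "mgrid M (rect p q) (bhat_cf M s) (bhat_df M s)" and "bis (bhat_cf M s) (bhat_df M s) (bgen (p, q)) = s"
proof -
  obtain cs x ds where cxd: "s = (cs, x, ds)" by (cases s)
  have len: "length cs = p" "length ds = q" and x: "x \<in> Obj LC" "x \<in> Obj RC"
    using s by (auto simp: cxd bisimplices_def Obj_both)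
  define x0 where "x0 = (if cs = [] then x else tgt LC (hd cs))"
  define c where "c = pcomp LC x0 cs"
  define d where "d = pcomp RC x ds"
  have "set cs \<subseteq> Mor LC" using s by (auto simp: cxd bisimplices_def composable_def)
  then have "x0 \<in> Obj LC" using x C.tgt_Obj[of "hd cs"] hd_in_set[of cs] by (auto simp: x0_def subset_iff)
  then have nc: "(x0, cs) \<in> nerve LC p" using s by (auto simp: cxd bisimplices_def nerve_def x0_def)
  have nd: "(x, ds) \<in> nerve RC q" using s x by (auto simp: cxd bisimplices_def nerve_def)
  have c_o: "c i i \<in> Obj LC" if "i \<le> p" for i unfolding c_def by (rule C.pcomp_refl[OF nc that])
  have d_o: "d j j \<in> Obj RC" if "j \<le> q" for j unfolding d_def by (rule D.pcomp_refl[OF nd that])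
  have cm: "c i i' \<in> Mor LC" "tgt LC (c i i') = c i i" "src LC (c i i') = c i' i'" if "i \<le> i'" "i' \<le> p" for i i'
    using C.pcomp_props[OF nc that] by (auto simp: c_def)
  have dm: "d j j' \<in> Mor RC" "tgt RC (d j j') = d j j" "src RC (d j j') = d j' j'" if "j \<le> j'" "j' \<le> q" for j j'
    using D.pcomp_props[OF nd that] by (auto simp: d_def)
  have cc: "cmp LC (c i i') (c i' i'') = c i i''" if "i \<le> i'" "i' \<le> i''" "i'' \<le> p" for i i' i''
    unfolding c_def by (rule C.pcomp_cmp[OF nc that])
  have dd: "cmp RC (d j j') (d j' j'') = d j j''" if "j \<le> j'" "j' \<le> j''" "j'' \<le> q" for j j' j''
    unfolding d_def by (rule D.pcomp_cmp[OF nd that])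
  \<comment> \<open>The row ends at the object where the column starts, also if one of them has no
    edges.\<close>
  have mid: "c p p = d 0 0"
  proof (cases p)
    case 0
    then show ?thesis using len by (simp add: c_def d_def pcomp_def x0_def)
  next
    case (Suc p')
    then have "src LC (cs ! (p - 1)) = x" using s len by (auto simp: cxd bisimplices_def last_conv_nth)
    then show ?thesis using Suc by (simp add: c_def d_def pcomp_def)
  qed
  have cf: "bhat_cf M s i i' j = ract M (c i i') (lact M (c i' p) (d 0 j))"
    and df: "bhat_df M s i j j' = lact M (ract M (c i p) (d 0 j)) (d j j')" for i i' j j'
    by (simp_all add: bhat_cf_def bhat_df_def bhat_C_def bhat_D_def cxd c_def d_def x0_def len)
  have L: "lact M (c i p) (d 0 j) \<in> Mor RC" "tgt RC (lact M (c i p) (d 0 j)) = c i i"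
      "src RC (lact M (c i p) (d 0 j)) = tgt LC (ract M (c i p) (d 0 j))"
      "ract M (c i p) (d 0 j) \<in> Mor LC" "src LC (ract M (c i p) (d 0 j)) = d j j" if "i \<le> p" "j \<le> q" for i j
    using lact_Mor[of "c i p" "d 0 j"] ract_Mor[of "c i p" "d 0 j"] tgt_lact[of "c i p" "d 0 j"]
      src_ract[of "c i p" "d 0 j"] src_lact'[of "c i p" "d 0 j"] cm[of i p] dm[of 0 j] mid that by auto
  \<comment> \<open>\<open>cp\<close> and \<open>cl\<close> split the row at \<open>i'\<close>,
    \<open>dr\<close> and \<open>dl\<close> below split the column at \<open>j\<close>; the grid
    laws are combinations of these four.\<close>
  have cp: "ract M (c i p) (d 0 j) = cmp LC (ract M (c i i') (lact M (c i' p) (d 0 j))) (ract M (c i' p) (d 0 j))"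
    if "i \<le> i'" "i' \<le> p" "j \<le> q" for i i' j
  proof -
    have "ract M (cmp LC (c i i') (c i' p)) (d 0 j) = cmp LC (ract M (c i i') (lact M (c i' p) (d 0 j))) (ract M (c i' p) (d 0 j))"
      by (rule ract_cmp_left') (use cm dm mid that in auto)
    then show ?thesis using cc[of i i' p] that by simp
  qed
  have cl: "lact M (c i p) (d 0 j) = lact M (c i i') (lact M (c i' p) (d 0 j))"
    if "i \<le> i'" "i' \<le> p" "j \<le> q" for i i' j
  proof -
    have "lact M (cmp LC (c i i') (c i' p)) (d 0 j) = lact M (c i i') (lact M (c i' p) (d 0 j))"
      by (rule lact_cmp_left) (use cm dm mid that in auto)
    then show ?thesis using cc[of i i' p] that by simp
  qed
  have dr: "ract M (c i p) (d 0 j') = ract M (ract M (c i p) (d 0 j)) (d j j')"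
    and dl: "lact M (c i p) (d 0 j') = cmp RC (lact M (c i p) (d 0 j)) (lact M (ract M (c i p) (d 0 j)) (d j j'))"
    if "i \<le> p" "j \<le> j'" "j' \<le> q" for i j j'
  proof -
    have "ract M (c i p) (cmp RC (d 0 j) (d j j')) = ract M (ract M (c i p) (d 0 j)) (d j j')"
      by (rule ract_cmp_right) (use cm dm mid that in auto)
    then show "ract M (c i p) (d 0 j') = ract M (ract M (c i p) (d 0 j)) (d j j')" using dd[of 0 j j'] that by simp
    have "lact M (c i p) (cmp RC (d 0 j) (d j j')) = cmp RC (lact M (c i p) (d 0 j)) (lact M (ract M (c i p) (d 0 j)) (d j j'))"
      by (rule lact_cmp_right') (use cm dm mid that in auto)
    then show "lact M (c i p) (d 0 j') = cmp RC (lact M (c i p) (d 0 j)) (lact M (ract M (c i p) (d 0 j)) (d j j'))"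
      using dd[of 0 j j'] that by simp
  qed
  have E: "ract M (c i i') (lact M (c i' p) (d 0 j)) \<in> Mor LC"
      "src LC (ract M (c i i') (lact M (c i' p) (d 0 j))) = tgt LC (ract M (c i' p) (d 0 j))"
      "tgt LC (ract M (c i i') (lact M (c i' p) (d 0 j))) = tgt LC (ract M (c i p) (d 0 j))"
      if "i \<le> i'" "i' \<le> p" "j \<le> q" for i i' j
    using ract_Mor[of "c i i'" "lact M (c i' p) (d 0 j)"] src_ract[of "c i i'" "lact M (c i' p) (d 0 j)"]
      src_lact'[of "c i i'" "lact M (c i' p) (d 0 j)"] L[of i' j] L[of i j] cm[of i i'] cl[OF that] that by auto
  have F: "lact M (ract M (c i p) (d 0 j)) (d j j') \<in> Mor RC"
      "tgt RC (lact M (ract M (c i p) (d 0 j)) (d j j')) = tgt LC (ract M (c i p) (d 0 j))"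
      "src RC (lact M (ract M (c i p) (d 0 j)) (d j j')) = tgt LC (ract M (c i p) (d 0 j'))"
      if "i \<le> p" "j \<le> j'" "j' \<le> q" for i j j'
    using lact_Mor[of "ract M (c i p) (d 0 j)" "d j j'"] tgt_lact[of "ract M (c i p) (d 0 j)" "d j j'"]
      src_lact'[of "ract M (c i p) (d 0 j)" "d j j'"] L[of i j] dm[of j j'] dr[OF that] that by auto
  have cf_o: "bhat_cf M s i i j = tgt LC (ract M (c i p) (d 0 j))" if "i \<le> p" "j \<le> q" for i j
    using ract_tgt[of "lact M (c i p) (d 0 j)"] L[OF that] by (simp add: cf)
  show "mgrid M (rect p q) (bhat_cf M s) (bhat_df M s)"
  proof
    fix i j assume "(i, j) \<in> rect p q"
    then have ij: "i \<le> p" "j \<le> q" by (auto simp: rect_def)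
    show "bhat_cf M s i i j \<in> Obj LC" using cf_o[OF ij] L[OF ij] C.tgt_Obj by simp
    show "bhat_df M s i j j = bhat_cf M s i i j"
      using cf_o[OF ij] L[OF ij] lact_src[of "ract M (c i p) (d 0 j)"] by (simp add: df)
  next
    fix i i' j assume "i \<le> i'" "(i, j) \<in> rect p q" "(i', j) \<in> rect p q"
    then have ij: "i \<le> i'" "i' \<le> p" "j \<le> q" by (auto simp: rect_def)
    show "bhat_cf M s i i' j \<in> Mor LC" "tgt LC (bhat_cf M s i i' j) = bhat_cf M s i i j"
      "src LC (bhat_cf M s i i' j) = bhat_cf M s i' i' j"
      using E[OF ij] cf_o ij by (auto simp: cf)
    fix i'' assume "i' \<le> i''" "(i'', j) \<in> rect p q"
    then have ij': "i' \<le> i''" "i'' \<le> p" by (auto simp: rect_def)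
    have "ract M (cmp LC (c i i') (c i' i'')) (lact M (c i'' p) (d 0 j))
      = cmp LC (ract M (c i i') (lact M (c i' i'') (lact M (c i'' p) (d 0 j)))) (ract M (c i' i'') (lact M (c i'' p) (d 0 j)))"
      by (rule ract_cmp_left') (use cm L ij ij' in auto)
    then show "cmp LC (bhat_cf M s i i' j) (bhat_cf M s i' i'' j) = bhat_cf M s i i'' j"
      using cc[of i i' i''] cl[of i' i'' j] ij ij' by (simp add: cf)
  next
    fix i j j' assume "j \<le> j'" "(i, j) \<in> rect p q" "(i, j') \<in> rect p q"
    then have ij: "i \<le> p" "j \<le> j'" "j' \<le> q" by (auto simp: rect_def)
    show "bhat_df M s i j j' \<in> Mor RC" "tgt RC (bhat_df M s i j j') = bhat_cf M s i i j"
      "src RC (bhat_df M s i j j') = bhat_cf M s i i j'"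
      using F[OF ij] cf_o ij by (auto simp: df)
    fix j'' assume "j' \<le> j''" "(i, j'') \<in> rect p q"
    then have ij': "j' \<le> j''" "j'' \<le> q" by (auto simp: rect_def)
    have "lact M (ract M (c i p) (d 0 j)) (cmp RC (d j j') (d j' j''))
      = cmp RC (lact M (ract M (c i p) (d 0 j)) (d j j')) (lact M (ract M (ract M (c i p) (d 0 j)) (d j j')) (d j' j''))"
      by (rule lact_cmp_right') (use dm L ij ij' in auto)
    then show "cmp RC (bhat_df M s i j j') (bhat_df M s i j' j'') = bhat_df M s i j j''"
      using dd[of j j' j''] dr[OF ij] ij ij' by (simp add: df)
  next
    fix i i' j j' assume "i \<le> i'" "j \<le> j'" "(i, j) \<in> rect p q" "(i', j) \<in> rect p q" "(i, j') \<in> rect p q" "(i', j') \<in> rect p q"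
    then have ij: "i \<le> i'" "i' \<le> p" "j \<le> j'" "j' \<le> q" by (auto simp: rect_def)
    have "lact M (cmp LC (ract M (c i i') (lact M (c i' p) (d 0 j))) (ract M (c i' p) (d 0 j))) (d j j')
      = lact M (ract M (c i i') (lact M (c i' p) (d 0 j))) (lact M (ract M (c i' p) (d 0 j)) (d j j'))"
      by (rule lact_cmp_left) (use E L dm ij in auto)
    then show "lact M (bhat_cf M s i i' j) (bhat_df M s i' j j') = bhat_df M s i j j'"
      using cp[of i i' j] ij by (simp add: cf df)
    have "ract M (c i i') (cmp RC (lact M (c i' p) (d 0 j)) (lact M (ract M (c i' p) (d 0 j)) (d j j')))
      = ract M (ract M (c i i') (lact M (c i' p) (d 0 j))) (lact M (ract M (c i' p) (d 0 j)) (d j j'))"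
      by (rule ract_cmp_right) (use cm L F ij in auto)
    then show "ract M (bhat_cf M s i i' j) (bhat_df M s i' j j') = bhat_cf M s i i' j'"
      using dl[of i' j j'] ij by (simp add: cf df)
  qed
  \<comment> \<open>On the row \<open>j = 0\<close>, as on the column \<open>i = p\<close> in
    \<open>dz\<close>, the acting morphism is an identity, so the stored path is recovered.\<close>
  have cz: "bhat_cf M s i i' 0 = c i i'" if "i \<le> i'" "i' \<le> p" for i i'
  proof -
    have "lact M (c i' p) (d 0 0) = c i' i'" using lact_src[of "c i' p"] cm[of i' p] mid that by simp
    then show ?thesis using ract_unit[of "c i i'"] cm[OF that] by (simp add: cf)
  qed
  have dz: "bhat_df M s p j j' = d j j'" if "j \<le> j'" "j' \<le> q" for j j'
  proof -
    have "ract M (c p p) (d 0 j) = d j j" using ract_tgt[of "d 0 j"] dm[of 0 j] mid that by simp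
    then show ?thesis using lact_unit[of "d j j'"] dm[OF that] by (simp add: df)
  qed
  have "csteps (bhat_cf M s) 0 [0..<Suc p] = cs"
  proof (rule nth_equalityI)
    fix t assume "t < length (csteps (bhat_cf M s) 0 [0..<Suc p])"
    then have t: "t < p" by simp
    then show "csteps (bhat_cf M s) 0 [0..<Suc p] ! t = cs ! t"
      using C.pcomp_Suc[OF nc t] by (simp add: cz c_def del: upt_Suc)
  qed (simp add: len)
  moreover have "steps (bhat_df M s p) [0..<Suc q] = ds"
  proof (rule nth_equalityI)
    fix t assume "t < length (steps (bhat_df M s p) [0..<Suc q])"
    then have t: "t < q" by simp
    then show "steps (bhat_df M s p) [0..<Suc q] ! t = ds ! t"
      using D.pcomp_Suc[OF nd t] by (simp add: dz d_def del: upt_Suc)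
  qed (simp add: len)
  moreover have "bhat_cf M s p p 0 = x" using cz[of p p] mid by (simp add: d_def pcomp_def)
  moreover have "last [0..<Suc p] = p" "[0..<Suc q] ! 0 = 0" by (simp, subst nth_upt, auto)
  ultimately show "bis (bhat_cf M s) (bhat_df M s) (bgen (p, q)) = s"
    by (simp add: bis_def bgen_def cxd del: upt_Suc)
qed

end

section \<open>The comparison maps\<close>

text \<open>Lets maps be composed and compared on generators without exposing the functions that
  they extend.\<close>

definition frag_linear :: "(('a \<Rightarrow>\<^sub>0 int) \<Rightarrow> 'b \<Rightarrow>\<^sub>0 int) \<Rightarrow> bool" where
  "frag_linear \<phi> \<longleftrightarrow> (\<exists>f. \<phi> = frag_extend f)"

lemma frag_linear_comp:
  assumes "frag_linear \<phi>" "frag_linear \<psi>" shows "frag_linear (\<psi> \<circ> \<phi>)"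
proof -
  obtain f g where "\<phi> = frag_extend f" "\<psi> = frag_extend g" using assms by (auto simp: frag_linear_def)
  then have "\<psi> \<circ> \<phi> = frag_extend (\<lambda>x. frag_extend g (f x))" by (simp add: fun_eq_iff frag_extend_frag_extend)
  then show ?thesis by (auto simp: frag_linear_def)
qed

lemma frag_linear_eq: "frag_linear \<phi> \<Longrightarrow> \<phi> = frag_extend (\<lambda>s. \<phi> (frag_of s))"
  by (auto simp: frag_linear_def)

lemma frag_linear_ext:
  assumes "frag_linear \<phi>" "frag_linear \<psi>" "\<And>s. s \<in> B \<Longrightarrow> \<phi> (frag_of s) = \<psi> (frag_of s)"
    and "supp x \<subseteq> B"
  shows "\<phi> x = \<psi> x"
  using assms by (subst (1 2) frag_linear_eq) (auto intro!: frag_extend_eq)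

lemma frag_linear_image:
  assumes "frag_linear \<phi>" "\<And>c. c \<in> supp u \<Longrightarrow> \<phi> (frag_of (h c)) = frag_map h' (g c)"
  shows "\<phi> (frag_map h u) = frag_map h' (frag_extend g u)"
proof -
  obtain f where "\<phi> = frag_extend f" using assms by (auto simp: frag_linear_def)
  then show ?thesis using assms(2) by (simp add: frag_extend_frag_extend cong: frag_extend_eq)
qed

lemma frag_linear_image1:
  assumes "frag_linear \<phi>" "\<And>c. c \<in> supp u \<Longrightarrow> \<phi> (frag_of (h c)) = frag_of (h' c)"
  shows "\<phi> (frag_map h u) = frag_map h' u"
  using frag_linear_image[where g = frag_of and h = h and h' = h', OF assms(1), of u] assms(2) by simp

lemma frag_linear_maps:
  "frag_linear (Nabla M k)" "frag_linear (Pi_map M k)" "frag_linear (Psi_map M k)"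
  "frag_linear (bdry (tot_complex M) k)" "frag_linear (bdry (diag_complex M) k)"
  "frag_linear (bdry (bowtie_complex M) k)"
  "frag_linear (bowtie_push f k)" "frag_linear (bisimplex_push f k)"
  by (auto simp: frag_linear_def Nabla_def Pi_map_def Psi_map_def tot_complex_def diag_complex_def
      bowtie_complex_def cat_complex_def bowtie_push_def bisimplex_push_def)

definition tot_basis :: "'m mpair \<Rightarrow> nat \<Rightarrow> 'm bisimplex set" where
  "tot_basis M k = (\<Union>p\<le>k. bisimplices M p (k - p))"

lemma chains_simps:
  "chains (tot_complex M) k = free_Abelian_group (tot_basis M k)"
  "chains (diag_complex M) k = free_Abelian_group (bisimplices M k k)"
  "chains (bowtie_complex M) k = free_Abelian_group (nerve (zappa_szep M) k)"
  by (simp_all add: tot_complex_def diag_complex_def bowtie_complex_def cat_complex_def tot_basis_def)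

lemma tot_basis_iff: "s \<in> tot_basis M k \<longleftrightarrow> s \<in> bisimplices M (length (fst s)) (length (snd (snd s)))
    \<and> length (fst s) + length (snd (snd s)) = k"
  by (cases s) (auto simp: tot_basis_def bisimplices_def)

text \<open>Every basis element of \<open>K\<close> is read off some grid, which may depend on the
  element, and on what is read off a grid the boundary of \<open>K\<close> is the index boundary
  \<open>d\<close>. Claims about \<open>K\<close> thus reduce to claims about index lists.\<close>

definition models ::
  "'m mpair \<Rightarrow> ('s \<Rightarrow>\<^sub>0 int) complex \<Rightarrow> (nat \<Rightarrow> 's set) \<Rightarrow> ('b \<Rightarrow> 'b \<Rightarrow>\<^sub>0 int) \<Rightarrow>
    ((nat \<Rightarrow> nat \<Rightarrow> nat \<Rightarrow> 'm) \<Rightarrow> (nat \<Rightarrow> nat \<Rightarrow> nat \<Rightarrow> 'm) \<Rightarrow> 'b \<Rightarrow> 's) \<Rightarrow> ((nat \<times> nat) set \<Rightarrow> nat \<Rightarrow> 'b set) \<Rightarrow> bool" where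
  "models M K B d R Q \<longleftrightarrow>
     (\<forall>k. chains K k = free_Abelian_group (B k) \<and> frag_linear (bdry K k)) \<and>
     (\<forall>k. \<forall>s\<in>B k. \<exists>V cf df. mgrid M V cf df \<and> s \<in> R cf df ` Q V k) \<and>
     (\<forall>V cf df k c. mgrid M V cf df \<longrightarrow> c \<in> Q V k \<longrightarrow> R cf df c \<in> B k) \<and>
     (\<forall>V cf df k c. mgrid M V cf df \<longrightarrow> c \<in> Q V (Suc k) \<longrightarrow>
        bdry K k (frag_of (R cf df c)) = frag_map (R cf df) (d c) \<and> supp (d c) \<subseteq> Q V k)"

lemma models_cover:
  assumes "models M K B d R Q" "s \<in> B k"
  obtains V cf df c where "mgrid M V cf df" "c \<in> Q V k" "s = R cf df c"
  using assms unfolding models_def by blast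

lemma models_bdry:
  assumes "models M K B d R Q" "mgrid M V cf df" "c \<in> Q V (Suc k)"
  shows "bdry K k (frag_of (R cf df c)) = frag_map (R cf df) (d c)" "supp (d c) \<subseteq> Q V k"
  using assms unfolding models_def by blast+

lemma models_chains:
  assumes "models M K B d R Q"
  shows "chains K k = free_Abelian_group (B k)" "bdry K k = frag_extend (\<lambda>s. bdry K k (frag_of s))"
    and "mgrid M V cf df \<Longrightarrow> supp u \<subseteq> Q V k \<Longrightarrow> supp (frag_map (R cf df) u) \<subseteq> B k"
proof -
  show "bdry K k = frag_extend (\<lambda>s. bdry K k (frag_of s))"
    by (rule frag_linear_eq) (use assms in \<open>simp add: models_def\<close>)
  assume g: "mgrid M V cf df" and u: "supp u \<subseteq> Q V k"
  have "R cf df c \<in> B k" if "c \<in> supp u" for c using assms g u that unfolding models_def by blast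
  then show "supp (frag_map (R cf df) u) \<subseteq> B k" by (intro keys_frag_extend_subset) simp
qed (use assms in \<open>simp add: models_def\<close>)

lemma models_bdry_image:
  assumes K: "models M K B d R Q" and g: "mgrid M V cf df" and u: "supp u \<subseteq> Q V (Suc k)"
  shows "bdry K k (frag_map (R cf df) u) = frag_map (R cf df) (frag_extend d u)"
proof (rule frag_linear_image)
  show "frag_linear (bdry K k)" using K by (simp add: models_def)
  show "bdry K k (frag_of (R cf df c)) = frag_map (R cf df) (d c)" if "c \<in> supp u" for c
    by (rule models_bdry(1)[OF K g subsetD[OF u that]])
qed

lemma models_complex:
  assumes K: "models M K B d R Q" and dd: "\<And>c. frag_extend d (d c) = 0"
  shows "chain_complex K"
proof (rule chain_complex_freeI[OF models_chains(1,2)[OF K]])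
  fix k s assume "s \<in> B (Suc k)"
  with K obtain V cf df c where g: "mgrid M V cf df" and c: "c \<in> Q V (Suc k)" and s: "s = R cf df c"
    by (rule models_cover)
  show "supp (bdry K k (frag_of s)) \<subseteq> B k"
    unfolding s models_bdry(1)[OF K g c] by (rule models_chains(3)[OF K g models_bdry(2)[OF K g c]])
next
  fix k s assume "s \<in> B (Suc (Suc k))"
  with K obtain V cf df c where g: "mgrid M V cf df" and c: "c \<in> Q V (Suc (Suc k))" and s: "s = R cf df c"
    by (rule models_cover)
  show "frag_extend (\<lambda>s. bdry K k (frag_of s)) (bdry K (Suc k) (frag_of s)) = 0"
    unfolding models_chains(2)[OF K, symmetric] s models_bdry(1)[OF K g c]
      models_bdry_image[OF K g models_bdry(2)[OF K g c]] by (simp add: dd)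
qed

text \<open>\<open>G\<close> is the index form of \<open>\<phi>\<close>. The maps \<open>tc\<close>
  and \<open>td\<close> change the grid: identities for the comparison maps, push-forward for the
  maps induced by a morphism of matched pairs.\<close>

lemma models_chain_map:
  assumes K: "models M K B d R Q" and L: "models M' L B' d' R' Q'" and cc: "chain_complex K" "chain_complex L"
    and lin: "\<And>k. frag_linear (\<phi> k)"
    and grid: "\<And>V cf df. mgrid M V cf df \<Longrightarrow> mgrid M' V (tc cf) (td df)"
    and \<phi>: "\<And>V cf df k c. mgrid M V cf df \<Longrightarrow> c \<in> Q V k \<Longrightarrow> \<phi> k (frag_of (R cf df c)) = frag_map (R' (tc cf) (td df)) (G c)"
    and G: "\<And>V k c. c \<in> Q V k \<Longrightarrow> supp (G c) \<subseteq> Q' V k"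
    and comm: "\<And>V k c. c \<in> Q V (Suc k) \<Longrightarrow> frag_extend G (d c) = frag_extend d' (G c)"
  shows "chain_map K L \<phi>"
proof (rule chain_map_freeI[OF cc models_chains(1)[OF K] models_chains(1)[OF L] models_chains(2)[OF K]
      models_chains(2)[OF L] frag_linear_eq[OF lin]])
  fix k s assume "s \<in> B k"
  with K obtain V cf df c where g: "mgrid M V cf df" and c: "c \<in> Q V k" and s: "s = R cf df c"
    by (rule models_cover)
  show "supp (\<phi> k (frag_of s)) \<subseteq> B' k"
    unfolding s \<phi>[OF g c] by (rule models_chains(3)[OF L grid[OF g] G[OF c]])
next
  fix k s assume "s \<in> B (Suc k)"
  with K obtain V cf df c where g: "mgrid M V cf df" and c: "c \<in> Q V (Suc k)" and s: "s = R cf df c"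
    by (rule models_cover)
  have "\<phi> k (frag_map (R cf df) (d c)) = frag_map (R' (tc cf) (td df)) (frag_extend G (d c))"
    by (rule frag_linear_image[OF lin]) (rule \<phi>[OF g subsetD[OF models_bdry(2)[OF K g c]]])
  then show "frag_extend (\<lambda>s. \<phi> k (frag_of s)) (bdry K k (frag_of s))
    = frag_extend (\<lambda>s. bdry L k (frag_of s)) (\<phi> (Suc k) (frag_of s))"
    unfolding frag_linear_eq[OF lin, symmetric] models_chains(2)[OF L, symmetric]
      s models_bdry(1)[OF K g c] \<phi>[OF g c] models_bdry_image[OF L grid[OF g] G[OF c]] comm[OF c] .
qed

lemma models_square:
  assumes K: "models M K B d R Q"
    and lin: "frag_linear \<phi>" "frag_linear \<psi>" "frag_linear \<phi>'" "frag_linear \<psi>'"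
    and x: "x \<in> carrier (chains K k)"
    and eq: "\<And>V cf df c. mgrid M V cf df \<Longrightarrow> c \<in> Q V k \<Longrightarrow>
      \<psi> (\<phi> (frag_of (R cf df c))) = \<psi>' (\<phi>' (frag_of (R cf df c)))"
  shows "\<psi> (\<phi> x) = \<psi>' (\<phi>' x)"
proof -
  have "(\<psi> \<circ> \<phi>) x = (\<psi>' \<circ> \<phi>') x"
  proof (rule frag_linear_ext[OF frag_linear_comp[OF lin(1,2)] frag_linear_comp[OF lin(3,4)]])
    show "supp x \<subseteq> B k" using x models_chains(1)[OF K] by simp
    fix s assume "s \<in> B k"
    with K obtain V cf df c where "mgrid M V cf df" "c \<in> Q V k" "s = R cf df c" by (rule models_cover)
    then show "(\<psi> \<circ> \<phi>) (frag_of s) = (\<psi>' \<circ> \<phi>') (frag_of s)" using eq by simp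
  qed
  then show ?thesis by simp
qed

lemma keys_shuf_pair: "c \<in> bgrid V k \<Longrightarrow> supp (case c of (l, m) \<Rightarrow> shuf l m) \<subseteq> dgrid V k"
  using keys_shuf_dgrid[of "fst c" "snd c" V k] by (simp add: split_def)

section \<open>Round trips on a grid, and grids rebuilt from their simplices\<close>

context mgrid begin

lemma Nabla_image:
  "supp u \<subseteq> bgrid V l \<Longrightarrow> Nabla M k (frag_map B u)
    = frag_map Bd (frag_extend (\<lambda>(l, m). shuf l m) u)"
  by (rule frag_linear_image[OF frag_linear_maps(1)]) (auto simp: Nabla_B)

lemma Pi_image:
  "supp u \<subseteq> dgrid V l \<Longrightarrow> Pi_map M k (frag_map Bd u) = frag_map N u"
  by (rule frag_linear_image1[OF frag_linear_maps(2)]) (auto simp: Pi_Bd)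

lemma Psi_image:
  "supp u \<subseteq> ngrid V k \<Longrightarrow> Psi_map M k (frag_map N u)
    = frag_map B (frag_extend AW u)"
  by (rule frag_linear_image[OF frag_linear_maps(3)]) (auto simp: Psi_N)

lemma B_tot_basis: "c \<in> bgrid V k \<Longrightarrow> B c \<in> tot_basis M k"
proof -
  assume c: "c \<in> bgrid V k"
  obtain as bs where cc: "c = (as, bs)" by (cases c)
  note g = bgrid_nth[OF c[unfolded cc]]
  have "length as - 1 + (length bs - 1) = k" using g(4-6) by linarith
  then show "B c \<in> tot_basis M k"
    using B_in[OF c[unfolded cc]] by (simp add: cc tot_basis_iff bis_def)
qed

lemma Nabla_B_pair:
  "c \<in> bgrid V l \<Longrightarrow> Nabla M k (frag_of (B c)) = frag_map Bd (case c of (l, m) \<Rightarrow> shuf l m)"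
  using Nabla_B by (cases c) auto

lemma Psi_Pi_Nabla_B:
  assumes c: "c \<in> bgrid V k"
  shows "Psi_map M k (Pi_map M k (Nabla M k (frag_of (B c)))) = frag_map B (Ftot c)"
  unfolding Nabla_B_pair[OF c] Pi_image[OF keys_shuf_pair[OF c]]
    Psi_image[OF order_trans[OF keys_shuf_pair[OF c] dgrid_subset_ngrid]]
  by (simp add: Ftot_def split_def)

lemma Pi_Nabla_Psi_N:
  assumes w: "w \<in> ngrid V k"
  shows "Pi_map M k (Nabla M k (Psi_map M k (frag_of (N w)))) = frag_map N (Fdiag w)"
proof -
  have "supp (Fdiag w) \<subseteq> dgrid V k" by (rule keys_Fdiag_ngrid[OF w])
  then show ?thesis
    using Nabla_image[OF keys_AW_ngrid[OF w]] Pi_image[of "Fdiag w" k] by (simp add: Psi_N[OF w] Fdiag_def)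
qed

lemma Nabla_Psi_Pi_Bd:
  assumes w: "w \<in> dgrid V k"
  shows "Nabla M k (Psi_map M k (Pi_map M k (frag_of (Bd w)))) = frag_map Bd (Fdiag w)"
proof -
  have n: "w \<in> ngrid V k" using w dgrid_subset_ngrid by blast
  show ?thesis
    using Nabla_image[OF keys_AW_ngrid[OF n]] by (simp add: Pi_Bd[OF w] Psi_N[OF n] Fdiag_def)
qed

lemma bhat_C_B:
  assumes "(as, bs) \<in> bgrid V l" "i \<le> i'" "i' < length as"
  shows "bhat_C M (B (as, bs)) i i' = cf (as ! i) (as ! i') (bs ! 0)"
proof (cases "i < i'")
  case True
  then show ?thesis
    using composite_cf[OF assms(1) _ True assms(3), of 0] bgrid_nth(5)[OF assms(1)]
    by (simp add: bhat_C_def bis_def pcomp_def)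
next
  case False
  then have i: "i' = i" using assms by simp
  note g = bgrid_nth[OF assms(1)]
  let ?cs = "csteps cf (bs ! 0) as"
  show ?thesis
  proof (cases "i = 0")
    case True
    have "(if ?cs = [] then cf (last as) (last as) (bs ! 0) else tgt (Lcat M) (hd ?cs)) = cf (as ! 0) (as ! 0) (bs ! 0)"
    proof (cases "length as \<le> 1")
      case True
      then have "last as = as ! 0" using g by (simp add: last_conv_nth)
      then show ?thesis using True by (simp add: steps_eq_Nil)
    next
      case False
      then show ?thesis using g(1)[of 0 0] g(1)[of 1 0] g(2)[of 0 1] g(4,5) by (simp add: steps_eq_Nil hd_steps tgt_cf)
    qed
    then show ?thesis using True by (simp add: i bhat_C_def bis_def pcomp_def)
  next
    case False
    then obtain n where n: "i = Suc n" by (cases i) auto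
    then have "src (Lcat M) (?cs ! (i - 1)) = cf (as ! i) (as ! i) (bs ! 0)"
      using g(1)[of i 0] g(1)[of n 0] g(2)[of n i] g(4,5) assms(3) by (simp add: i src_cf)
    then show ?thesis using False by (simp add: i bhat_C_def bis_def pcomp_def)
  qed
qed

lemma bhat_D_B:
  assumes "(as, bs) \<in> bgrid V l" "j \<le> j'" "j' < length bs"
  shows "bhat_D M (B (as, bs)) j j' = df (last as) (bs ! j) (bs ! j')"
proof -
  note g = bgrid_nth[OF assms(1)]
  have la: "last as = as ! (length as - 1)" using g by (simp add: last_conv_nth)
  have refl: "df (last as) (bs ! j) (bs ! j) = cf (last as) (last as) (bs ! j)" if "j < length bs" for j
    unfolding la by (rule df_refl) (use g that in auto)
  show ?thesis
  proof (cases "j < j'")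
    case True
    then show ?thesis
      using composite_df[OF assms(1) _ True assms(3), of "length as - 1"] g(4) la
      by (simp add: bhat_D_def bis_def pcomp_def)
  next
    case False
    then have j: "j' = j" using assms by simp
    show ?thesis
    proof (cases "j = 0")
      case True
      then show ?thesis using refl[of 0] g(5) by (simp add: j bhat_D_def bis_def pcomp_def)
    next
      case False
      then have "src (Rcat M) (steps (df (last as)) bs ! (j - 1)) = cf (last as) (last as) (bs ! j)"
        unfolding la using g(1)[of "length as - 1" j] g(1)[of "length as - 1" "j - 1"] g(3)[of "j - 1" j] g(4) assms(3)
        by (simp add: j src_df)
      then show ?thesis using False refl[of j] assms(3) by (simp add: j bhat_D_def bis_def pcomp_def)
    qed
  qed
qed

text \<open>Uniqueness of the grid: by \<open>lact_cf\<close> and \<open>ract_cf\<close> the row at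
  height \<open>bs ! 0\<close> and the column at \<open>last as\<close> determine all other
  morphisms, so the rebuilt grid is the given one with indices read through \<open>as\<close> and
  \<open>bs\<close>.\<close>

lemma bhat_B:
  assumes "(as, bs) \<in> bgrid V l"
  shows "i \<le> i' \<Longrightarrow> i' < length as \<Longrightarrow> j < length bs \<Longrightarrow> bhat_cf M (B (as, bs)) i i' j = cf (as ! i) (as ! i') (bs ! j)"
    and "i < length as \<Longrightarrow> j \<le> j' \<Longrightarrow> j' < length bs \<Longrightarrow> bhat_df M (B (as, bs)) i j j' = df (as ! i) (bs ! j) (bs ! j')"
proof -
  note g = bgrid_nth[OF assms]
  have la: "last as = as ! (length as - 1)" using g by (simp add: last_conv_nth)
  have len: "length (fst (B (as, bs))) = length as - 1" by (simp add: bis_def)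
  have v: "as ! i \<le> last as" "(last as, bs ! j) \<in> V" if "i < length as" "j < length bs" for i j
    unfolding la using g that by auto
  {
    assume ij: "i \<le> i'" "i' < length as" "j < length bs"
    have "lact M (cf (as ! i') (last as) (bs ! 0)) (df (last as) (bs ! 0) (bs ! j)) = df (as ! i') (bs ! 0) (bs ! j)"
      by (rule lact_cf) (use ij g v in auto)
    moreover have "ract M (cf (as ! i) (as ! i') (bs ! 0)) (df (as ! i') (bs ! 0) (bs ! j)) = cf (as ! i) (as ! i') (bs ! j)"
      by (rule ract_cf) (use ij g in auto)
    ultimately show "bhat_cf M (B (as, bs)) i i' j = cf (as ! i) (as ! i') (bs ! j)"
      using ij g(4) bhat_C_B[OF assms, of i' "length as - 1"]
      by (simp add: bhat_cf_def len bhat_C_B[OF assms] bhat_D_B[OF assms] la)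
  }
  assume ij: "i < length as" "j \<le> j'" "j' < length bs"
  have "ract M (cf (as ! i) (last as) (bs ! 0)) (df (last as) (bs ! 0) (bs ! j)) = cf (as ! i) (last as) (bs ! j)"
    by (rule ract_cf) (use ij g v in auto)
  moreover have "lact M (cf (as ! i) (last as) (bs ! j)) (df (last as) (bs ! j) (bs ! j')) = df (as ! i) (bs ! j) (bs ! j')"
    by (rule lact_cf) (use ij g v in auto)
  ultimately show "bhat_df M (B (as, bs)) i j j' = df (as ! i) (bs ! j) (bs ! j')"
    using ij g(4) bhat_C_B[OF assms, of i "length as - 1"]
    by (simp add: bhat_df_def len bhat_D_B[OF assms] la)
qed

text \<open>This is the functoriality clause of \<open>realizes\<close>: reading indices in the
  rebuilt grid is reading them through \<open>c\<close> in the given one.\<close>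

lemma bis_bhat_B:
  assumes c: "c \<in> bgrid V l" and e: "e \<in> bgrid (rect (fst (bshape c)) (snd (bshape c))) m"
  shows "bis (bhat_cf M (B c)) (bhat_df M (B c)) e = B (bact c e)"
proof -
  obtain as bs xs ys where ce: "c = (as, bs)" "e = (xs, ys)" by (cases c; cases e)
  note g = bgrid_nth[OF c[unfolded ce]] and h = bgrid_nth[OF e[unfolded ce]]
  have "xs ! s \<le> length as - 1 \<and> ys ! t \<le> length bs - 1" if "s < length xs" "t < length ys" for s t
    using h(1)[OF that] by (auto simp: rect_def bshape_def ce)
  then have lt: "s < length xs \<Longrightarrow> xs ! s < length as" "t < length ys \<Longrightarrow> ys ! t < length bs" for s t
    using h(4,5) g(4,5) by (meson Suc_pred' le_imp_less_Suc less_Suc_eq_le order.strict_trans1 diff_less zero_less_one)+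
  have la: "last xs = xs ! (length xs - 1)" using h by (simp add: last_conv_nth)
  have lm: "last (map ((!) as) xs) = as ! last xs" "map ((!) bs) ys ! 0 = bs ! (ys ! 0)"
    using h by (simp_all add: last_map)
  have "steps (\<lambda>a a'. bhat_cf M (B (as, bs)) a a' (ys ! 0)) xs = steps (\<lambda>a a'. cf (as ! a) (as ! a') (bs ! (ys ! 0))) xs"
    by (rule steps_cong) (use h lt in \<open>auto intro!: bhat_B(1)[OF c[unfolded ce]]\<close>)
  moreover have "steps (bhat_df M (B (as, bs)) (last xs)) ys = steps (\<lambda>b b'. df (as ! last xs) (bs ! b) (bs ! b')) ys"
    unfolding la by (rule steps_cong) (use h lt in \<open>auto intro!: bhat_B(2)[OF c[unfolded ce]]\<close>)
  moreover have "bhat_cf M (B (as, bs)) (last xs) (last xs) (ys ! 0) = cf (as ! last xs) (as ! last xs) (bs ! (ys ! 0))"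
    unfolding la by (rule bhat_B(1)[OF c[unfolded ce]]) (use h lt in auto)
  ultimately show ?thesis by (simp add: ce bis_def bact_def lm steps_map)
qed

lemma bisd_bhat_Bd:
  assumes c: "c \<in> dgrid V l" and e: "e \<in> dgrid (rect (length c - 1) (length c - 1)) m"
  shows "bisd (bhat_cf M (Bd c)) (bhat_df M (Bd c)) e = Bd (dact c e)"
proof -
  have "0 < length c" using c by (simp add: dgrid_def)
  then have lt: "fst x < length c \<and> snd x < length c" if "x \<in> set e" for x
    using dgrid_rect_lt[OF e _ that] by simp
  have "bact (map fst c, map snd c) (map fst e, map snd e) = (map fst (dact c e), map snd (dact c e))"
    using lt by (auto simp: dact_def bact_def)
  moreover have "bis (bhat_cf M (B (map fst c, map snd c))) (bhat_df M (B (map fst c, map snd c))) (map fst e, map snd e)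
    = B (bact (map fst c, map snd c) (map fst e, map snd e))"
    by (rule bis_bhat_B[OF dgrid_bgrid[OF c]]) (use dgrid_bgrid[OF e] in \<open>simp add: bshape_def\<close>)
  ultimately show ?thesis by (simp add: bisd_def)
qed

lemma pcomp_N:
  assumes w: "w \<in> ngrid V l" and ij: "i \<le> j" "j < length w"
  shows "pcomp (zappa_szep M) (fst (N w)) (snd (N w)) i j
    = (df (fst (w ! i)) (snd (w ! i)) (snd (w ! j)), cf (fst (w ! i)) (fst (w ! j)) (snd (w ! j)))"
proof (cases "i < j")
  case True
  then show ?thesis using composite_N[OF w True ij(2)] by (simp add: pcomp_def ner_def)
next
  case False
  then have j: "j = i" using ij by simp
  have V: "(fst (w ! s), snd (w ! t)) \<in> V" if "s \<le> t" "t < length w" for s t using ngrid_nth(1)[OF w that] .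
  have o: "df (fst (w ! i)) (snd (w ! i)) (snd (w ! i)) = cf (fst (w ! i)) (fst (w ! i)) (snd (w ! i))"
    by (rule df_refl) (rule V, use ij in auto)
  show ?thesis
  proof (cases "i = 0")
    case True
    then show ?thesis using o by (simp add: j pcomp_def ner_def)
  next
    case False
    have "src (Lcat M) (cf (fst (w ! (i - 1))) (fst (w ! i)) (snd (w ! i))) = cf (fst (w ! i)) (fst (w ! i)) (snd (w ! i))"
      by (rule src_cf) (use V[of "i - 1" i] V[of i i] ngrid_nth(2)[OF w, of "i - 1" i] ij in auto)
    then show ?thesis using False o ij by (simp add: j pcomp_def ner_def zappa_szep_def)
  qed
qed

text \<open>The functoriality clause for staircases. All edges involved satisfy the inequalities of
  the staircase, within which the partial composites computed in \<open>pcomp_N\<close> determine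
  the grid.\<close>

lemma ner_nhat_N:
  assumes w: "w \<in> ngrid V l" and e: "e \<in> ngrid (stair (length w - 1)) m"
  shows "ner (nhat_cf M (N w)) (nhat_df M (N w)) e = N (dact w e)"
proof -
  have lw: "length w = Suc l" and le: "length e = Suc m" using w e by (auto simp: ngrid_def)
  have v: "(fst (w ! a), snd (w ! b)) \<in> V" "fst (w ! a) \<le> fst (w ! b)" "snd (w ! a) \<le> snd (w ! b)"
    if "a \<le> b" "b \<le> l" for a b using ngrid_nth(1-3)[OF w, of a b] lw that by auto
  have cf: "nhat_cf M (N w) i i' j = cf (fst (w ! i)) (fst (w ! i')) (snd (w ! j))" if "i \<le> i'" "i' \<le> j" "j \<le> l" for i i' j
    using that lw by (simp add: nhat_cf_def pcomp_N[OF w] ract_cf v del: prod.collapse)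
  have df: "nhat_df M (N w) i j j' = df (fst (w ! i)) (snd (w ! j)) (snd (w ! j'))" if "i \<le> j" "j \<le> j'" "j' \<le> l" for i j j'
    using that lw by (simp add: nhat_df_def pcomp_N[OF w] lact_cf v del: prod.collapse)
  have ev: "fst (e ! s) \<le> snd (e ! t)" "snd (e ! t) \<le> l" "fst (e ! s) \<le> fst (e ! t)" "snd (e ! s) \<le> snd (e ! t)"
    if "s \<le> t" "t \<le> m" for s t
    using ngrid_nth(1-3)[OF e, of s t] that le lw by (auto simp: stair_def)
  have "steps (\<lambda>x y. (nhat_df M (N w) (fst x) (snd x) (snd y), nhat_cf M (N w) (fst x) (fst y) (snd y))) e
    = steps (\<lambda>x y. (df (fst (w ! fst x)) (snd (w ! snd x)) (snd (w ! snd y)), cf (fst (w ! fst x)) (fst (w ! fst y)) (snd (w ! snd y)))) e"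
  proof (rule steps_cong)
    fix t assume "Suc t < length e"
    then have t: "Suc t \<le> m" using le by simp
    show "(nhat_df M (N w) (fst (e ! t)) (snd (e ! t)) (snd (e ! Suc t)), nhat_cf M (N w) (fst (e ! t)) (fst (e ! Suc t)) (snd (e ! Suc t)))
      = (df (fst (w ! fst (e ! t))) (snd (w ! snd (e ! t))) (snd (w ! snd (e ! Suc t))),
         cf (fst (w ! fst (e ! t))) (fst (w ! fst (e ! Suc t))) (snd (w ! snd (e ! Suc t))))"
      using ev(1)[of t t] ev[of t "Suc t"] ev(1,2)[of "Suc t" "Suc t"] t by (simp add: cf df)
  qed
  moreover have "nhat_cf M (N w) (fst (e ! 0)) (fst (e ! 0)) (snd (e ! 0)) = cf (fst (w ! fst (e ! 0))) (fst (w ! fst (e ! 0))) (snd (w ! snd (e ! 0)))"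
    using ev(1,2)[of 0 0] by (simp add: cf)
  moreover have "map (map_prod (\<lambda>i. fst (w ! i)) (\<lambda>j. snd (w ! j))) e ! 0 = (fst (w ! fst (e ! 0)), snd (w ! snd (e ! 0)))"
    using le by (simp add: map_prod_def split_def)
  ultimately show ?thesis by (simp add: ner_def dact_def steps_map)
qed

end

section \<open>The complexes and round trips as realizations of the models\<close>

context mpair_locale begin

lemma dgen_fst_snd: "(map fst (dgen k), map snd (dgen k)) = bgen (k, k)"
  by (simp add: dgen_def bgen_def comp_def del: upt_Suc)

lemma bgen_bgrid: "p + q = l \<Longrightarrow> bgen (p, q) \<in> bgrid (rect p q) l"
  by (auto simp: bgen_def bgrid_def rect_def simp del: upt_Suc)

lemma dgen_dgrid: "dgen k \<in> dgrid (rect k k) k"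
  by (auto simp: dgen_def dgrid_def rect_def comp_def simp del: upt_Suc)

lemma dgen_ngrid: "dgen k \<in> ngrid (stair k) k"
  by (auto simp: dgen_def ngrid_def stair_def chain_rel_def sorted_wrt_map sorted_wrt_iff_nth_less simp del: upt_Suc)

lemma models_tot: "models M (tot_complex M) (tot_basis M) ptbd bis bgrid"
proof -
  have "\<exists>V cf df. mgrid M V cf df \<and> s \<in> bis cf df ` bgrid V k" if "s \<in> tot_basis M k" for s k
    using that bhat[of s] bgen_bgrid[of "length (fst s)" "length (snd (snd s))" k]
    unfolding tot_basis_iff by (metis image_eqI)
  then show ?thesis
    unfolding models_def
    by (simp add: chains_simps frag_linear_maps mgrid.tot_bdry_B mgrid.B_tot_basis keys_ptbd_bgrid)
qed

lemma models_diag: "models M (diag_complex M) (\<lambda>k. bisimplices M k k) bd bisd dgrid"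
proof -
  have "\<exists>V cf df. mgrid M V cf df \<and> s \<in> bisd cf df ` dgrid V k" if "s \<in> bisimplices M k k" for s k
    using bhat[OF that] dgen_dgrid unfolding dgen_fst_snd[symmetric] bisd_def[symmetric] by (metis image_eqI)
  then show ?thesis
    unfolding models_def
    by (simp add: chains_simps frag_linear_maps mgrid.diag_bdry_Bd mgrid.Bd_in keys_bd_dgrid)
qed

lemma models_bow: "models M (bowtie_complex M) (nerve (zappa_szep M)) bd ner ngrid"
proof -
  have "\<exists>V cf df. mgrid M V cf df \<and> s \<in> ner cf df ` ngrid V k" if "s \<in> nerve (zappa_szep M) k" for s k
    using nhat[OF that] dgen_ngrid by (metis image_eqI)
  then show ?thesis
    unfolding models_def
    by (simp add: chains_simps frag_linear_maps mgrid.bow_bdry_N mgrid.N_in keys_bd_ngrid)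
qed

lemma chain_complexes: "chain_complex (tot_complex M)" "chain_complex (diag_complex M)" "chain_complex (bowtie_complex M)"
  by (rule models_complex[OF models_tot ptbd_ptbd] models_complex[OF models_diag bd_bd] models_complex[OF models_bow bd_bd])+

lemma chain_map_Nabla: "chain_map (tot_complex M) (diag_complex M) (Nabla M)"
  by (rule models_chain_map[OF models_tot models_diag chain_complexes(1,2) frag_linear_maps(1),
        where tc = "\<lambda>x. x" and td = "\<lambda>x. x" and G = "\<lambda>c. case c of (l, m) \<Rightarrow> shuf l m"])
    (assumption | rule mgrid.Nabla_B_pair keys_shuf_pair ptbd_shuf)+

text \<open>The index form is the identity; what remains is the inclusion of \<open>dgrid\<close> in
  \<open>ngrid\<close>.\<close>

lemma chain_map_Pi: "chain_map (diag_complex M) (bowtie_complex M) (Pi_map M)"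
  by (rule models_chain_map[OF models_diag models_bow chain_complexes(2,3) frag_linear_maps(2),
        where tc = "\<lambda>x. x" and td = "\<lambda>x. x" and G = frag_of])
    (use dgrid_subset_ngrid in \<open>auto simp: mgrid.Pi_Bd\<close>)

lemma chain_map_Psi: "chain_map (bowtie_complex M) (tot_complex M) (Psi_map M)"
  by (rule models_chain_map[OF models_bow models_tot chain_complexes(3,1) frag_linear_maps(3),
        where tc = "\<lambda>x. x" and td = "\<lambda>x. x" and G = AW])
    (assumption | rule mgrid.Psi_N keys_AW_ngrid ptbd_AW[symmetric])+

lemma realizes_tot:
  "tot.realizes (tot_basis M) (\<lambda>k s. bdry (tot_complex M) k (frag_of s))
     (\<lambda>k s. (Psi_map M k \<circ> (Pi_map M k \<circ> Nabla M k)) (frag_of s))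
     (\<lambda>s. bis (bhat_cf M s) (bhat_df M s)) (\<lambda>s. (length (fst s), length (snd (snd s))))"
  unfolding tot.realizes_def fst_conv snd_conv
proof (intro allI ballI conjI)
  fix l s assume "s \<in> tot_basis M l"
  then have s: "s \<in> bisimplices M (length (fst s)) (length (snd (snd s)))" and l: "length (fst s) + length (snd (snd s)) = l"
    by (auto simp: tot_basis_iff)
  note g = bhat(1)[OF s]
  show "bgen (length (fst s), length (snd (snd s))) \<in> bgrid (rect (length (fst s)) (length (snd (snd s)))) l"
    by (rule bgen_bgrid[OF l])
  show "bis (bhat_cf M s) (bhat_df M s) (bgen (length (fst s), length (snd (snd s)))) = s"
    by (rule bhat(2)[OF s])
  {
    fix m c assume c: "c \<in> bgrid (rect (length (fst s)) (length (snd (snd s)))) m"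
    let ?s = "bis (bhat_cf M s) (bhat_df M s) c"
    show "?s \<in> tot_basis M m" by (rule mgrid.B_tot_basis[OF g c])
    show "(length (fst ?s), length (snd (snd ?s))) = bshape c" by (cases c) (simp add: bis_def bshape_def)
    show "(Psi_map M m \<circ> (Pi_map M m \<circ> Nabla M m)) (frag_of ?s) = frag_map (bis (bhat_cf M s) (bhat_df M s)) (Ftot c)"
      unfolding comp_apply by (rule mgrid.Psi_Pi_Nabla_B[OF g c])
    fix n e assume "e \<in> bgrid (rect (fst (bshape c)) (snd (bshape c))) n"
    then show "bis (bhat_cf M ?s) (bhat_df M ?s) e = bis (bhat_cf M s) (bhat_df M s) (bact c e)"
      by (rule mgrid.bis_bhat_B[OF g c])
  }
  fix m c assume c: "c \<in> bgrid (rect (length (fst s)) (length (snd (snd s)))) (Suc m)"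
  show "bdry (tot_complex M) m (frag_of (bis (bhat_cf M s) (bhat_df M s) c))
    = frag_map (bis (bhat_cf M s) (bhat_df M s)) (ptbd c)"
    by (rule mgrid.tot_bdry_B[OF g c])
qed

lemma realizes_diag:
  "diag.realizes (\<lambda>k. bisimplices M k k) (\<lambda>k s. bdry (diag_complex M) k (frag_of s))
     (\<lambda>k s. (Nabla M k \<circ> (Psi_map M k \<circ> Pi_map M k)) (frag_of s))
     (\<lambda>s. bisd (bhat_cf M s) (bhat_df M s)) (\<lambda>s. length (fst s))"
  unfolding diag.realizes_def
proof (intro allI ballI conjI)
  fix l s assume s: "s \<in> bisimplices M l l"
  have l: "length (fst s) = l" using s by (auto simp: bisimplices_def)
  note g = bhat(1)[OF s]
  show "dgen (length (fst s)) \<in> dgrid (rect (length (fst s)) (length (fst s))) l"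
    unfolding l by (rule dgen_dgrid)
  show "bisd (bhat_cf M s) (bhat_df M s) (dgen (length (fst s))) = s"
    unfolding l bisd_def dgen_fst_snd by (rule bhat(2)[OF s])
  {
    fix m c assume "c \<in> dgrid (rect (length (fst s)) (length (fst s))) m"
    then have c: "c \<in> dgrid (rect l l) m" by (simp add: l)
    let ?s = "bisd (bhat_cf M s) (bhat_df M s) c"
    show "?s \<in> bisimplices M m m" by (rule mgrid.Bd_in[OF g c])
    show "length (fst ?s) = length c - 1" by (simp add: bisd_def bis_def)
    show "(Nabla M m \<circ> (Psi_map M m \<circ> Pi_map M m)) (frag_of ?s) = frag_map (bisd (bhat_cf M s) (bhat_df M s)) (Fdiag c)"
      unfolding comp_apply by (rule mgrid.Nabla_Psi_Pi_Bd[OF g c])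
    fix n e assume "e \<in> dgrid (rect (length c - 1) (length c - 1)) n"
    then show "bisd (bhat_cf M ?s) (bhat_df M ?s) e = bisd (bhat_cf M s) (bhat_df M s) (dact c e)"
      by (rule mgrid.bisd_bhat_Bd[OF g c])
  }
  fix m c assume "c \<in> dgrid (rect (length (fst s)) (length (fst s))) (Suc m)"
  then have c: "c \<in> dgrid (rect l l) (Suc m)" by (simp add: l)
  show "bdry (diag_complex M) m (frag_of (bisd (bhat_cf M s) (bhat_df M s) c))
    = frag_map (bisd (bhat_cf M s) (bhat_df M s)) (bd c)"
    by (rule mgrid.diag_bdry_Bd[OF g c])
qed

lemma realizes_bow:
  "bow.realizes (nerve (zappa_szep M)) (\<lambda>k s. bdry (bowtie_complex M) k (frag_of s))
     (\<lambda>k s. (Pi_map M k \<circ> (Nabla M k \<circ> Psi_map M k)) (frag_of s))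
     (\<lambda>s. ner (nhat_cf M s) (nhat_df M s)) (\<lambda>s. length (snd s))"
  unfolding bow.realizes_def
proof (intro allI ballI conjI)
  fix l s assume s: "s \<in> nerve (zappa_szep M) l"
  have l: "length (snd s) = l" using s by (auto simp: nerve_def)
  note g = nhat(1)[OF s]
  show "dgen (length (snd s)) \<in> ngrid (stair (length (snd s))) l"
    unfolding l by (rule dgen_ngrid)
  show "ner (nhat_cf M s) (nhat_df M s) (dgen (length (snd s))) = s"
    unfolding l by (rule nhat(2)[OF s])
  {
    fix m c assume "c \<in> ngrid (stair (length (snd s))) m"
    then have c: "c \<in> ngrid (stair l) m" by (simp add: l)
    let ?s = "ner (nhat_cf M s) (nhat_df M s) c"
    show "?s \<in> nerve (zappa_szep M) m" by (rule mgrid.N_in[OF g c])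
    show "length (snd ?s) = length c - 1" by (simp add: ner_def)
    show "(Pi_map M m \<circ> (Nabla M m \<circ> Psi_map M m)) (frag_of ?s) = frag_map (ner (nhat_cf M s) (nhat_df M s)) (Fdiag c)"
      unfolding comp_apply by (rule mgrid.Pi_Nabla_Psi_N[OF g c])
    fix n e assume "e \<in> ngrid (stair (length c - 1)) n"
    then show "ner (nhat_cf M ?s) (nhat_df M ?s) e = ner (nhat_cf M s) (nhat_df M s) (dact c e)"
      by (rule mgrid.ner_nhat_N[OF g c])
  }
  fix m c assume "c \<in> ngrid (stair (length (snd s))) (Suc m)"
  then have c: "c \<in> ngrid (stair l) (Suc m)" by (simp add: l)
  show "bdry (bowtie_complex M) m (frag_of (ner (nhat_cf M s) (nhat_df M s) c))
    = frag_map (ner (nhat_cf M s) (nhat_df M s)) (bd c)"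
    by (rule mgrid.bow_bdry_N[OF g c])
qed

end

text \<open>Precomposition reverses the order, so the first map of a round trip on chains acts last
  in cohomology.\<close>

lemma cohomology_map_comp3:
  assumes A: "comm_group A" and f: "chain_map K L \<phi>" and g: "chain_map L N \<psi>" and h: "chain_map N K \<chi>"
    and X: "X \<in> carrier (cohomology A K n)"
  shows "cohomology_map A K K (\<lambda>n. \<chi> n \<circ> (\<psi> n \<circ> \<phi> n)) n X
    = cohomology_map A K L \<phi> n (cohomology_map A L N \<psi> n (cohomology_map A N K \<chi> n X))"
proof -
  interpret h: coefficient_map A N K \<chi> by (rule coefficient_map.intro[OF A h])
  have "cohomology_map A N K \<chi> n X \<in> carrier (cohomology A N n)"
    using h.cohomology_map_hom[of n] X by (auto simp: hom_def)
  then have "cohomology_map A K N (\<lambda>n. \<psi> n \<circ> \<phi> n) n (cohomology_map A N K \<chi> n X)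
    = cohomology_map A K L \<phi> n (cohomology_map A L N \<psi> n (cohomology_map A N K \<chi> n X))"
    by (intro cohomology_map_comp[OF A f g chain_map_comp[OF f g]]) auto
  moreover have "cohomology_map A K K (\<lambda>n. \<chi> n \<circ> (\<psi> n \<circ> \<phi> n)) n X
    = cohomology_map A K N (\<lambda>n. \<psi> n \<circ> \<phi> n) n (cohomology_map A N K \<chi> n X)"
    by (intro cohomology_map_comp[OF A chain_map_comp[OF f g] h chain_map_comp[OF chain_map_comp[OF f g] h]] X) simp
  ultimately show ?thesis by simp
qed

lemma cohomology_map_square:
  assumes A: "comm_group A" and f: "chain_map K L \<phi>" and g: "chain_map L N \<psi>"
    and f': "chain_map K L' \<phi>'" and g': "chain_map L' N \<psi>'"
    and eq: "\<And>x. x \<in> carrier (chains K n) \<Longrightarrow> \<psi> n (\<phi> n x) = \<psi>' n (\<phi>' n x)"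
    and X: "X \<in> carrier (cohomology A N n)"
  shows "cohomology_map A K L \<phi> n (cohomology_map A L N \<psi> n X) = cohomology_map A K L' \<phi>' n (cohomology_map A L' N \<psi>' n X)"
proof -
  have "cohomology_map A K N (\<lambda>n. \<psi> n \<circ> \<phi> n) n X = cohomology_map A K L \<phi> n (cohomology_map A L N \<psi> n X)"
    by (intro cohomology_map_comp[OF A f g chain_map_comp[OF f g]] X) simp
  moreover have "cohomology_map A K N (\<lambda>n. \<psi> n \<circ> \<phi> n) n X = cohomology_map A K L' \<phi>' n (cohomology_map A L' N \<psi>' n X)"
    by (intro cohomology_map_comp[OF A f' g' chain_map_comp[OF f g]] X) (simp add: eq)
  ultimately show ?thesis by simp
qed

context mpair_locale begin

lemma cohomology_composites:
  assumes A: "comm_group A"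
  shows "X \<in> carrier (H_bowtie A M n) \<Longrightarrow> Psi_star A M n (Nabla_star A M n (Pi_star A M n X)) = X"
    and "Y \<in> carrier (H_diag A M n) \<Longrightarrow> Pi_star A M n (Psi_star A M n (Nabla_star A M n Y)) = Y"
    and "Z \<in> carrier (H_tot A M n) \<Longrightarrow> Nabla_star A M n (Pi_star A M n (Psi_star A M n Z)) = Z"
proof -
  note maps = chain_map_Nabla chain_map_Pi chain_map_Psi
  have lin: "frag_linear (Pi_map M k \<circ> (Nabla M k \<circ> Psi_map M k))"
      "frag_linear (Nabla M k \<circ> (Psi_map M k \<circ> Pi_map M k))"
      "frag_linear (Psi_map M k \<circ> (Pi_map M k \<circ> Nabla M k))" for k
    by (intro frag_linear_comp frag_linear_maps)+
  show "Psi_star A M n (Nabla_star A M n (Pi_star A M n X)) = X" if "X \<in> carrier (H_bowtie A M n)"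
    using cohomology_map_comp3[OF A maps(3,1,2) that]
      bow.cohomology_map_realization[OF realizes_bow A chain_map_comp[OF chain_map_comp[OF maps(3,1)] maps(2)]
        chains_simps(3) frag_linear_eq[OF frag_linear_maps(6)] frag_linear_eq[OF lin(1)] that] by simp
  show "Pi_star A M n (Psi_star A M n (Nabla_star A M n Y)) = Y" if "Y \<in> carrier (H_diag A M n)"
    using cohomology_map_comp3[OF A maps(2,3,1) that]
      diag.cohomology_map_realization[OF realizes_diag A chain_map_comp[OF chain_map_comp[OF maps(2,3)] maps(1)]
        chains_simps(2) frag_linear_eq[OF frag_linear_maps(5)] frag_linear_eq[OF lin(2)] that] by simp
  show "Nabla_star A M n (Pi_star A M n (Psi_star A M n Z)) = Z" if "Z \<in> carrier (H_tot A M n)"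
    using cohomology_map_comp3[OF A maps(1,2,3) that]
      tot.cohomology_map_realization[OF realizes_tot A chain_map_comp[OF chain_map_comp[OF maps(1,2)] maps(3)]
        chains_simps(1) frag_linear_eq[OF frag_linear_maps(4)] frag_linear_eq[OF lin(3)] that] by simp
qed

text \<open>The round trips through the source and through the target of a map give its injectivity
  and surjectivity, so each isomorphism takes two of the three composites.\<close>

lemma comparison_isos:
  assumes A: "comm_group A"
  shows "Pi_star A M n \<in> iso (H_bowtie A M n) (H_diag A M n)"
    and "Nabla_star A M n \<in> iso (H_diag A M n) (H_tot A M n)"
    and "Psi_star A M n \<in> iso (H_tot A M n) (H_bowtie A M n)"
proof -
  have P: "Pi_star A M n \<in> hom (H_bowtie A M n) (H_diag A M n)"
    by (rule coefficient_map.cohomology_map_hom[OF coefficient_map.intro[OF A chain_map_Pi]])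
  have N: "Nabla_star A M n \<in> hom (H_diag A M n) (H_tot A M n)"
    by (rule coefficient_map.cohomology_map_hom[OF coefficient_map.intro[OF A chain_map_Nabla]])
  have S: "Psi_star A M n \<in> hom (H_tot A M n) (H_bowtie A M n)"
    by (rule coefficient_map.cohomology_map_hom[OF coefficient_map.intro[OF A chain_map_Psi]])
  note c = cohomology_composites[OF A]
  show "Pi_star A M n \<in> iso (H_bowtie A M n) (H_diag A M n)"
    by (rule iso_if_cyclic_id[OF P N S c(1,2)])
  show "Nabla_star A M n \<in> iso (H_diag A M n) (H_tot A M n)"
    by (rule iso_if_cyclic_id[OF N S P c(2,3)])
  show "Psi_star A M n \<in> iso (H_tot A M n) (H_bowtie A M n)"
    by (rule iso_if_cyclic_id[OF S P N c(3,1)])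
qed

end

section \<open>Naturality\<close>

locale mpair_morph =
  fixes M :: "'a mpair" and M' :: "'b mpair" and f :: "('a, 'b) mpair_map"
  assumes morph: "mpair_morphism M M' f"
begin

sublocale M: mpair_locale M
  using morph by unfold_locales (simp add: mpair_morphism_def)

sublocale M': mpair_locale M'
  using morph by unfold_locales (simp add: mpair_morphism_def)

lemma bisimplex_push_bisd:
  "bisimplex_push f k (frag_of (bisd cf df w)) = frag_of (bisd (push_cf f cf) (push_df f df) w)"
  by (simp add: bisd_def bisimplex_push_bis)

lemma push_tot: "chain_map (tot_complex M) (tot_complex M') (bisimplex_push f)"
  by (rule models_chain_map[OF M.models_tot M'.models_tot M.chain_complexes(1) M'.chain_complexes(1) frag_linear_maps(8),
        where tc = "push_cf f" and td = "push_df f" and G = frag_of])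
    (simp_all add: mgrid_push(1)[OF morph] bisimplex_push_bis)

lemma push_diag: "chain_map (diag_complex M) (diag_complex M') (bisimplex_push f)"
  by (rule models_chain_map[OF M.models_diag M'.models_diag M.chain_complexes(2) M'.chain_complexes(2) frag_linear_maps(8),
        where tc = "push_cf f" and td = "push_df f" and G = frag_of])
    (simp_all add: mgrid_push(1)[OF morph] bisimplex_push_bisd)

lemma push_bowtie: "chain_map (bowtie_complex M) (bowtie_complex M') (bowtie_push f)"
  by (rule models_chain_map[OF M.models_bow M'.models_bow M.chain_complexes(3) M'.chain_complexes(3) frag_linear_maps(7),
        where tc = "push_cf f" and td = "push_df f" and G = frag_of])
    (simp_all add: mgrid_push(1)[OF morph] bowtie_push_ner[OF morph])

text \<open>Both sides read the same index list off the pushed grid; \<open>Nabla_natural\<close>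
  and \<open>Psi_natural\<close> hold for the same reason.\<close>

lemma Pi_natural:
  assumes "x \<in> carrier (chains (diag_complex M) k)"
  shows "bowtie_push f k (Pi_map M k x) = Pi_map M' k (bisimplex_push f k x)"
proof (rule models_square[OF M.models_diag frag_linear_maps(2) frag_linear_maps(7) frag_linear_maps(8) frag_linear_maps(2) assms])
  fix V cf df w assume g: "mgrid M V cf df" and w: "w \<in> dgrid V k"
  show "bowtie_push f k (Pi_map M k (frag_of (bisd cf df w))) = Pi_map M' k (bisimplex_push f k (frag_of (bisd cf df w)))"
    unfolding mgrid.Pi_Bd[OF g w] bowtie_push_ner[OF morph g subsetD[OF dgrid_subset_ngrid w]]
      bisimplex_push_bisd mgrid.Pi_Bd[OF mgrid_push(1)[OF morph g] w] ..
qed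

lemma Nabla_natural:
  assumes "x \<in> carrier (chains (tot_complex M) k)"
  shows "bisimplex_push f k (Nabla M k x) = Nabla M' k (bisimplex_push f k x)"
proof (rule models_square[OF M.models_tot frag_linear_maps(1) frag_linear_maps(8) frag_linear_maps(8) frag_linear_maps(1) assms])
  fix V cf df c assume g: "mgrid M V cf df" and c: "c \<in> bgrid V k"
  show "bisimplex_push f k (Nabla M k (frag_of (bis cf df c))) = Nabla M' k (bisimplex_push f k (frag_of (bis cf df c)))"
    unfolding mgrid.Nabla_B_pair[OF g c] frag_linear_image1[OF frag_linear_maps(8) bisimplex_push_bisd]
      bisimplex_push_bis mgrid.Nabla_B_pair[OF mgrid_push(1)[OF morph g] c] ..
qed

lemma Psi_natural:
  assumes "x \<in> carrier (chains (bowtie_complex M) k)"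
  shows "bisimplex_push f k (Psi_map M k x) = Psi_map M' k (bowtie_push f k x)"
proof (rule models_square[OF M.models_bow frag_linear_maps(3) frag_linear_maps(8) frag_linear_maps(7) frag_linear_maps(3) assms])
  fix V cf df w assume g: "mgrid M V cf df" and w: "w \<in> ngrid V k"
  show "bisimplex_push f k (Psi_map M k (frag_of (ner cf df w))) = Psi_map M' k (bowtie_push f k (frag_of (ner cf df w)))"
    unfolding mgrid.Psi_N[OF g w] frag_linear_image1[OF frag_linear_maps(8) bisimplex_push_bis]
      bowtie_push_ner[OF morph g w] mgrid.Psi_N[OF mgrid_push(1)[OF morph g] w] ..
qed

end

lemma push_id:
  "bowtie_push mpair_id k x = x" "bisimplex_push mpair_id k y = y"
  by (simp_all add: bowtie_push_def bisimplex_push_def mpair_id_def split_def prod.map_id0 list.map_id0)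

lemma push_comp:
  "bowtie_push (mpair_comp g f) k x = bowtie_push g k (bowtie_push f k x)"
  "bisimplex_push (mpair_comp g f) k y = bisimplex_push g k (bisimplex_push f k y)"
  by (simp_all add: bowtie_push_def bisimplex_push_def mpair_comp_def split_def frag_extend_frag_extend
      map_prod.comp[symmetric] comp_def map_prod_def)

lemma chain_map_ident: "chain_complex K \<Longrightarrow> (\<And>k x. \<phi> k x = x) \<Longrightarrow> chain_map K K \<phi>"
  by (auto simp: chain_map_def hom_def)

theorem corollary5p4:
  fixes A :: "('g, 'm) monoid_scheme"
  assumes A: "comm_group A"
  shows
    "\<comment> \<open>the three cohomologies are contravariant functors on matched pairs\<close>
    (\<forall>(M :: 'a mpair) (M' :: 'b mpair) f n. mpair_morphism M M' f \<longrightarrow>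
       H_bowtie_map A M M' f n \<in> hom (H_bowtie A M' n) (H_bowtie A M n) \<and>
       H_diag_map A M M' f n \<in> hom (H_diag A M' n) (H_diag A M n) \<and>
       H_tot_map A M M' f n \<in> hom (H_tot A M' n) (H_tot A M n)) \<and>
    (\<forall>(M :: 'a mpair) n. is_matched_pair M \<longrightarrow>
       (\<forall>X\<in>carrier (H_bowtie A M n). H_bowtie_map A M M mpair_id n X = X) \<and>
       (\<forall>X\<in>carrier (H_diag A M n). H_diag_map A M M mpair_id n X = X) \<and>
       (\<forall>X\<in>carrier (H_tot A M n). H_tot_map A M M mpair_id n X = X)) \<and>
    (\<forall>(M :: 'a mpair) (M' :: 'b mpair) (M'' :: 'c mpair) f g n.
       mpair_morphism M M' f \<and> mpair_morphism M' M'' g \<longrightarrow>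
       (\<forall>X\<in>carrier (H_bowtie A M'' n).
          H_bowtie_map A M M'' (mpair_comp g f) n X =
          H_bowtie_map A M M' f n (H_bowtie_map A M' M'' g n X)) \<and>
       (\<forall>X\<in>carrier (H_diag A M'' n).
          H_diag_map A M M'' (mpair_comp g f) n X =
          H_diag_map A M M' f n (H_diag_map A M' M'' g n X)) \<and>
       (\<forall>X\<in>carrier (H_tot A M'' n).
          H_tot_map A M M'' (mpair_comp g f) n X =
          H_tot_map A M M' f n (H_tot_map A M' M'' g n X))) \<and>
    \<comment> \<open>the comparison maps are chain maps\<close>
    (\<forall>M :: 'a mpair. is_matched_pair M \<longrightarrow>
       chain_map (tot_complex M) (diag_complex M) (Nabla M) \<and>
       chain_map (diag_complex M) (bowtie_complex M) (Pi_map M) \<and>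
       chain_map (bowtie_complex M) (tot_complex M) (Psi_map M)) \<and>
    \<comment> \<open>their duals induce isomorphisms\<close>
    (\<forall>(M :: 'a mpair) n. is_matched_pair M \<longrightarrow>
       Pi_star A M n \<in> iso (H_bowtie A M n) (H_diag A M n) \<and>
       Nabla_star A M n \<in> iso (H_diag A M n) (H_tot A M n) \<and>
       Psi_star A M n \<in> iso (H_tot A M n) (H_bowtie A M n)) \<and>
    \<comment> \<open>which are natural\<close>
    (\<forall>(M :: 'a mpair) (M' :: 'b mpair) f n. mpair_morphism M M' f \<longrightarrow>
       (\<forall>X\<in>carrier (H_bowtie A M' n).
          Pi_star A M n (H_bowtie_map A M M' f n X) = H_diag_map A M M' f n (Pi_star A M' n X)) \<and>
       (\<forall>X\<in>carrier (H_diag A M' n).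
          Nabla_star A M n (H_diag_map A M M' f n X) = H_tot_map A M M' f n (Nabla_star A M' n X)) \<and>
       (\<forall>X\<in>carrier (H_tot A M' n).
          Psi_star A M n (H_tot_map A M M' f n X) = H_bowtie_map A M M' f n (Psi_star A M' n X)))"
proof (intro conjI allI impI ballI)
  fix M :: "'a mpair" and M' :: "'b mpair" and f n
  assume "mpair_morphism M M' f"
  then interpret mpair_morph M M' f by unfold_locales
  note hom = coefficient_map.cohomology_map_hom[OF coefficient_map.intro[OF A]]
  show "H_bowtie_map A M M' f n \<in> hom (H_bowtie A M' n) (H_bowtie A M n)" by (rule hom[OF push_bowtie])
  show "H_diag_map A M M' f n \<in> hom (H_diag A M' n) (H_diag A M n)" by (rule hom[OF push_diag])
  show "H_tot_map A M M' f n \<in> hom (H_tot A M' n) (H_tot A M n)" by (rule hom[OF push_tot])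
next
  fix M :: "'a mpair" and n
  assume "is_matched_pair M"
  then interpret mpair_locale M by unfold_locales
  note ident = cohomology_map_ident[OF A chain_map_ident]
  show "H_bowtie_map A M M mpair_id n X = X" if "X \<in> carrier (H_bowtie A M n)" for X
    by (rule ident[OF chain_complexes(3) push_id(1) push_id(1) that])
  show "H_diag_map A M M mpair_id n X = X" if "X \<in> carrier (H_diag A M n)" for X
    by (rule ident[OF chain_complexes(2) push_id(2) push_id(2) that])
  show "H_tot_map A M M mpair_id n X = X" if "X \<in> carrier (H_tot A M n)" for X
    by (rule ident[OF chain_complexes(1) push_id(2) push_id(2) that])
next
  fix M :: "'a mpair" and M' :: "'b mpair" and M'' :: "'c mpair" and f g n
  assume fg: "mpair_morphism M M' f \<and> mpair_morphism M' M'' g"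
  then interpret f: mpair_morph M M' f by unfold_locales simp
  from fg interpret g: mpair_morph M' M'' g by unfold_locales simp
  \<comment> \<open>Here the push-forward along a composite equals the composite as a function, not
    merely on chains, so it can be rewritten inside \<open>cohomology_map\<close>.\<close>
  have eq: "bowtie_push (mpair_comp g f) = (\<lambda>k. bowtie_push g k \<circ> bowtie_push f k)"
    "bisimplex_push (mpair_comp g f) = (\<lambda>k. bisimplex_push g k \<circ> bisimplex_push f k)"
    by (auto simp: fun_eq_iff push_comp)
  note comp = cohomology_map_comp[OF A _ _ chain_map_comp]
  show "H_bowtie_map A M M'' (mpair_comp g f) n X = H_bowtie_map A M M' f n (H_bowtie_map A M' M'' g n X)"
    if "X \<in> carrier (H_bowtie A M'' n)" for X
    unfolding eq by (rule comp[OF f.push_bowtie g.push_bowtie f.push_bowtie g.push_bowtie _ that]) simp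
  show "H_diag_map A M M'' (mpair_comp g f) n X = H_diag_map A M M' f n (H_diag_map A M' M'' g n X)"
    if "X \<in> carrier (H_diag A M'' n)" for X
    unfolding eq by (rule comp[OF f.push_diag g.push_diag f.push_diag g.push_diag _ that]) simp
  show "H_tot_map A M M'' (mpair_comp g f) n X = H_tot_map A M M' f n (H_tot_map A M' M'' g n X)"
    if "X \<in> carrier (H_tot A M'' n)" for X
    unfolding eq by (rule comp[OF f.push_tot g.push_tot f.push_tot g.push_tot _ that]) simp
next
  fix M :: "'a mpair"
  assume "is_matched_pair M"
  then interpret mpair_locale M by unfold_locales
  show "chain_map (tot_complex M) (diag_complex M) (Nabla M)"
    "chain_map (diag_complex M) (bowtie_complex M) (Pi_map M)"
    "chain_map (bowtie_complex M) (tot_complex M) (Psi_map M)"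
    by (rule chain_map_Nabla chain_map_Pi chain_map_Psi)+
next
  fix M :: "'a mpair" and n
  assume "is_matched_pair M"
  then interpret mpair_locale M by unfold_locales
  show "Pi_star A M n \<in> iso (H_bowtie A M n) (H_diag A M n)"
    "Nabla_star A M n \<in> iso (H_diag A M n) (H_tot A M n)"
    "Psi_star A M n \<in> iso (H_tot A M n) (H_bowtie A M n)"
    by (rule comparison_isos[OF A])+
next
  fix M :: "'a mpair" and M' :: "'b mpair" and f n
  assume "mpair_morphism M M' f"
  then interpret mpair_morph M M' f by unfold_locales
  note square = cohomology_map_square[OF A]
  show "Pi_star A M n (H_bowtie_map A M M' f n X) = H_diag_map A M M' f n (Pi_star A M' n X)"
    if "X \<in> carrier (H_bowtie A M' n)" for X
    by (rule square[OF M.chain_map_Pi push_bowtie push_diag M'.chain_map_Pi Pi_natural that])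
  show "Nabla_star A M n (H_diag_map A M M' f n X) = H_tot_map A M M' f n (Nabla_star A M' n X)"
    if "X \<in> carrier (H_diag A M' n)" for X
    by (rule square[OF M.chain_map_Nabla push_diag push_tot M'.chain_map_Nabla Nabla_natural that])
  show "Psi_star A M n (H_tot_map A M M' f n X) = H_bowtie_map A M M' f n (Psi_star A M' n X)"
    if "X \<in> carrier (H_tot A M' n)" for X
    by (rule square[OF M.chain_map_Psi push_tot push_bowtie M'.chain_map_Psi Psi_natural that])
qed

end
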